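(* Under the standing hypotheses (H1)–(H6) below, a linear relation $S\subseteq T_{\max}$ is self-adjoint in $L^2((a,b);\varrho)$ if and only if $$S=\{f\in T_{\max}\,:\, W_a^b(f,g^\ast)=0\ \text{for all } g\in S\}.$$
   Context: Let $-\infty\le a<b\le\infty$ and $\varrho,\varsigma,\chi$ locally finite Borel measures on $(a,b)$ with: (H1) $\varrho$ positive; (H2) $\chi$ real-valued; (H3) $\varsigma$ real-valued with $\operatorname{supp}\varsigma=(a,b)$; (H4) $\varsigma(\{x\})\chi(\{x\})=\varsigma(\{x\})\varrho(\{x\})=0$ for all $x$; (H5) for every gap $(\alpha,\beta)$ of $\operatorname{supp}\varrho$ (open interval in the complement with $\alpha,\beta\in\operatorname{supp}\varrho$) and every $f\in\mathfrak{D}_\tau$ with $f(\alpha-)=f(\beta+)=0$ one has $f=0$ on $(\alpha,\beta)$; (H6) $\operatorname{supp}\varrho$ has more than one point. Notation: $\int_c^x h\,d\mu=\int_{[c,x)}h\,d\mu$ ($x>c$), $0$ ($x=c$), $-\int_{[x,c)}h\,d\mu$ ($x<c$); $AC_{loc}((a,b);\mu)$: functions $f(x)=f(c)+\int_c^x h\,d\mu$, $h=\frac{df}{d\mu}\in L^1_{loc}$. $\mathfrak{D}_\tau$: $f\in AC_{loc}((a,b);\varsigma)$ for which there is $F\in AC_{loc}((a,b);\varrho)$ with $F=-\frac{df}{d\varsigma}+\int_c^{\cdot}f\,d\chi$ $|\varsigma|$-a.e.; $\tau f:=\frac{dF}{d\varrho}$, $f^{[1]}:=\int_c^{\cdot}f\,d\chi-F$,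 $W(f,g)=fg^{[1]}-f^{[1]}g$. In $L^2((a,b);\varrho)$ (inner product $\langle f,g\rangle=\int g^\ast f\,d\varrho$): $T_{\max}=\{(f,\tau f): f\in\mathfrak{D}_\tau,\ f,\tau f\in L^2\}$; elements of $T_{\max}$ are identified with functions in $\mathfrak{D}_\tau$ (the map $f\mapsto(f,\tau f)$ is injective), and $f^\ast$ denotes complex conjugation (with $f\in T_{\max}\Rightarrow f^\ast\in T_{\max}$). For $f,g\in T_{\max}$ the limits $W(f,g)(a)=\lim_{x\downarrow a}W(f,g)(x)$, $W(f,g)(b)=\lim_{x\uparrow b}W(f,g)(x)$ exist, and $W_a^b(f,g)=W(f,g)(b)-W(f,g)(a)$. A linear relation $S$ is self-adjoint if $S=S^\ast$, where $S^\ast=\{(f,g):\langle f,v\rangle=\langle g,u\rangle\ \forall(u,v)\in S\}$. *)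

theory Defs
  imports "HOL-Analysis.Analysis"
begin

definition Iab :: "ereal \<Rightarrow> ereal \<Rightarrow> real set" where
  "Iab a b = {x::real. a < ereal x \<and> ereal x < b}"

text \<open>A positive locally finite Borel measure on (a,b) (represented as a Borel
  measure on the reals; only its restriction to (a,b) is ever used).\<close>
definition locfin :: "ereal \<Rightarrow> ereal \<Rightarrow> real measure \<Rightarrow> bool" where
  "locfin a b M \<longleftrightarrow> sets M = sets borel \<and>
     (\<forall>K. compact K \<and> K \<subseteq> Iab a b \<longrightarrow> emeasure M K < \<infinity>)"

text \<open>A real-valued locally finite Borel measure on (a,b), represented by its
  Jordan decomposition (P,N): two mutually singular positive locally finite
  measures, the signed measure being P - N and its variation |.| being P + N.\<close>
type_synonym smeasure = "real measure \<times> real measure"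

definition real_lf_measure :: "ereal \<Rightarrow> ereal \<Rightarrow> smeasure \<Rightarrow> bool" where
  "real_lf_measure a b \<mu> \<longleftrightarrow> locfin a b (fst \<mu>) \<and> locfin a b (snd \<mu>) \<and>
     (\<exists>A\<in>sets borel. emeasure (fst \<mu>) (Iab a b - A) = 0 \<and> emeasure (snd \<mu>) (Iab a b \<inter> A) = 0)"

definition smass :: "smeasure \<Rightarrow> real \<Rightarrow> real" where
  "smass \<mu> x = measure (fst \<mu>) {x} - measure (snd \<mu>) {x}"

definition psupp :: "ereal \<Rightarrow> ereal \<Rightarrow> real measure \<Rightarrow> real set" where
  "psupp a b M = {x \<in> Iab a b. \<forall>e>0. emeasure M (ball x e \<inter> Iab a b) > 0}"

definition ssupp :: "ereal \<Rightarrow> ereal \<Rightarrow> smeasure \<Rightarrow> real set" where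
  "ssupp a b \<mu> = {x \<in> Iab a b. \<forall>e>0.
      emeasure (fst \<mu>) (ball x e \<inter> Iab a b) + emeasure (snd \<mu>) (ball x e \<inter> Iab a b) > 0}"

definition pint :: "real measure \<Rightarrow> real set \<Rightarrow> (real \<Rightarrow> complex) \<Rightarrow> complex" where
  "pint M S h = set_lebesgue_integral M S h"

definition sint :: "smeasure \<Rightarrow> real set \<Rightarrow> (real \<Rightarrow> complex) \<Rightarrow> complex" where
  "sint \<mu> S h = set_lebesgue_integral (fst \<mu>) S h - set_lebesgue_integral (snd \<mu>) S h"

definition oint :: "(real set \<Rightarrow> (real \<Rightarrow> complex) \<Rightarrow> complex) \<Rightarrow> real \<Rightarrow> real \<Rightarrow> (real \<Rightarrow> complex) \<Rightarrow> complex" where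
  "oint J c x h = (if c < x then J {c..<x} h else if x = c then 0 else - J {x..<c} h)"

definition ploc_int :: "ereal \<Rightarrow> ereal \<Rightarrow> real measure \<Rightarrow> (real \<Rightarrow> complex) \<Rightarrow> bool" where
  "ploc_int a b M h \<longleftrightarrow> (\<forall>K. compact K \<and> K \<subseteq> Iab a b \<longrightarrow> set_integrable M K h)"

definition sloc_int :: "ereal \<Rightarrow> ereal \<Rightarrow> smeasure \<Rightarrow> (real \<Rightarrow> complex) \<Rightarrow> bool" where
  "sloc_int a b \<mu> h \<longleftrightarrow> ploc_int a b (fst \<mu>) h \<and> ploc_int a b (snd \<mu>) h"

text \<open>\<open>f \<in> AC_loc((a,b);\<mu>)\<close> with density \<open>df/d\<mu> = h\<close> (base point c).\<close>
definition pAC :: "ereal \<Rightarrow> ereal \<Rightarrow> real measure \<Rightarrow> real \<Rightarrow> (real \<Rightarrow> complex) \<Rightarrow> (real \<Rightarrow> complex) \<Rightarrow> bool" where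
  "pAC a b M c f h \<longleftrightarrow> ploc_int a b M h \<and> (\<forall>x\<in>Iab a b. f x = f c + oint (pint M) c x h)"

definition sAC :: "ereal \<Rightarrow> ereal \<Rightarrow> smeasure \<Rightarrow> real \<Rightarrow> (real \<Rightarrow> complex) \<Rightarrow> (real \<Rightarrow> complex) \<Rightarrow> bool" where
  "sAC a b \<mu> c f h \<longleftrightarrow> sloc_int a b \<mu> h \<and> (\<forall>x\<in>Iab a b. f x = f c + oint (sint \<mu>) c x h)"

definition sAE :: "ereal \<Rightarrow> ereal \<Rightarrow> smeasure \<Rightarrow> (real \<Rightarrow> bool) \<Rightarrow> bool" where
  "sAE a b \<mu> P \<longleftrightarrow> (AE x in fst \<mu>. x \<in> Iab a b \<longrightarrow> P x) \<and> (AE x in snd \<mu>. x \<in> Iab a b \<longrightarrow> P x)"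

text \<open>The data (h, F, G) witnessing \<open>f \<in> \<frak>D_\<tau>\<close>: \<open>h = df/d\<varsigma>\<close>, \<open>F \<in> AC_loc(\<rho>)\<close> with
  \<open>F = -df/d\<varsigma> + \<integral>_c f d\<kappa>\<close> |\<open>\<varsigma>\<close>|-a.e., and \<open>G = dF/d\<rho>\<close>.\<close>
definition Dtau_data :: "ereal \<Rightarrow> ereal \<Rightarrow> real measure \<Rightarrow> smeasure \<Rightarrow> smeasure \<Rightarrow> real \<Rightarrow>
    (real \<Rightarrow> complex) \<Rightarrow> (real \<Rightarrow> complex) \<Rightarrow> (real \<Rightarrow> complex) \<Rightarrow> (real \<Rightarrow> complex) \<Rightarrow> bool" where
  "Dtau_data a b \<rho> \<sigma> \<kappa> c f h F G \<longleftrightarrow>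
     sAC a b \<sigma> c f h \<and> pAC a b \<rho> c F G \<and>
     sAE a b \<sigma> (\<lambda>x. F x = - h x + oint (sint \<kappa>) c x f)"

definition in_Dtau :: "ereal \<Rightarrow> ereal \<Rightarrow> real measure \<Rightarrow> smeasure \<Rightarrow> smeasure \<Rightarrow> real \<Rightarrow> (real \<Rightarrow> complex) \<Rightarrow> bool" where
  "in_Dtau a b \<rho> \<sigma> \<kappa> c f \<longleftrightarrow> (\<exists>h F G. Dtau_data a b \<rho> \<sigma> \<kappa> c f h F G)"

text \<open>The function F (unique on (a,b) under (H3)) and a version of \<open>\<tau> f = dF/d\<rho>\<close>.\<close>
definition FG_of :: "ereal \<Rightarrow> ereal \<Rightarrow> real measure \<Rightarrow> smeasure \<Rightarrow> smeasure \<Rightarrow> real \<Rightarrow>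
    (real \<Rightarrow> complex) \<Rightarrow> (real \<Rightarrow> complex) \<times> (real \<Rightarrow> complex)" where
  "FG_of a b \<rho> \<sigma> \<kappa> c f = (SOME FG. \<exists>h. Dtau_data a b \<rho> \<sigma> \<kappa> c f h (fst FG) (snd FG))"

definition tau :: "ereal \<Rightarrow> ereal \<Rightarrow> real measure \<Rightarrow> smeasure \<Rightarrow> smeasure \<Rightarrow> real \<Rightarrow> (real \<Rightarrow> complex) \<Rightarrow> real \<Rightarrow> complex" where
  "tau a b \<rho> \<sigma> \<kappa> c f = snd (FG_of a b \<rho> \<sigma> \<kappa> c f)"

definition quasi :: "ereal \<Rightarrow> ereal \<Rightarrow> real measure \<Rightarrow> smeasure \<Rightarrow> smeasure \<Rightarrow> real \<Rightarrow> (real \<Rightarrow> complex) \<Rightarrow> real \<Rightarrow> complex" where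
  "quasi a b \<rho> \<sigma> \<kappa> c f x = oint (sint \<kappa>) c x f - fst (FG_of a b \<rho> \<sigma> \<kappa> c f) x"

definition Wr :: "ereal \<Rightarrow> ereal \<Rightarrow> real measure \<Rightarrow> smeasure \<Rightarrow> smeasure \<Rightarrow> real \<Rightarrow>
    (real \<Rightarrow> complex) \<Rightarrow> (real \<Rightarrow> complex) \<Rightarrow> real \<Rightarrow> complex" where
  "Wr a b \<rho> \<sigma> \<kappa> c f g x = f x * quasi a b \<rho> \<sigma> \<kappa> c g x - quasi a b \<rho> \<sigma> \<kappa> c f x * g x"

definition left_end :: "ereal \<Rightarrow> real filter" where
  "left_end a = (if a = -\<infinity> then at_bot else at_right (real_of_ereal a))"

definition right_end :: "ereal \<Rightarrow> real filter" where
  "right_end b = (if b = \<infinity> then at_top else at_left (real_of_ereal b))"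

definition Wab :: "ereal \<Rightarrow> ereal \<Rightarrow> real measure \<Rightarrow> smeasure \<Rightarrow> smeasure \<Rightarrow> real \<Rightarrow>
    (real \<Rightarrow> complex) \<Rightarrow> (real \<Rightarrow> complex) \<Rightarrow> complex" where
  "Wab a b \<rho> \<sigma> \<kappa> c f g =
     Lim (right_end b) (Wr a b \<rho> \<sigma> \<kappa> c f g) - Lim (left_end a) (Wr a b \<rho> \<sigma> \<kappa> c f g)"

definition L2 :: "ereal \<Rightarrow> ereal \<Rightarrow> real measure \<Rightarrow> (real \<Rightarrow> complex) \<Rightarrow> bool" where
  "L2 a b \<rho> f \<longleftrightarrow> set_borel_measurable \<rho> (Iab a b) f \<and>
     set_integrable \<rho> (Iab a b) (\<lambda>x. (norm (f x))\<^sup>2)"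

definition inner2 :: "ereal \<Rightarrow> ereal \<Rightarrow> real measure \<Rightarrow> (real \<Rightarrow> complex) \<Rightarrow> (real \<Rightarrow> complex) \<Rightarrow> complex" where
  "inner2 a b \<rho> f g = set_lebesgue_integral \<rho> (Iab a b) (\<lambda>x. cnj (g x) * f x)"

text \<open>\<open>T_max\<close>, with elements identified with functions in \<open>\<frak>D_\<tau>\<close>; the values outside
  (a,b) are normalised to 0 so that this identification is injective.\<close>
definition Tmax :: "ereal \<Rightarrow> ereal \<Rightarrow> real measure \<Rightarrow> smeasure \<Rightarrow> smeasure \<Rightarrow> real \<Rightarrow> (real \<Rightarrow> complex) set" where
  "Tmax a b \<rho> \<sigma> \<kappa> c = {f. in_Dtau a b \<rho> \<sigma> \<kappa> c f \<and> (\<forall>x. x \<notin> Iab a b \<longrightarrow> f x = 0) \<and>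
       L2 a b \<rho> f \<and> L2 a b \<rho> (tau a b \<rho> \<sigma> \<kappa> c f)}"

definition lin_rel :: "ereal \<Rightarrow> ereal \<Rightarrow> real measure \<Rightarrow> smeasure \<Rightarrow> smeasure \<Rightarrow> real \<Rightarrow> (real \<Rightarrow> complex) set \<Rightarrow> bool" where
  "lin_rel a b \<rho> \<sigma> \<kappa> c S \<longleftrightarrow> S \<subseteq> Tmax a b \<rho> \<sigma> \<kappa> c \<and> (\<lambda>x. 0) \<in> S \<and>
     (\<forall>f\<in>S. \<forall>g\<in>S. (\<lambda>x. f x + g x) \<in> S) \<and> (\<forall>z::complex. \<forall>f\<in>S. (\<lambda>x. z * f x) \<in> S)"

text \<open>Self-adjointness \<open>S = S^*\<close> in \<open>L^2((a,b);\<rho>)\<close>, where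
  \<open>S^* = {(u,v) : \<langle>u, \<tau> g\<rangle> = \<langle>v, g\<rangle> for all g \<in> S}\<close> and an element of S is the class
  of \<open>(f, \<tau> f)\<close>.\<close>
definition self_adjoint :: "ereal \<Rightarrow> ereal \<Rightarrow> real measure \<Rightarrow> smeasure \<Rightarrow> smeasure \<Rightarrow> real \<Rightarrow> (real \<Rightarrow> complex) set \<Rightarrow> bool" where
  "self_adjoint a b \<rho> \<sigma> \<kappa> c S \<longleftrightarrow>
     (\<forall>u v. L2 a b \<rho> u \<and> L2 a b \<rho> v \<longrightarrow>
        ((\<forall>g\<in>S. inner2 a b \<rho> u (tau a b \<rho> \<sigma> \<kappa> c g) = inner2 a b \<rho> v g) \<longleftrightarrow>
         (\<exists>f\<in>S. AE x in \<rho>. x \<in> Iab a b \<longrightarrow> u x = f x \<and> v x = tau a b \<rho> \<sigma> \<kappa> c f x)))"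

end

theory Submission
  imports Defs
begin

text \<open>
  Writing \<open>q\<close> for the quasi-derivative of \<open>f\<close>, the equation \<open>\<tau> f = G\<close> is the first order system
  \<open>df = q d\<sigma>\<close>, \<open>dq = f d\<kappa> - G d\<rho>\<close>. All measures have densities with respect to one
  dominating measure, and the product rule for that measure gives the Lagrange identity, because
  (H4) removes the jump terms. Picard iteration solves the system to the right; constancy of the
  Wronskian then yields uniqueness in both directions and existence to the left.

  If \<open>S\<close> is self-adjoint, the Lagrange identity and the injectivity of \<open>f \<mapsto> (f, \<tau> f)\<close> turn
  \<open>S = S\<^sup>*\<close> into the boundary condition. Conversely, the boundary condition puts every compactly
  supported element of \<open>T\<^sub>m\<^sub>a\<^sub>x\<close> into \<open>S\<close>. For \<open>(u, v) \<in> S\<^sup>*\<close> and a solution \<open>F\<close> of \<open>\<tau> F = v\<close>, the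
  difference \<open>u - F\<close> is then orthogonal to every compactly supported \<open>G\<close> that is orthogonal to the
  two homogeneous solutions, so it is locally a combination of these. Hence \<open>S\<^sup>* \<subseteq> T\<^sub>m\<^sub>a\<^sub>x\<close>, and
  the Lagrange identity finishes the proof. Injectivity comes from (H5): a function vanishing
  \<open>\<rho>\<close>-almost everywhere vanishes on an interval, where its quasi-derivative must vanish as well.
\<close>

section \<open>Indefinite integrals with respect to a measure\<close>

text \<open>The obstacle is atoms. With integrals over \<open>{x..<y}\<close>, the value at the
  right end depends only on values at earlier points, so iteration to the right is explicit. To the
  left, the unknown value at \<open>x\<close> occurs under its own integral, multiplied by the mass
  of \<open>x\<close>; the constant Wronskian replaces the missing iteration. Atoms also add a jump
  term to the product rule. For \<open>f\<close> and \<open>q\<close> it consists of products of a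
  jump of \<sigma> with a jump of \<kappa> or of \<rho>, which is what (H4) makes vanish. Gaps of
  the support of \<rho> are the second obstacle: vanishing \<rho>-almost everywhere says nothing
  inside a gap, and outside it only yields the one-sided limits at the gap's endpoints that enter
  (H5). An element of the adjoint is merely a pair of classes. A representative is found by
  finite-dimensional linear algebra: a functional vanishing on the common kernel of two others is a
  combination of them. The coefficients found on different intervals agree because a homogeneous
  solution that is \<rho>-null on an interval containing two support points is zero.\<close>

definition primitive_on :: "real measure \<Rightarrow> real set \<Rightarrow> (real \<Rightarrow> 'a::{banach, second_countable_topology}) \<Rightarrow> (real \<Rightarrow> 'a) \<Rightarrow> bool" where
  "primitive_on M J f \<phi> \<longleftrightarrow> (\<forall>x\<in>J. \<forall>y\<in>J. x \<le> y \<longrightarrow>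
     set_integrable M {x..<y} \<phi> \<and> f y - f x = (LINT t:{x..<y}|M. \<phi> t))"

lemma primitive_onI:
  assumes "\<And>x y. x \<in> J \<Longrightarrow> y \<in> J \<Longrightarrow> x \<le> y \<Longrightarrow> set_integrable M {x..<y} \<phi>"
    and "\<And>x y. x \<in> J \<Longrightarrow> y \<in> J \<Longrightarrow> x \<le> y \<Longrightarrow> f y - f x = (LINT t:{x..<y}|M. \<phi> t)"
  shows "primitive_on M J f \<phi>"
  using assms by (auto simp: primitive_on_def)

lemma primitive_onD:
  assumes "primitive_on M J f \<phi>" "x \<in> J" "y \<in> J" "x \<le> y"
  shows "set_integrable M {x..<y} \<phi>" "f y - f x = (LINT t:{x..<y}|M. \<phi> t)"
  using assms by (auto simp: primitive_on_def)

lemma primitive_on_subset: "primitive_on M J f \<phi> \<Longrightarrow> J' \<subseteq> J \<Longrightarrow> primitive_on M J' f \<phi>"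
  by (auto simp: primitive_on_def)

lemma primitive_on_const: "primitive_on M J (\<lambda>_. C) (\<lambda>_. 0)"
  by (auto simp: primitive_on_def set_integrable_def)

lemma primitive_on_add:
  assumes f: "primitive_on M J f \<phi>" and g: "primitive_on M J g \<psi>"
  shows "primitive_on M J (\<lambda>x. f x + g x) (\<lambda>x. \<phi> x + \<psi> x)"
proof (rule primitive_onI)
  fix x y assume xy: "x \<in> J" "y \<in> J" "x \<le> y"
  note int = primitive_onD(1)[OF f xy] primitive_onD(1)[OF g xy]
  show "set_integrable M {x..<y} (\<lambda>x. \<phi> x + \<psi> x)"
    using int by (rule set_integral_add(1))
  show "(f y + g y) - (f x + g x) = (LINT t:{x..<y}|M. \<phi> t + \<psi> t)"
    unfolding set_integral_add(2)[OF int] primitive_onD(2)[OF f xy, symmetric]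
      primitive_onD(2)[OF g xy, symmetric] by simp
qed

lemma primitive_on_diff:
  assumes f: "primitive_on M J f \<phi>" and g: "primitive_on M J g \<psi>"
  shows "primitive_on M J (\<lambda>x. f x - g x) (\<lambda>x. \<phi> x - \<psi> x)"
proof (rule primitive_onI)
  fix x y assume xy: "x \<in> J" "y \<in> J" "x \<le> y"
  note int = primitive_onD(1)[OF f xy] primitive_onD(1)[OF g xy]
  show "set_integrable M {x..<y} (\<lambda>x. \<phi> x - \<psi> x)"
    using int by (rule set_integral_diff(1))
  show "(f y - g y) - (f x - g x) = (LINT t:{x..<y}|M. \<phi> t - \<psi> t)"
    unfolding set_integral_diff(2)[OF int] primitive_onD(2)[OF f xy, symmetric]
      primitive_onD(2)[OF g xy, symmetric] by simp
qed

lemma primitive_on_cmult: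
  fixes f :: "real \<Rightarrow> 'a::{banach, second_countable_topology, real_normed_field}"
  assumes f: "primitive_on M J f \<phi>"
  shows "primitive_on M J (\<lambda>x. C * f x) (\<lambda>x. C * \<phi> x)"
proof (rule primitive_onI)
  fix x y assume xy: "x \<in> J" "y \<in> J" "x \<le> y"
  show "set_integrable M {x..<y} (\<lambda>x. C * \<phi> x)"
    using primitive_onD(1)[OF f xy] by simp
  show "C * f y - C * f x = (LINT t:{x..<y}|M. C * \<phi> t)"
    unfolding set_integral_mult_right primitive_onD(2)[OF f xy, symmetric]
    by (simp add: right_diff_distrib)
qed

lemma set_lebesgue_integral_cnj:
  "(LINT x:A|M. cnj (f x)) = cnj (LINT x:A|M. f x)"
proof -
  have "(LINT x:A|M. cnj (f x)) = (LINT x|M. cnj (indicator A x *\<^sub>R f x))"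
    by (simp add: set_lebesgue_integral_def)
  then show ?thesis
    unfolding set_lebesgue_integral_def by (simp only: Bochner_Integration.integral_cnj)
qed

lemma set_integrable_cnj:
  assumes "set_integrable M A f"
  shows "set_integrable M A (\<lambda>x. cnj (f x))"
proof -
  have "integrable M (\<lambda>x. cnj (indicator A x *\<^sub>R f x))"
    using assms unfolding set_integrable_def by (rule integrable_cnj)
  then show ?thesis
    by (simp add: set_integrable_def)
qed

lemma primitive_on_cnj:
  assumes "primitive_on M J f \<phi>"
  shows "primitive_on M J (\<lambda>x. cnj (f x)) (\<lambda>x. cnj (\<phi> x))"
proof (rule primitive_onI)
  fix x y assume xy: "x \<in> J" "y \<in> J" "x \<le> y"
  show "set_integrable M {x..<y} (\<lambda>x. cnj (\<phi> x))"
    using primitive_onD(1)[OF assms xy] by (rule set_integrable_cnj)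
  show "cnj (f y) - cnj (f x) = (LINT t:{x..<y}|M. cnj (\<phi> t))"
    unfolding set_lebesgue_integral_cnj primitive_onD(2)[OF assms xy, symmetric] by simp
qed

lemma primitive_on_cong:
  assumes "primitive_on M J f \<phi>" "is_interval J" "\<And>x. x \<in> J \<Longrightarrow> f x = g x" "\<And>x. x \<in> J \<Longrightarrow> \<phi> x = \<psi> x"
  shows "primitive_on M J g \<psi>"
proof (rule primitive_onI)
  fix x y assume xy: "x \<in> J" "y \<in> J" "x \<le> y"
  have sub: "t \<in> J" if "t \<in> {x..<y}" for t
    using that xy assms(2) unfolding is_interval_1 by (meson atLeastLessThan_iff less_imp_le)
  have eq: "indicator {x..<y} t *\<^sub>R \<phi> t = indicator {x..<y} t *\<^sub>R \<psi> t" for t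
    using sub[of t] assms(4)[of t] by (auto simp: indicator_def)
  show "set_integrable M {x..<y} \<psi>"
    using primitive_onD(1)[OF assms(1) xy] by (simp add: set_integrable_def eq)
  have "(LINT t:{x..<y}|M. \<phi> t) = (LINT t:{x..<y}|M. \<psi> t)"
    by (simp add: set_lebesgue_integral_def eq)
  then show "g y - g x = (LINT t:{x..<y}|M. \<psi> t)"
    using primitive_onD(2)[OF assms(1) xy] assms(3) xy by simp
qed

text \<open>\<open>J\<close> is any interval, so that the same facts serve (a,b) and its compact
  subintervals, while \<open>M\<close> lives on the whole line. Sigma-finiteness is carried along
  for Fubini's theorem.\<close>

locale loc_finite_interval =
  fixes M :: "real measure" and J :: "real set"
  assumes sets_M [measurable_cong, simp]: "sets M = sets borel"
    and sigma_finite_M: "sigma_finite_measure M"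
    and interval_J: "is_interval J"
    and finite_J: "x \<in> J \<Longrightarrow> y \<in> J \<Longrightarrow> emeasure M {x..y} < \<infinity>"
begin

lemma space_M [simp]: "space M = UNIV"
  using sets_eq_imp_space_eq[OF sets_M] by simp

lemma mem_J: "x \<in> J \<Longrightarrow> y \<in> J \<Longrightarrow> x \<le> t \<Longrightarrow> t \<le> y \<Longrightarrow> t \<in> J"
  using interval_J unfolding is_interval_1 by blast

lemma finite_point: "x \<in> J \<Longrightarrow> emeasure M {x} < \<infinity>"
  using finite_J[of x x] by simp

text \<open>On \<open>{x..<y}\<close> the function equals \<open>f x\<close> plus a parameter
  integral whose jointly measurable integrand cuts \<open>\<phi>\<close> off at \<open>t\<close>;
  sigma-finiteness makes such integrals measurable in \<open>t\<close>. The indicators are there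
  because \<open>\<phi>\<close> is known to be measurable on such intervals only.\<close>

lemma primitive_on_borel:
  fixes f :: "real \<Rightarrow> 'a::{banach, second_countable_topology}"
  assumes f: "primitive_on M J f \<phi>" and xy: "x \<in> J" "y \<in> J" "x \<le> y"
  shows "(\<lambda>t. indicator {x..<y} t *\<^sub>R f t) \<in> borel_measurable M"
proof -
  interpret sigma_finite_measure M by (rule sigma_finite_M)
  have int: "set_integrable M {x..<y} \<phi>" using primitive_onD(1)[OF f] xy by blast
  then have [measurable]: "(\<lambda>t. indicator {x..<y} t *\<^sub>R \<phi> t) \<in> borel_measurable M"
    by (auto simp: set_integrable_def)
  have "(\<lambda>t. indicator {x..<y} t *\<^sub>R (f x + (LINT u|M. indicator {u. u < t} u *\<^sub>R (indicator {x..<y} u *\<^sub>R \<phi> u))))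
      \<in> borel_measurable M"
    by measurable
  also have "(\<lambda>t. indicator {x..<y} t *\<^sub>R (f x + (LINT u|M. indicator {u. u < t} u *\<^sub>R (indicator {x..<y} u *\<^sub>R \<phi> u))))
     = (\<lambda>t. indicator {x..<y} t *\<^sub>R f t)"
  proof
    fix t show "indicator {x..<y} t *\<^sub>R (f x + (LINT u|M. indicator {u. u < t} u *\<^sub>R (indicator {x..<y} u *\<^sub>R \<phi> u)))
     = indicator {x..<y} t *\<^sub>R f t"
  proof (cases "t \<in> {x..<y}")
    case True
    have "f t - f x = (LINT t:{x..<t}|M. \<phi> t)"
      using primitive_onD(2)[OF f xy(1), of t] True mem_J[OF xy(1,2), of t] by auto
    also have "\<dots> = (LINT u|M. indicator {u. u < t} u *\<^sub>R (indicator {x..<y} u *\<^sub>R \<phi> u))"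
      unfolding set_lebesgue_integral_def
      by (rule Bochner_Integration.integral_cong) (use True in \<open>auto simp: indicator_def\<close>)
    finally show ?thesis by (simp add: algebra_simps)
  qed simp
  qed
  finally show ?thesis .
qed

lemma primitive_on_bounded:
  fixes f :: "real \<Rightarrow> 'a::{banach, second_countable_topology}"
  assumes f: "primitive_on M J f \<phi>" and xy: "x \<in> J" "y \<in> J" "t \<in> {x..y}"
  shows "norm (f t) \<le> norm (f x) + (LINT t:{x..<y}|M. norm (\<phi> t))"
proof -
  have t: "t \<in> J" "x \<le> y" using mem_J[OF xy(1,2), of t] xy(3) by auto
  have int: "set_integrable M {x..<y} \<phi>" using primitive_onD(1)[OF f] xy t by blast
  have "norm (f t - f x) \<le> (LINT t:{x..<t}|M. norm (\<phi> t))"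
    using set_integral_norm_bound[OF primitive_onD(1)[OF f xy(1) t(1)]]
      primitive_onD(2)[OF f xy(1) t(1)] xy by simp
  also have "\<dots> \<le> (LINT t:{x..<y}|M. norm (\<phi> t))"
  proof -
    have "set_integrable M {x..<t} \<phi>"
      using int by (rule set_integrable_subset) (use xy in auto)
    then show ?thesis
      using integrable_norm[of M "\<lambda>u. indicator {x..<t} u *\<^sub>R \<phi> u"]
        integrable_norm[of M "\<lambda>u. indicator {x..<y} u *\<^sub>R \<phi> u"] int xy
      unfolding set_lebesgue_integral_def set_integrable_def
      by (intro integral_mono) (auto simp: indicator_def)
  qed
  finally show ?thesis using norm_triangle_sub[of "f t" "f x"] by linarith
qed

lemma set_integrable_mult_bounded:
  fixes g h :: "real \<Rightarrow> 'a::{real_normed_field, banach, second_countable_topology}"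
  assumes "set_integrable M A h" and [measurable]: "(\<lambda>t. indicator A t *\<^sub>R g t) \<in> borel_measurable M"
    and "\<And>t. t \<in> A \<Longrightarrow> norm (g t) \<le> C"
  shows "set_integrable M A (\<lambda>t. h t * g t)"
  unfolding set_integrable_def
proof (rule Bochner_Integration.integrable_bound)
  show "integrable M (\<lambda>t. C *\<^sub>R norm (indicator A t *\<^sub>R h t))"
    using assms(1) unfolding set_integrable_def by (intro integrable_scaleR_right integrable_norm)
  have [measurable]: "(\<lambda>t. indicator A t *\<^sub>R h t) \<in> borel_measurable M"
    using assms(1) by (auto simp: set_integrable_def)
  have eq: "(\<lambda>t. indicator A t *\<^sub>R (h t * g t)) = (\<lambda>t. (indicator A t *\<^sub>R h t) * (indicator A t *\<^sub>R g t))"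
    by (auto simp: indicator_def)
  show "(\<lambda>t. indicator A t *\<^sub>R (h t * g t)) \<in> borel_measurable M"
    unfolding eq by measurable
  show "AE t in M. norm (indicator A t *\<^sub>R (h t * g t)) \<le> norm (C *\<^sub>R norm (indicator A t *\<^sub>R h t))"
  proof (rule AE_I2)
    fix t
    have "norm (h t) * norm (g t) \<le> norm (h t) * \<bar>C\<bar>" if "t \<in> A"
      using assms(3)[OF that] by (intro mult_left_mono) auto
    then show "norm (indicator A t *\<^sub>R (h t * g t)) \<le> norm (C *\<^sub>R norm (indicator A t *\<^sub>R h t))"
      by (auto simp: indicator_def norm_mult mult.commute)
  qed
qed

lemma set_integrable_mult_primitive:
  fixes f h :: "real \<Rightarrow> 'a::{real_normed_field, banach, second_countable_topology}"
  assumes f: "primitive_on M J f \<phi>" and xy: "x \<in> J" "y \<in> J" "x \<le> y" and h: "set_integrable M {x..<y} h"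
  shows "set_integrable M {x..<y} (\<lambda>t. h t * f t)"
  using h primitive_on_borel[OF f xy] primitive_on_bounded[OF f xy(1,2)]
  by (rule set_integrable_mult_bounded) auto

lemma primitive_onI_integral:
  fixes \<phi> :: "real \<Rightarrow> 'a::{banach, second_countable_topology}"
  assumes \<alpha>: "\<alpha> \<in> J" "\<And>x. x \<in> J \<Longrightarrow> \<alpha> \<le> x"
    and int: "\<And>x. x \<in> J \<Longrightarrow> set_integrable M {\<alpha>..<x} \<phi>"
    and eq: "\<And>x. x \<in> J \<Longrightarrow> f x = C + (LINT t:{\<alpha>..<x}|M. \<phi> t)"
  shows "primitive_on M J f \<phi>"
proof (rule primitive_onI)
  fix x y assume xy: "x \<in> J" "y \<in> J" "x \<le> y"
  have ax: "\<alpha> \<le> x" using \<alpha> xy by auto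
  show i: "set_integrable M {x..<y} \<phi>"
    using int[OF xy(2)] by (rule set_integrable_subset) (use ax in auto)
  have "{\<alpha>..<y} = {\<alpha>..<x} \<union> {x..<y}" using ax xy by auto
  then have "(LINT t:{\<alpha>..<y}|M. \<phi> t) = (LINT t:{\<alpha>..<x}|M. \<phi> t) + (LINT t:{x..<y}|M. \<phi> t)"
    using set_integral_Un[OF _ int[OF xy(1)] i] by auto
  then show "f y - f x = (LINT t:{x..<y}|M. \<phi> t)" using eq xy by simp
qed

text \<open>The product of the two increments is the integral of \<open>\<phi> t * \<psi> u\<close>
  over a square, and Fubini evaluates it separately on the two sides of the diagonal. An atom of
  \<open>M\<close> charges the diagonal, which is the origin of the term with
  \<open>measure M {t}\<close>.\<close>

lemma primitive_on_mult:
  fixes f g :: "real \<Rightarrow> 'a::{real_normed_field, banach, second_countable_topology}"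
  assumes f: "primitive_on M J f \<phi>" and g: "primitive_on M J g \<psi>"
  shows "primitive_on M J (\<lambda>t. f t * g t)
     (\<lambda>t. \<phi> t * g t + f t * \<psi> t + \<phi> t * \<psi> t * of_real (measure M {t}))"
proof (rule primitive_onI)
  fix x y assume xy: "x \<in> J" "y \<in> J" "x \<le> y"
  interpret sigma_finite_measure M by (rule sigma_finite_M)
  interpret P: pair_sigma_finite M M ..
  let ?i = "\<lambda>t. indicator {x..<y} t :: real"
  define F where "F t = ?i t *\<^sub>R \<phi> t" for t
  define G where "G t = ?i t *\<^sub>R \<psi> t" for t
  have F: "integrable M F" and G: "integrable M G"
    using primitive_onD(1)[OF f xy] primitive_onD(1)[OF g xy]
    by (auto simp: F_def[abs_def] G_def[abs_def] set_integrable_def)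
  then have [measurable]: "F \<in> borel_measurable M" "G \<in> borel_measurable M" by auto
  have FG: "integrable (M \<Otimes>\<^sub>M M) (\<lambda>(t, u). F t * G u)"
  proof (rule P.Fubini_integrable)
    show "integrable M (\<lambda>t. LINT u|M. norm (case (t, u) of (t, u) \<Rightarrow> F t * G u))"
      using F by (simp add: norm_mult)
    show "AE t in M. integrable M (\<lambda>u. case (t, u) of (t, u) \<Rightarrow> F t * G u)"
      using G by simp
  qed measurable
  \<comment> \<open>The diagonal goes to \<open>L\<close> alone: the inner integral of
    \<open>K\<close> then gives the increment of \<open>f\<close> up to \<open>u\<close>, that of
    \<open>L\<close> the increment of \<open>g\<close> up to \<open>t\<close> plus the atom at
    \<open>t\<close>.\<close>
  define K where "K t u = (if t < u then F t * G u else 0)" for t u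
  define L where "L t u = (if u \<le> t then F t * G u else 0)" for t u
  have [measurable]: "case_prod K \<in> borel_measurable (M \<Otimes>\<^sub>M M)" "case_prod L \<in> borel_measurable (M \<Otimes>\<^sub>M M)"
    unfolding K_def[abs_def] L_def[abs_def] by measurable
  have K: "integrable (M \<Otimes>\<^sub>M M) (case_prod K)"
    by (rule Bochner_Integration.integrable_bound[OF FG]) (auto simp: K_def)
  have L: "integrable (M \<Otimes>\<^sub>M M) (case_prod L)"
    by (rule Bochner_Integration.integrable_bound[OF FG]) (auto simp: L_def)
  have Kin: "(LINT t|M. K t u) = ?i u *\<^sub>R (\<psi> u * (f u - f x))" for u
  proof (cases "u \<in> {x..<y}")
    case True
    have "K t u = (indicator {x..<u} t *\<^sub>R \<phi> t) * \<psi> u" for t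
      using True by (auto simp: K_def F_def G_def indicator_def)
    then have "(LINT t|M. K t u) = (LINT t:{x..<u}|M. \<phi> t) * \<psi> u"
      unfolding set_lebesgue_integral_def by (simp only: integral_mult_left_zero)
    moreover have "f u - f x = (LINT t:{x..<u}|M. \<phi> t)"
      using primitive_onD(2)[OF f xy(1), of u] True mem_J[OF xy(1,2), of u] by auto
    ultimately show ?thesis using True by simp
  next
    case False
    then have "K t u = 0" for t by (auto simp: K_def G_def)
    then show ?thesis using False by simp
  qed
  have Lin: "(LINT u|M. L t u) = ?i t *\<^sub>R (\<phi> t * (g t - g x + \<psi> t * of_real (measure M {t})))" for t
  proof (cases "t \<in> {x..<y}")
    case True
    then have t: "t \<in> J" "x \<le> t" using mem_J[OF xy(1,2), of t] by auto
    have L_eq: "L t u = \<phi> t * (indicator {x..<t} u *\<^sub>R \<psi> u + indicator {t} u *\<^sub>R \<psi> t)" for u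
      using True by (cases "u = t"; cases "u < t") (auto simp: L_def F_def G_def indicator_def)
    have int1: "integrable M (\<lambda>u. indicator {x..<t} u *\<^sub>R \<psi> u)"
      using primitive_onD(1)[OF g xy(1) t] by (simp add: set_integrable_def)
    have int2: "integrable M (\<lambda>u. indicat_real {t} u *\<^sub>R \<psi> t)"
      using finite_point[OF t(1)] by (intro integrable_scaleR_left integrable_real_indicator) auto
    have "(LINT u|M. indicat_real {t} u *\<^sub>R \<psi> t) = measure M {t} *\<^sub>R \<psi> t"
      using finite_point[OF t(1)] by (subst integral_scaleR_left) auto
    then have "(LINT u|M. L t u) = \<phi> t * ((LINT u:{x..<t}|M. \<psi> u) + \<psi> t * of_real (measure M {t}))"
      unfolding L_eq set_lebesgue_integral_def integral_mult_right_zero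
        Bochner_Integration.integral_add[OF int1 int2]
      by (simp add: scaleR_conv_of_real mult.commute)
    then show ?thesis
      using primitive_onD(2)[OF g xy(1) t] True by simp
  next
    case False
    then have "L t u = 0" for u by (auto simp: L_def F_def)
    then show ?thesis using False by simp
  qed
  have 1: "set_integrable M {x..<y} (\<lambda>u. \<psi> u * (f u - f x))"
    using P.integrable_snd[OF K] by (simp add: Kin set_integrable_def)
  have 2: "set_integrable M {x..<y} (\<lambda>t. \<phi> t * (g t - g x + \<psi> t * of_real (measure M {t})))"
    using P.integrable_fst[OF L] by (simp add: Lin set_integrable_def)
  have 3: "set_integrable M {x..<y} (\<lambda>t. f x * \<psi> t + g x * \<phi> t)"
    using primitive_onD(1)[OF f xy] primitive_onD(1)[OF g xy] by (intro set_integral_add) auto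
  have eq: "(\<lambda>t. \<phi> t * g t + f t * \<psi> t + \<phi> t * \<psi> t * of_real (measure M {t})) =
    (\<lambda>t. \<psi> t * (f t - f x) + \<phi> t * (g t - g x + \<psi> t * of_real (measure M {t})) + (f x * \<psi> t + g x * \<phi> t))"
    by (auto simp: algebra_simps)
  show "set_integrable M {x..<y} (\<lambda>t. \<phi> t * g t + f t * \<psi> t + \<phi> t * \<psi> t * of_real (measure M {t}))"
    unfolding eq by (rule set_integral_add(1)[OF set_integral_add(1)[OF 1 2] 3])
  have fx: "f y - f x = (LINT t|M. F t)"
    unfolding primitive_onD(2)[OF f xy] F_def set_lebesgue_integral_def ..
  have gx: "g y - g x = (LINT t|M. G t)"
    unfolding primitive_onD(2)[OF g xy] G_def set_lebesgue_integral_def ..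
  have "(f y - f x) * (g y - g x) = (LINT t|M. LINT u|M. F t * G u)"
    unfolding fx gx integral_mult_right_zero integral_mult_left_zero ..
  also have "\<dots> = integral\<^sup>L (M \<Otimes>\<^sub>M M) (\<lambda>(t, u). F t * G u)"
    using P.integral_fst[OF FG] .
  also have "\<dots> = integral\<^sup>L (M \<Otimes>\<^sub>M M) (\<lambda>p. case_prod K p + case_prod L p)"
    by (rule Bochner_Integration.integral_cong) (auto simp: K_def L_def)
  also have "\<dots> = integral\<^sup>L (M \<Otimes>\<^sub>M M) (case_prod K) + integral\<^sup>L (M \<Otimes>\<^sub>M M) (case_prod L)"
    using K L by (rule Bochner_Integration.integral_add)
  also have "\<dots> = (LINT u:{x..<y}|M. \<psi> u * (f u - f x)) +
      (LINT t:{x..<y}|M. \<phi> t * (g t - g x + \<psi> t * of_real (measure M {t})))"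
    unfolding P.integral_fst[OF L, symmetric] P.integral_snd[OF K, symmetric] Kin Lin set_lebesgue_integral_def ..
  finally have *: "(f y - f x) * (g y - g x) = \<dots>" .
  have **: "(LINT t:{x..<y}|M. f x * \<psi> t + g x * \<phi> t) = f x * (g y - g x) + g x * (f y - f x)"
    unfolding primitive_onD(2)[OF f xy] primitive_onD(2)[OF g xy]
    using primitive_onD(1)[OF f xy] primitive_onD(1)[OF g xy] by (subst set_integral_add(2)) auto
  have "f y * g y - f x * g x = (f y - f x) * (g y - g x) + (f x * (g y - g x) + g x * (f y - f x))"
    by (simp add: algebra_simps)
  also have "\<dots> = (LINT t:{x..<y}|M. \<phi> t * g t + f t * \<psi> t + \<phi> t * \<psi> t * of_real (measure M {t}))"
    unfolding eq set_integral_add(2)[OF set_integral_add(1)[OF 1 2] 3] set_integral_add(2)[OF 1 2] * ** ..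
  finally show "f y * g y - f x * g x =
      (LINT t:{x..<y}|M. \<phi> t * g t + f t * \<psi> t + \<phi> t * \<psi> t * of_real (measure M {t}))" .
qed

end

section \<open>Existence for Volterra systems\<close>

context loc_finite_interval
begin

lemma loc_finite_interval_subset: "J' \<subseteq> J \<Longrightarrow> is_interval J' \<Longrightarrow> loc_finite_interval M J'"
  by (intro loc_finite_interval.intro sets_M sigma_finite_M finite_J) (auto dest: subsetD)

lemma primitive_on_integral:
  fixes \<phi> :: "real \<Rightarrow> 'a::{banach, second_countable_topology}"
  assumes "\<alpha> \<in> J" "\<And>x. x \<in> J \<Longrightarrow> \<alpha> \<le> x" "\<And>x. x \<in> J \<Longrightarrow> set_integrable M {\<alpha>..<x} \<phi>"
  shows "primitive_on M J (\<lambda>x. C + (LINT t:{\<alpha>..<x}|M. \<phi> t)) \<phi>"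
  using assms by (rule primitive_onI_integral) auto

section \<open>Iterated integrals of a nonnegative weight\<close>

context
  fixes \<alpha> :: real and w :: "real \<Rightarrow> real"
  assumes \<alpha>: "\<alpha> \<in> J" "\<And>x. x \<in> J \<Longrightarrow> \<alpha> \<le> x" and w: "\<And>x. x \<in> J \<Longrightarrow> set_integrable M {\<alpha>..<x} w"
    and w0: "\<And>t. 0 \<le> w t"
begin

text \<open>The scalar Picard terms for the weight \<open>w\<close>. If \<open>M\<close> has no
  atoms, the n-th one is the n-th power of the first divided by n factorial; atoms leave an
  inequality. The summand \<open>0\<close> gives the body the shape of
  \<open>primitive_on_integral\<close>.\<close>

primrec iterated_integral :: "nat \<Rightarrow> real \<Rightarrow> real" where
  "iterated_integral 0 = (\<lambda>_. 1)"
| "iterated_integral (Suc n) = (\<lambda>x. 0 + (LINT t:{\<alpha>..<x}|M. w t * iterated_integral n t))"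

lemma iterated_integral_base: "iterated_integral (Suc n) \<alpha> = 0"
  by (simp add: set_lebesgue_integral_def)

lemma primitive_on_iterated_integral:
  "primitive_on M J (iterated_integral (Suc n)) (\<lambda>t. w t * iterated_integral n t)"
proof (induction n)
  case 0
  show ?case
    unfolding iterated_integral.simps by (rule primitive_on_integral[OF \<alpha>]) (auto simp: w)
next
  case (Suc n)
  show ?case
    unfolding iterated_integral.simps(2)[of "Suc n"]
  proof (rule primitive_on_integral[OF \<alpha>])
    fix x assume x: "x \<in> J"
    show "set_integrable M {\<alpha>..<x} (\<lambda>t. w t * iterated_integral (Suc n) t)"
      by (rule set_integrable_mult_primitive[OF Suc \<alpha>(1) x \<alpha>(2)[OF x] w[OF x]])
  qed
qed

lemma iterated_integral_nonneg: "0 \<le> iterated_integral n x"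
proof (induction n arbitrary: x)
  case (Suc n)
  have "0 \<le> (LINT t|M. indicator {\<alpha>..<x} t *\<^sub>R (w t * iterated_integral n t))"
    by (rule Bochner_Integration.integral_nonneg) (use w0 Suc in auto)
  then show ?case by (simp add: set_lebesgue_integral_def)
qed simp

lemma set_integrable_mult_iterated_integral:
  "x \<in> J \<Longrightarrow> set_integrable M {\<alpha>..<x} (\<lambda>t. w t * iterated_integral n t)"
  by (rule primitive_onD(1)[OF primitive_on_iterated_integral \<alpha>(1) _ \<alpha>(2)])

text \<open>The right side is what the product rule yields for the product of the first and the
  \<open>n\<close>-th iterated integral once the nonnegative jump terms are dropped.\<close>
lemma iterated_integral_step:
  "x \<in> J \<Longrightarrow> real (Suc n) * iterated_integral (Suc n) x \<le> iterated_integral (Suc 0) x * iterated_integral n x"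
proof (induction n arbitrary: x)
  case (Suc n)
  let ?i = "iterated_integral"
  let ?d = "\<lambda>t. w t * ?i 0 t * ?i (Suc n) t + ?i (Suc 0) t * (w t * ?i n t) +
      w t * ?i 0 t * (w t * ?i n t) * of_real (measure M {t})"
  note d = primitive_onD[OF primitive_on_mult[OF primitive_on_iterated_integral[of 0]
        primitive_on_iterated_integral[of n]] \<alpha>(1) Suc.prems \<alpha>(2)[OF Suc.prems]]
  have "real (Suc (Suc n)) * ?i (Suc (Suc n)) x = (LINT t:{\<alpha>..<x}|M. real (Suc (Suc n)) * (w t * ?i (Suc n) t))"
    unfolding set_integral_mult_right by simp
  also have "\<dots> \<le> (LINT t:{\<alpha>..<x}|M. ?d t)"
  proof (rule set_integral_mono)
    show "set_integrable M {\<alpha>..<x} (\<lambda>t. real (Suc (Suc n)) * (w t * ?i (Suc n) t))"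
      by (intro set_integrable_mult_right set_integrable_mult_iterated_integral Suc.prems)
    show "set_integrable M {\<alpha>..<x} ?d" using d(1) .
    fix t assume t: "t \<in> {\<alpha>..<x}"
    then have "t \<in> J" using mem_J[OF \<alpha>(1) Suc.prems, of t] by auto
    from Suc.IH[OF this] have "w t * (real (Suc n) * ?i (Suc n) t) \<le> w t * (?i (Suc 0) t * ?i n t)"
      by (rule mult_left_mono) (rule w0)
    moreover have "0 \<le> w t * ?i 0 t * (w t * ?i n t) * of_real (measure M {t})"
      using w0 iterated_integral_nonneg[of n t] by simp
    ultimately show "real (Suc (Suc n)) * (w t * ?i (Suc n) t) \<le> ?d t"
      unfolding iterated_integral.simps(1) by (simp only: of_nat_Suc algebra_simps)
  qed
  also have "\<dots> = ?i (Suc 0) x * ?i (Suc n) x - ?i (Suc 0) \<alpha> * ?i (Suc n) \<alpha>"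
    by (rule d(2)[symmetric])
  also have "\<dots> = ?i (Suc 0) x * ?i (Suc n) x"
    by (simp only: iterated_integral_base)
  finally show ?case .
qed simp

text \<open>The step inequality allows a division by \<open>Suc n\<close> at each stage, whence the
  factorial. This bound makes the Picard series converge on all of \<open>J\<close> at once; a
  contraction on short intervals would fail at a heavy atom, which no subdivision makes
  small.\<close>

lemma iterated_integral_le:
  assumes x: "x \<in> J"
  shows "iterated_integral n x \<le> iterated_integral (Suc 0) x ^ n / fact n"
proof (induction n)
  case (Suc n)
  let ?i = "iterated_integral"
  have "real (Suc n) * ?i (Suc n) x \<le> ?i (Suc 0) x * ?i n x"
    by (rule iterated_integral_step[OF x])
  also have "\<dots> \<le> ?i (Suc 0) x * (?i (Suc 0) x ^ n / fact n)"
    by (rule mult_left_mono[OF Suc iterated_integral_nonneg])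
  finally have "?i (Suc n) x \<le> ?i (Suc 0) x * (?i (Suc 0) x ^ n / fact n) / real (Suc n)"
    by (subst pos_le_divide_eq) (simp_all only: mult.commute of_nat_0_less_iff zero_less_Suc)
  also have "\<dots> = ?i (Suc 0) x ^ Suc n / fact (Suc n)"
    by (simp only: fact_Suc power_Suc of_nat_mult times_divide_eq_right divide_divide_eq_left mult.commute)
  finally show ?case .
qed simp

lemma summable_iterated_integral:
  assumes x: "x \<in> J"
  shows "summable (\<lambda>n. iterated_integral n x)"
proof (rule summable_comparison_test')
  show "summable (\<lambda>n. iterated_integral (Suc 0) x ^ n / fact n)"
    using summable_exp[of "iterated_integral (Suc 0) x"] by (simp add: field_simps)
  show "norm (iterated_integral n x) \<le> iterated_integral (Suc 0) x ^ n / fact n" for n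
    using iterated_integral_le[OF x, of n] iterated_integral_nonneg[of n x]
    by (simp only: real_norm_def abs_of_nonneg)
qed

end

lemma set_integral_suminf:
  fixes \<phi> :: "nat \<Rightarrow> real \<Rightarrow> 'a::{banach, second_countable_topology}"
  assumes "\<And>n. set_integrable M A (\<phi> n)"
    and "\<And>t. t \<in> A \<Longrightarrow> summable (\<lambda>n. norm (\<phi> n t))"
    and "summable (\<lambda>n. LINT t:A|M. norm (\<phi> n t))"
  shows "set_integrable M A (\<lambda>t. \<Sum>n. \<phi> n t)"
    and "(LINT t:A|M. (\<Sum>n. \<phi> n t)) = (\<Sum>n. LINT t:A|M. \<phi> n t)"
proof -
  let ?f = "\<lambda>n t. indicator A t *\<^sub>R \<phi> n t"
  have 1: "integrable M (?f n)" for n using assms(1) by (simp add: set_integrable_def)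
  have 2: "AE t in M. summable (\<lambda>n. norm (?f n t))"
    using assms(2) by (intro AE_I2) (auto simp: indicator_def)
  have 3: "summable (\<lambda>n. LINT t|M. norm (?f n t))"
    using assms(3) by (simp add: set_lebesgue_integral_def)
  have eq: "(\<lambda>t. \<Sum>n. ?f n t) = (\<lambda>t. indicator A t *\<^sub>R (\<Sum>n. \<phi> n t))"
    by (auto simp: indicator_def)
  show "set_integrable M A (\<lambda>t. \<Sum>n. \<phi> n t)"
    using integrable_suminf[OF 1 2 3] by (simp add: set_integrable_def eq)
  show "(LINT t:A|M. (\<Sum>n. \<phi> n t)) = (\<Sum>n. LINT t:A|M. \<phi> n t)"
    using integral_suminf[OF 1 2 3] by (simp add: set_lebesgue_integral_def eq)
qed

section \<open>The Picard series of a two-component system\<close>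

context
  fixes \<alpha> :: real and s k g :: "real \<Rightarrow> complex" and f0 q0 :: complex
  assumes least: "\<alpha> \<in> J" "\<And>x. x \<in> J \<Longrightarrow> \<alpha> \<le> x"
    and int_s: "\<And>x. x \<in> J \<Longrightarrow> set_integrable M {\<alpha>..<x} s"
    and int_k: "\<And>x. x \<in> J \<Longrightarrow> set_integrable M {\<alpha>..<x} k"
    and int_g: "\<And>x. x \<in> J \<Longrightarrow> set_integrable M {\<alpha>..<x} g"
begin

text \<open>These are the differences of successive Picard approximations, so the solution is their
  sum. The data \<open>f0\<close>, \<open>q0\<close> and \<open>g\<close> enter through term 0;
  every later term depends linearly on its predecessor.\<close>

primrec picard :: "nat \<Rightarrow> (real \<Rightarrow> complex) \<times> (real \<Rightarrow> complex)" where
  "picard 0 = ((\<lambda>x. f0), (\<lambda>x. q0 + (LINT t:{\<alpha>..<x}|M. g t)))"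
| "picard (Suc n) = ((\<lambda>x. 0 + (LINT t:{\<alpha>..<x}|M. s t * snd (picard n) t)),
     (\<lambda>x. 0 + (LINT t:{\<alpha>..<x}|M. k t * fst (picard n) t)))"

text \<open>Knowing that some density exists is enough: a primitive is measurable and bounded
  between two points of \<open>J\<close>, so the next integrand is integrable and its integral is
  again a primitive.\<close>

lemma primitive_on_picard:
  "(\<exists>\<phi>. primitive_on M J (fst (picard n)) \<phi>) \<and> (\<exists>\<phi>. primitive_on M J (snd (picard n)) \<phi>)"
proof (induction n)
  case 0
  have "primitive_on M J (\<lambda>x. q0 + (LINT t:{\<alpha>..<x}|M. g t)) g"
    by (rule primitive_on_integral[OF least int_g])
  then show ?case using primitive_on_const[of M J f0] by auto
next
  case (Suc n)
  then obtain \<phi> \<psi> where p: "primitive_on M J (fst (picard n)) \<phi>" "primitive_on M J (snd (picard n)) \<psi>" by auto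
  have "primitive_on M J (fst (picard (Suc n))) (\<lambda>t. s t * snd (picard n) t)"
    unfolding picard.simps fst_conv
    by (rule primitive_on_integral[OF least]) (use set_integrable_mult_primitive[OF p(2) least(1)] least int_s in auto)
  moreover have "primitive_on M J (snd (picard (Suc n))) (\<lambda>t. k t * fst (picard n) t)"
    unfolding picard.simps snd_conv
    by (rule primitive_on_integral[OF least]) (use set_integrable_mult_primitive[OF p(1) least(1)] least int_k in auto)
  ultimately show ?case by blast
qed

lemma set_integrable_picard:
  assumes x: "x \<in> J"
  shows "set_integrable M {\<alpha>..<x} (\<lambda>t. s t * snd (picard n) t)"
    and "set_integrable M {\<alpha>..<x} (\<lambda>t. k t * fst (picard n) t)"
  using primitive_on_picard[of n] set_integrable_mult_primitive[OF _ least(1) x least(2)[OF x] int_s[OF x]]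
    set_integrable_mult_primitive[OF _ least(1) x least(2)[OF x] int_k[OF x]] by auto

text \<open>One weight dominating both coefficients lets the two components, each fed by the other,
  share a single bound.\<close>

definition "weight t = norm (s t) + norm (k t)"

lemma weight_nonneg: "0 \<le> weight t" by (simp add: weight_def)

lemma le_weight: "norm (s t) \<le> weight t" "norm (k t) \<le> weight t"
  by (simp_all add: weight_def)

lemma int_weight: "x \<in> J \<Longrightarrow> set_integrable M {\<alpha>..<x} weight"
  unfolding weight_def[abs_def] using int_s int_k
  by (intro set_integral_add(1)) (auto intro: set_integrable_norm)

abbreviation "ii \<equiv> iterated_integral \<alpha> weight"

lemmas ii_simps = iterated_integral.simps[OF least int_weight weight_nonneg]

text \<open>\<open>c\<close> stands for \<open>s\<close> or \<open>k\<close>, and \<open>h\<close>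
  for the opposite component of the preceding term; one integration raises the index of
  \<open>ii\<close>. The bound on the integral of the norm is the one that later permits exchanging
  sum and integral.\<close>

lemma picard_step_bound:
  fixes c h :: "real \<Rightarrow> complex"
  assumes x: "x \<in> J" and y: "y \<in> J" "x \<le> y"
    and c: "set_integrable M {\<alpha>..<x} (\<lambda>t. c t * h t)" "\<And>t. norm (c t) \<le> weight t"
    and h: "\<And>t. t \<in> {\<alpha>..<x} \<Longrightarrow> norm (h t) \<le> C * ii n t"
  shows "(LINT t:{\<alpha>..<x}|M. norm (c t * h t)) \<le> C * ii (Suc n) x"
    and "norm (LINT t:{\<alpha>..<x}|M. c t * h t) \<le> C * ii (Suc n) x"
proof -
  have "(LINT t:{\<alpha>..<x}|M. norm (c t * h t)) \<le> (LINT t:{\<alpha>..<x}|M. C * (weight t * ii n t))"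
  proof (rule set_integral_mono)
    show "set_integrable M {\<alpha>..<x} (\<lambda>t. norm (c t * h t))" using c(1) by (rule set_integrable_norm)
    show "set_integrable M {\<alpha>..<x} (\<lambda>t. C * (weight t * ii n t))"
      by (intro set_integrable_mult_right set_integrable_mult_iterated_integral[OF least int_weight weight_nonneg x])
    fix t assume t: "t \<in> {\<alpha>..<x}"
    have "norm (c t) * norm (h t) \<le> weight t * (C * ii n t)"
      by (rule mult_mono[OF c(2) h[OF t] weight_nonneg]) simp
    then show "norm (c t * h t) \<le> C * (weight t * ii n t)"
      by (simp add: norm_mult ac_simps)
  qed
  also have "\<dots> = C * ii (Suc n) x"
    unfolding set_integral_mult_right by (simp add: ii_simps)
  finally show 1: "(LINT t:{\<alpha>..<x}|M. norm (c t * h t)) \<le> C * ii (Suc n) x" .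
  then show "norm (LINT t:{\<alpha>..<x}|M. c t * h t) \<le> C * ii (Suc n) x"
    using set_integral_norm_bound[OF c(1)] by linarith
qed

text \<open>A bound for both components of term 0 on \<open>{\<alpha>..y}\<close>. It depends on the
  right end \<open>y\<close> instead of the running point, so the induction in
  \<open>picard_bound\<close> carries one fixed constant.\<close>

definition "picard_const y = norm f0 + norm q0 + (LINT t:{\<alpha>..<y}|M. norm (g t))"

lemma picard_bound:
  assumes y: "y \<in> J" and x: "x \<in> {\<alpha>..y}"
  shows "norm (fst (picard n) x) \<le> picard_const y * ii n x \<and> norm (snd (picard n) x) \<le> picard_const y * ii n x"
  using x
proof (induction n arbitrary: x)
  case 0
  have p: "primitive_on M J (\<lambda>x. q0 + (LINT t:{\<alpha>..<x}|M. g t)) g"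
    by (rule primitive_on_integral[OF least int_g])
  have "norm (snd (picard 0) x) \<le> norm q0 + (LINT t:{\<alpha>..<y}|M. norm (g t))"
    using primitive_on_bounded[OF p least(1) y 0] by (simp add: set_lebesgue_integral_def)
  moreover have "0 \<le> (LINT t:{\<alpha>..<y}|M. norm (g t))"
    unfolding set_lebesgue_integral_def by (rule Bochner_Integration.integral_nonneg) simp
  moreover have "norm (fst (picard 0) x) = norm f0" by simp
  moreover have "picard_const y * ii 0 x = picard_const y" by (simp add: ii_simps)
  ultimately show ?case
    unfolding picard_const_def using norm_ge_zero[of f0] norm_ge_zero[of q0] by linarith
next
  case (Suc n)
  then have x: "x \<in> J" "x \<le> y" using mem_J[OF least(1) y, of x] by auto
  have IH: "norm (fst (picard n) t) \<le> picard_const y * ii n t" "norm (snd (picard n) t) \<le> picard_const y * ii n t"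
    if "t \<in> {\<alpha>..<x}" for t
    using Suc.IH[of t] that x by auto
  show ?case
    unfolding picard.simps fst_conv snd_conv add_0
    by (intro conjI picard_step_bound(2)[OF x(1) y x(2)] set_integrable_picard[OF x(1)] le_weight IH)
qed

lemma picard_summable:
  assumes x: "x \<in> J"
  shows "summable (\<lambda>n. norm (fst (picard n) x))" "summable (\<lambda>n. norm (snd (picard n) x))"
proof -
  have s: "summable (\<lambda>n. picard_const x * ii n x)"
    by (intro summable_mult summable_iterated_integral[OF least int_weight weight_nonneg x])
  show "summable (\<lambda>n. norm (fst (picard n) x))" "summable (\<lambda>n. norm (snd (picard n) x))"
    by (rule summable_comparison_test'[OF s]; use picard_bound[OF x, of x] least(2)[OF x] in auto)+
qed

text \<open>Absolute summability of the Picard terms lets integration pass through the sum;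
  splitting off term 0 and shifting the index turns the recursion into the integral
  equations.\<close>

lemma Volterra_existence:
  "\<exists>f q. primitive_on M J f (\<lambda>t. s t * q t) \<and> primitive_on M J q (\<lambda>t. k t * f t + g t) \<and> f \<alpha> = f0 \<and> q \<alpha> = q0"
proof -
  define f where "f x = (\<Sum>n. fst (picard n) x)" for x
  define q where "q x = (\<Sum>n. snd (picard n) x)" for x
  \<comment> \<open>Stated for a generic coefficient \<open>c\<close> and sequence \<open>h\<close>:
    it is applied to \<open>s\<close> with the second components and to \<open>k\<close> with the
    first ones.\<close>
  have int: "set_integrable M {\<alpha>..<x} (\<lambda>t. c t * (\<Sum>n. h n t)) \<and>
      (LINT t:{\<alpha>..<x}|M. c t * (\<Sum>n. h n t)) = (\<Sum>n. LINT t:{\<alpha>..<x}|M. c t * h n t)"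
    if x: "x \<in> J" and c: "\<And>n. set_integrable M {\<alpha>..<x} (\<lambda>t. c t * h n t)" "\<And>t. norm (c t) \<le> weight t"
      and h: "\<And>n t. t \<in> {\<alpha>..x} \<Longrightarrow> norm (h n t) \<le> picard_const x * ii n t"
      and hs: "\<And>t. t \<in> J \<Longrightarrow> summable (\<lambda>n. norm (h n t))" for x and c :: "real \<Rightarrow> complex" and h
  proof -
    have sub: "t \<in> J" if "t \<in> {\<alpha>..<x}" for t using mem_J[OF least(1) x, of t] that by auto
    have b: "(LINT t:{\<alpha>..<x}|M. norm (c t * h n t)) \<le> picard_const x * ii (Suc n) x" for n
      by (rule picard_step_bound(1)[OF x x order_refl c]) (use h in auto)
    have nn: "0 \<le> (LINT t:{\<alpha>..<x}|M. norm (c t * h n t))" for n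
      unfolding set_lebesgue_integral_def by (rule Bochner_Integration.integral_nonneg) simp
    have su: "summable (\<lambda>n. picard_const x * ii (Suc n) x)"
      using summable_iterated_integral[OF least int_weight weight_nonneg x]
      by (intro summable_mult) (subst summable_Suc_iff)
    have 3: "summable (\<lambda>n. LINT t:{\<alpha>..<x}|M. norm (c t * h n t))"
      by (rule summable_comparison_test'[OF su, of 0]) (use b nn in \<open>simp only: real_norm_def abs_of_nonneg\<close>)
    have 2: "summable (\<lambda>n. norm (c t * h n t))" if "t \<in> {\<alpha>..<x}" for t
      using hs[OF sub[OF that]] by (simp add: norm_mult summable_mult)
    have eq: "(\<Sum>n. c t * h n t) = c t * (\<Sum>n. h n t)" if "t \<in> {\<alpha>..<x}" for t
      using summable_norm_cancel[OF hs[OF sub[OF that]]] by (rule suminf_mult)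
    have eq': "indicator {\<alpha>..<x} t *\<^sub>R (\<Sum>n. c t * h n t) = indicator {\<alpha>..<x} t *\<^sub>R (c t * (\<Sum>n. h n t))" for t
      using eq[of t] by (auto simp: indicator_def)
    show ?thesis
      using set_integral_suminf[OF c(1) 2 3]
      unfolding set_integrable_def set_lebesgue_integral_def eq' by auto
  qed
  have ints: "set_integrable M {\<alpha>..<x} (\<lambda>t. s t * q t)"
    and fx: "f x = f0 + (LINT t:{\<alpha>..<x}|M. s t * q t)"
    and intk: "set_integrable M {\<alpha>..<x} (\<lambda>t. k t * f t)"
    and qx: "q x = q0 + (LINT t:{\<alpha>..<x}|M. g t) + (LINT t:{\<alpha>..<x}|M. k t * f t)" if x: "x \<in> J" for x
  proof -
    have 1: "set_integrable M {\<alpha>..<x} (\<lambda>t. s t * q t) \<and>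
      (LINT t:{\<alpha>..<x}|M. s t * q t) = (\<Sum>n. LINT t:{\<alpha>..<x}|M. s t * snd (picard n) t)"
      unfolding q_def using set_integrable_picard(1)[OF x] picard_bound[OF x] picard_summable(2)
      by (intro int[OF x]) (auto simp: le_weight)
    have 2: "set_integrable M {\<alpha>..<x} (\<lambda>t. k t * f t) \<and>
      (LINT t:{\<alpha>..<x}|M. k t * f t) = (\<Sum>n. LINT t:{\<alpha>..<x}|M. k t * fst (picard n) t)"
      unfolding f_def using set_integrable_picard(2)[OF x] picard_bound[OF x] picard_summable(1)
      by (intro int[OF x]) (auto simp: le_weight)
    show "set_integrable M {\<alpha>..<x} (\<lambda>t. s t * q t)" "set_integrable M {\<alpha>..<x} (\<lambda>t. k t * f t)"
      using 1 2 by auto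
    have "f x = (\<Sum>n. fst (picard (Suc n)) x) + fst (picard 0) x"
      unfolding f_def using suminf_split_head[OF summable_norm_cancel[OF picard_summable(1)[OF x]]] by simp
    then show "f x = f0 + (LINT t:{\<alpha>..<x}|M. s t * q t)"
      using 1 by simp
    have "q x = (\<Sum>n. snd (picard (Suc n)) x) + snd (picard 0) x"
      unfolding q_def using suminf_split_head[OF summable_norm_cancel[OF picard_summable(2)[OF x]]] by simp
    then show "q x = q0 + (LINT t:{\<alpha>..<x}|M. g t) + (LINT t:{\<alpha>..<x}|M. k t * f t)"
      using 2 by simp
  qed
  have "primitive_on M J f (\<lambda>t. s t * q t)"
    by (rule primitive_onI_integral[OF least ints fx])
  moreover have "primitive_on M J q (\<lambda>t. k t * f t + g t)"
  proof (rule primitive_onI_integral[OF least])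
    fix x assume x: "x \<in> J"
    show "set_integrable M {\<alpha>..<x} (\<lambda>t. k t * f t + g t)"
      using intk[OF x] int_g[OF x] by (rule set_integral_add(1))
    show "q x = q0 + (LINT t:{\<alpha>..<x}|M. k t * f t + g t)"
      unfolding qx[OF x] set_integral_add(2)[OF intk[OF x] int_g[OF x]] by (simp add: add.assoc add.commute)
  qed
  moreover have "f \<alpha> = f0" "q \<alpha> = q0"
    using fx[OF least(1)] qx[OF least(1)] by (simp_all add: set_lebesgue_integral_def)
  ultimately show ?thesis by blast
qed

end

end

section \<open>First order systems driven by a measure\<close>

text \<open>Cramer's rule: the first two hypotheses form a homogeneous linear system for
  \<open>f\<close> and \<open>q\<close>, whose determinant is the Wronskian in the third.\<close>

lemma Wronskian_elimination:
  fixes f q u1 u2 p1 p2 :: complex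
  assumes W1: "f * p1 - q * u1 = 0" and W2: "f * p2 - q * u2 = 0" and W: "u1 * p2 - p1 * u2 = 1"
  shows "f = 0 \<and> q = 0"
proof -
  have "f = f * (u1 * p2 - p1 * u2)" unfolding W by simp
  also have "\<dots> = u1 * (f * p2 - q * u2) - u2 * (f * p1 - q * u1)"
    by (simp add: algebra_simps)
  finally have "f = 0" unfolding W1 W2 by simp
  moreover have "q = q * (u1 * p2 - p1 * u2)" unfolding W by simp
  then have "q = p1 * (f * p2 - q * u2) - p2 * (f * p1 - q * u1)"
    by (simp add: algebra_simps)
  then have "q = 0" unfolding W1 W2 by simp
  ultimately show ?thesis ..
qed

text \<open>\<open>s\<close>, \<open>k\<close> and \<open>r\<close> stand for the densities of
  \<sigma>, \<kappa> and \<rho> with respect to \<open>M\<close>; since they are real, conjugation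
  maps solutions to solutions. The jump conditions carry the factor \<open>measure M {x}\<close>
  once because the product rule produces it in that form.\<close>

locale measure_system = loc_finite_interval +
  fixes s k r :: "real \<Rightarrow> complex"
  assumes int_s: "x \<in> J \<Longrightarrow> y \<in> J \<Longrightarrow> set_integrable M {x..<y} s"
    and int_k: "x \<in> J \<Longrightarrow> y \<in> J \<Longrightarrow> set_integrable M {x..<y} k"
    and cnj_s: "cnj (s t) = s t" and cnj_k: "cnj (k t) = k t" and cnj_r: "cnj (r t) = r t"
    and no_common_jump_sk: "x \<in> J \<Longrightarrow> s x * k x * of_real (measure M {x}) = 0"
    and no_common_jump_sr: "x \<in> J \<Longrightarrow> s x * r x * of_real (measure M {x}) = 0"
begin

definition solution_on :: "real set \<Rightarrow> (real \<Rightarrow> complex) \<Rightarrow> (real \<Rightarrow> complex) \<Rightarrow> (real \<Rightarrow> complex) \<Rightarrow> bool" where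
  "solution_on K f q G \<longleftrightarrow> primitive_on M K f (\<lambda>t. s t * q t) \<and> primitive_on M K q (\<lambda>t. k t * f t - r t * G t)"

lemma solution_on_subset: "solution_on K f q G \<Longrightarrow> K' \<subseteq> K \<Longrightarrow> solution_on K' f q G"
  unfolding solution_on_def using primitive_on_subset by blast

lemma solution_on_add:
  assumes "solution_on K f q G" "solution_on K g p H"
  shows "solution_on K (\<lambda>x. f x + g x) (\<lambda>x. q x + p x) (\<lambda>x. G x + H x)"
proof -
  have "primitive_on M K (\<lambda>x. f x + g x) (\<lambda>t. s t * q t + s t * p t)"
    "primitive_on M K (\<lambda>x. q x + p x) (\<lambda>t. (k t * f t - r t * G t) + (k t * g t - r t * H t))"
    using assms by (auto simp: solution_on_def intro!: primitive_on_add)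
  then show ?thesis by (simp add: solution_on_def algebra_simps)
qed

lemma solution_on_cmult:
  assumes "solution_on K f q G"
  shows "solution_on K (\<lambda>x. C * f x) (\<lambda>x. C * q x) (\<lambda>x. C * G x)"
proof -
  have "primitive_on M K (\<lambda>x. C * f x) (\<lambda>t. C * (s t * q t))"
    "primitive_on M K (\<lambda>x. C * q x) (\<lambda>t. C * (k t * f t - r t * G t))"
    using assms by (auto simp: solution_on_def intro!: primitive_on_cmult)
  then show ?thesis by (simp add: solution_on_def algebra_simps)
qed

lemma solution_on_diff:
  assumes "solution_on K f q G" "solution_on K g p H"
  shows "solution_on K (\<lambda>x. f x - g x) (\<lambda>x. q x - p x) (\<lambda>x. G x - H x)"
  using solution_on_add[OF assms(1) solution_on_cmult[OF assms(2), of "-1"]] by simp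

lemma solution_on_cnj:
  assumes "solution_on K f q G"
  shows "solution_on K (\<lambda>x. cnj (f x)) (\<lambda>x. cnj (q x)) (\<lambda>x. cnj (G x))"
  using assms primitive_on_cnj[of M K f "\<lambda>t. s t * q t"] primitive_on_cnj[of M K q "\<lambda>t. k t * f t - r t * G t"]
  by (simp add: solution_on_def cnj_s cnj_k cnj_r)

lemma solution_on_cong:
  assumes "solution_on K f q G" "is_interval K"
    "\<And>x. x \<in> K \<Longrightarrow> f x = g x" "\<And>x. x \<in> K \<Longrightarrow> q x = p x" "\<And>x. x \<in> K \<Longrightarrow> r x * G x = r x * H x"
  shows "solution_on K g p H"
  unfolding solution_on_def
proof
  show "primitive_on M K g (\<lambda>t. s t * p t)"
    by (rule primitive_on_cong[of M K f "\<lambda>t. s t * q t"]) (use assms in \<open>auto simp: solution_on_def\<close>)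
  show "primitive_on M K p (\<lambda>t. k t * g t - r t * H t)"
    by (rule primitive_on_cong[of M K q "\<lambda>t. k t * f t - r t * G t"]) (use assms in \<open>auto simp: solution_on_def\<close>)
qed

lemma solution_on_Lagrange:
  assumes sol: "solution_on K f q G" "solution_on K g p H" and K: "K \<subseteq> J" "is_interval K"
  shows "primitive_on M K (\<lambda>t. f t * p t - q t * g t) (\<lambda>t. r t * (G t * g t - f t * H t))"
proof -
  interpret K: loc_finite_interval M K by (rule loc_finite_interval_subset[OF K])
  let ?m = "\<lambda>t. of_real (measure M {t}) :: complex"
  have 1: "primitive_on M K (\<lambda>t. f t * p t - q t * g t)
     (\<lambda>t. (s t * q t * p t + f t * (k t * g t - r t * H t) + s t * q t * (k t * g t - r t * H t) * ?m t)
        - ((k t * f t - r t * G t) * g t + q t * (s t * p t) + (k t * f t - r t * G t) * (s t * p t) * ?m t))"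
    using sol by (intro primitive_on_diff K.primitive_on_mult) (auto simp: solution_on_def)
  show ?thesis
  proof (rule primitive_on_cong[OF 1 K(2) refl])
    fix t assume "t \<in> K"
    then have t: "t \<in> J" using K by auto
    \<comment> \<open>Each monomial of a jump term contains \<open>s\<close> times \<open>k\<close>
      or \<open>s\<close> times \<open>r\<close>, together with the mass of the point.\<close>
    have "s t * q t * (k t * g t - r t * H t) * ?m t
       = q t * g t * (s t * k t * ?m t) - q t * H t * (s t * r t * ?m t)" by (simp only: algebra_simps)
    then have e1: "s t * q t * (k t * g t - r t * H t) * ?m t = 0"
      unfolding no_common_jump_sk[OF t] no_common_jump_sr[OF t] by simp
    have "(k t * f t - r t * G t) * (s t * p t) * ?m t
       = f t * p t * (s t * k t * ?m t) - G t * p t * (s t * r t * ?m t)" by (simp only: algebra_simps)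
    then have e2: "(k t * f t - r t * G t) * (s t * p t) * ?m t = 0"
      unfolding no_common_jump_sk[OF t] no_common_jump_sr[OF t] by simp
    show "(s t * q t * p t + f t * (k t * g t - r t * H t) + s t * q t * (k t * g t - r t * H t) * ?m t)
        - ((k t * f t - r t * G t) * g t + q t * (s t * p t) + (k t * f t - r t * G t) * (s t * p t) * ?m t)
        = r t * (G t * g t - f t * H t)"
      unfolding e1 e2 by (simp add: algebra_simps)
  qed
qed

lemma Wronskian_const:
  assumes sol: "solution_on K f q (\<lambda>_. 0)" "solution_on K g p (\<lambda>_. 0)" and K: "K \<subseteq> J" "is_interval K"
    and xy: "x \<in> K" "y \<in> K"
  shows "f x * p x - q x * g x = f y * p y - q y * g y"
proof -
  have "f y * p y - q y * g y = f x * p x - q x * g x" if "x \<in> K" "y \<in> K" "x \<le> y" for x y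
    using primitive_onD(2)[OF solution_on_Lagrange[OF sol K] that] by simp
  then show ?thesis using xy by (cases "x \<le> y") (metis, metis linear)
qed

lemma right_existence:
  assumes K: "K \<subseteq> J" "is_interval K" and \<alpha>: "\<alpha> \<in> K" "\<And>x. x \<in> K \<Longrightarrow> \<alpha> \<le> x"
    and G: "\<And>x. x \<in> K \<Longrightarrow> set_integrable M {\<alpha>..<x} (\<lambda>t. r t * G t)"
  obtains f q where "solution_on K f q G" "f \<alpha> = A" "q \<alpha> = B"
proof -
  interpret K: loc_finite_interval M K by (rule loc_finite_interval_subset[OF K])
  have "\<exists>f q. primitive_on M K f (\<lambda>t. s t * q t) \<and> primitive_on M K q (\<lambda>t. k t * f t + - (r t * G t)) \<and> f \<alpha> = A \<and> q \<alpha> = B"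
  proof (rule K.Volterra_existence[OF \<alpha>])
    fix x assume x: "x \<in> K"
    have "x \<in> J" "\<alpha> \<in> J" using x \<alpha>(1) K(1) by auto
    then show "set_integrable M {\<alpha>..<x} s" "set_integrable M {\<alpha>..<x} k"
      using int_s int_k by blast+
    show "set_integrable M {\<alpha>..<x} (\<lambda>t. - (r t * G t))"
      using G[OF x] unfolding set_integrable_def by simp
  qed
  then show thesis using that by (auto simp: solution_on_def)
qed

lemma fundamental_system:
  assumes K: "K \<subseteq> J" "is_interval K" and \<alpha>: "\<alpha> \<in> K" "\<And>x. x \<in> K \<Longrightarrow> \<alpha> \<le> x"
  obtains u1 p1 u2 p2 where "solution_on K u1 p1 (\<lambda>_. 0)" "solution_on K u2 p2 (\<lambda>_. 0)"
    "u1 \<alpha> = 1" "p1 \<alpha> = 0" "u2 \<alpha> = 0" "p2 \<alpha> = 1"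
proof -
  have G: "set_integrable M {\<alpha>..<x} (\<lambda>t. r t * 0)" for x by (simp add: set_integrable_def)
  obtain u1 p1 where "solution_on K u1 p1 (\<lambda>_. 0)" "u1 \<alpha> = 1" "p1 \<alpha> = 0"
    using right_existence[where A = 1 and B = 0, OF K \<alpha> G] by blast
  moreover obtain u2 p2 where "solution_on K u2 p2 (\<lambda>_. 0)" "u2 \<alpha> = 0" "p2 \<alpha> = 1"
    using right_existence[where A = 0 and B = 1, OF K \<alpha> G] by blast
  ultimately show thesis using that by blast
qed

text \<open>Zero data at \<open>c\<close> make the Wronskians of \<open>f\<close> with both members
  of a fundamental system vanish at \<open>c\<close>, hence at \<open>x\<close>, and Cramer's rule
  concludes. No estimate is involved, so the argument does not depend on the side of
  \<open>c\<close> on which \<open>x\<close> lies.\<close>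

lemma solution_on_unique_zero:
  assumes sol: "solution_on K f q (\<lambda>_. 0)" and K: "K \<subseteq> J" "is_interval K"
    and c: "c \<in> K" "f c = 0" "q c = 0" and x: "x \<in> K"
  shows "f x = 0 \<and> q x = 0"
proof -
  \<comment> \<open>The fundamental system is started at the left end of the hull of
    \<open>c\<close> and \<open>x\<close>, so that it exists at both points.\<close>
  define L where "L = {min c x..max c x}"
  have "min c x \<in> K" "max c x \<in> K" using c(1) x by (auto simp: min_def max_def)
  then have "L \<subseteq> K"
    using K(2) unfolding L_def is_interval_1 by (meson atLeastAtMost_iff subsetI)
  then have L: "L \<subseteq> K" "is_interval L" "c \<in> L" "x \<in> L" "min c x \<in> L"
    by (auto simp: L_def is_interval_cc)
  have LJ: "L \<subseteq> J" using L K by auto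
  have least: "t \<in> L \<Longrightarrow> min c x \<le> t" for t by (simp add: L_def)
  obtain u1 p1 u2 p2 where u: "solution_on L u1 p1 (\<lambda>_. 0)" "solution_on L u2 p2 (\<lambda>_. 0)"
    "u1 (min c x) = 1" "p1 (min c x) = 0" "u2 (min c x) = 0" "p2 (min c x) = 1"
    using fundamental_system[OF LJ L(2) L(5) least] by metis
  note sol' = solution_on_subset[OF sol L(1)]
  have W1: "f x * p1 x - q x * u1 x = 0"
    using Wronskian_const[OF sol' u(1) LJ L(2) L(4,3)] c by simp
  have W2: "f x * p2 x - q x * u2 x = 0"
    using Wronskian_const[OF sol' u(2) LJ L(2) L(4,3)] c by simp
  have W: "u1 x * p2 x - p1 x * u2 x = 1"
    using Wronskian_const[OF u(1,2) LJ L(2) L(4) L(5)] u by simp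
  show ?thesis by (rule Wronskian_elimination[OF W1 W2 W])
qed

lemma solution_on_unique:
  assumes sol: "solution_on K f q G" "solution_on K g p G" and K: "K \<subseteq> J" "is_interval K"
    and c: "c \<in> K" "f c = g c" "q c = p c" and x: "x \<in> K"
  shows "f x = g x \<and> q x = p x"
  using solution_on_unique_zero[of K "\<lambda>x. f x - g x" "\<lambda>x. q x - p x" c x]
    solution_on_diff[OF sol] K c x by auto

text \<open>Solutions started at the left end \<open>\<alpha>\<close> exist, and since the Wronskian is 1 at \<open>c\<close> as well,
  a combination of them attains arbitrary data at \<open>c\<close>; no equation is ever solved to the left.\<close>
lemma compact_existence:
  assumes \<alpha>\<beta>: "\<alpha> \<in> J" "\<beta> \<in> J" and c: "c \<in> {\<alpha>..\<beta>}"
    and G: "\<And>x. x \<in> {\<alpha>..\<beta>} \<Longrightarrow> set_integrable M {\<alpha>..<x} (\<lambda>t. r t * G t)"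
  obtains f q where "solution_on {\<alpha>..\<beta>} f q G" "f c = A" "q c = B"
proof -
  have K: "{\<alpha>..\<beta>} \<subseteq> J" "is_interval {\<alpha>..\<beta>}" using mem_J[OF \<alpha>\<beta>] by (auto simp: is_interval_cc)
  have \<alpha>: "\<alpha> \<in> {\<alpha>..\<beta>}" "\<And>x. x \<in> {\<alpha>..\<beta>} \<Longrightarrow> \<alpha> \<le> x" using c by auto
  obtain u1 p1 u2 p2 where u: "solution_on {\<alpha>..\<beta>} u1 p1 (\<lambda>_. 0)" "solution_on {\<alpha>..\<beta>} u2 p2 (\<lambda>_. 0)"
    "u1 \<alpha> = 1" "p1 \<alpha> = 0" "u2 \<alpha> = 0" "p2 \<alpha> = 1"
    using fundamental_system[OF K \<alpha>] by metis
  obtain P Q where P: "solution_on {\<alpha>..\<beta>} P Q G" "P \<alpha> = 0" "Q \<alpha> = 0"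
    using right_existence[OF K \<alpha> G] by metis
  have W: "u1 c * p2 c - p1 c * u2 c = 1"
    using Wronskian_const[OF u(1,2) K c \<alpha>(1)] u by simp
  define A' B' where "A' = A - P c" "B' = B - Q c"
  \<comment> \<open>Coefficients from Cramer's rule, the determinant in \<open>W\<close> being
    1.\<close>
  define c1 c2 where "c1 = A' * p2 c - B' * u2 c" "c2 = B' * u1 c - A' * p1 c"
  have "solution_on {\<alpha>..\<beta>} (\<lambda>x. P x + (c1 * u1 x + c2 * u2 x)) (\<lambda>x. Q x + (c1 * p1 x + c2 * p2 x)) (\<lambda>x. G x + (c1 * 0 + c2 * 0))"
    by (intro solution_on_add solution_on_cmult P u)
  moreover have "c1 * u1 c + c2 * u2 c = A' * (u1 c * p2 c - p1 c * u2 c)"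
    "c1 * p1 c + c2 * p2 c = B' * (u1 c * p2 c - p1 c * u2 c)"
    by (simp_all add: c1_c2_def algebra_simps)
  ultimately show thesis
    using that unfolding W by (auto simp: A'_B'_def)
qed

text \<open>The value at \<open>x\<close> is read off a solution on the hull of \<open>x\<close> and
  \<open>c\<close>. All these solutions have the same data at \<open>c\<close>, so uniqueness glues
  the diagonal of the family into one solution.\<close>

lemma global_existence:
  assumes c: "c \<in> J" and G: "\<And>x y. x \<in> J \<Longrightarrow> y \<in> J \<Longrightarrow> set_integrable M {x..<y} (\<lambda>t. r t * G t)"
  obtains f q where "solution_on J f q G" "f c = A" "q c = B"
proof -
  have "\<exists>f q. solution_on {min x c..max x c} f q G \<and> f c = A \<and> q c = B" if "x \<in> J" for x
  proof -
    have "min x c \<in> J" "max x c \<in> J" "c \<in> {min x c..max x c}" using that c by (auto simp: min_def max_def)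
    moreover have "set_integrable M {min x c..<y} (\<lambda>t. r t * G t)" if "y \<in> {min x c..max x c}" for y
      using G[OF calculation(1)] mem_J[OF calculation(1,2), of y] that by auto
    ultimately show ?thesis using compact_existence by metis
  qed
  then obtain \<phi> \<psi> where sol: "\<And>x. x \<in> J \<Longrightarrow> solution_on {min x c..max x c} (\<phi> x) (\<psi> x) G"
    "\<And>x. x \<in> J \<Longrightarrow> \<phi> x c = A" "\<And>x. x \<in> J \<Longrightarrow> \<psi> x c = B" by metis
  \<comment> \<open>Any solution with the data \<open>A\<close>, \<open>B\<close> on a compact
    interval containing \<open>c\<close> agrees with the diagonal of the chosen family.\<close>
  have eq: "\<phi> x x = f x \<and> \<psi> x x = q x" if f: "solution_on {\<alpha>..\<beta>} f q G" "f c = A" "q c = B"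
    and \<alpha>\<beta>: "\<alpha> \<in> J" "\<beta> \<in> J" "c \<in> {\<alpha>..\<beta>}" "x \<in> {\<alpha>..\<beta>}" for f q \<alpha> \<beta> x
  proof -
    have sub: "{\<alpha>..\<beta>} \<subseteq> J" using mem_J[OF \<alpha>\<beta>(1,2)] by auto
    then have x: "x \<in> J" using \<alpha>\<beta> by auto
    have sub': "{min x c..max x c} \<subseteq> {\<alpha>..\<beta>}" using \<alpha>\<beta> by auto
    have sub'': "{min x c..max x c} \<subseteq> J" using sub sub' by blast
    show ?thesis
      using sub'' f sol(2,3)[OF x]
      by (intro solution_on_unique[OF sol(1)[OF x] solution_on_subset[OF f(1) sub'], of c])
         (auto simp: is_interval_cc)
  qed
  have "primitive_on M J (\<lambda>x. \<phi> x x) (\<lambda>t. s t * \<psi> t t) \<and> primitive_on M J (\<lambda>x. \<psi> x x) (\<lambda>t. k t * \<phi> t t - r t * G t)"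
  proof -
    have *: "primitive_on M {x..y} (\<lambda>x. \<phi> x x) (\<lambda>t. s t * \<psi> t t) \<and> primitive_on M {x..y} (\<lambda>x. \<psi> x x) (\<lambda>t. k t * \<phi> t t - r t * G t)"
      if xy: "x \<in> J" "y \<in> J" "x \<le> y" for x y
    proof -
      \<comment> \<open>The interval is enlarged to contain \<open>c\<close>, where the data for the
        comparison are prescribed.\<close>
      let ?\<alpha> = "min x c" and ?\<beta> = "max y c"
      have \<alpha>\<beta>: "?\<alpha> \<in> J" "?\<beta> \<in> J" "c \<in> {?\<alpha>..?\<beta>}" using xy c by (auto simp: min_def max_def)
      have "set_integrable M {?\<alpha>..<z} (\<lambda>t. r t * G t)" if "z \<in> {?\<alpha>..?\<beta>}" for z
        using G[OF \<alpha>\<beta>(1)] mem_J[OF \<alpha>\<beta>(1,2), of z] that by auto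
      then obtain f q where f: "solution_on {?\<alpha>..?\<beta>} f q G" "f c = A" "q c = B"
        using compact_existence[OF \<alpha>\<beta>] by metis
      have sub: "{x..y} \<subseteq> {?\<alpha>..?\<beta>}" by auto
      have "solution_on {x..y} (\<lambda>x. \<phi> x x) (\<lambda>x. \<psi> x x) G"
      proof (rule solution_on_cong[OF solution_on_subset[OF f(1) sub] is_interval_cc _ _ refl])
        fix t assume "t \<in> {x..y}"
        then have "\<phi> t t = f t \<and> \<psi> t t = q t" using eq[OF f \<alpha>\<beta>] sub by blast
        then show "f t = \<phi> t t" "q t = \<psi> t t" by simp_all
      qed
      then show ?thesis by (simp add: solution_on_def)
    qed
    show ?thesis
    proof (intro conjI primitive_onI)
      fix x y assume xy: "x \<in> J" "y \<in> J" "x \<le> y"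
      then have m: "x \<in> {x..y}" "y \<in> {x..y}" by auto
      note d = primitive_onD[OF conjunct1[OF *[OF xy]] m xy(3)] primitive_onD[OF conjunct2[OF *[OF xy]] m xy(3)]
      show "set_integrable M {x..<y} (\<lambda>t. s t * \<psi> t t)" "\<phi> y y - \<phi> x x = (LINT t:{x..<y}|M. s t * \<psi> t t)"
        "set_integrable M {x..<y} (\<lambda>t. k t * \<phi> t t - r t * G t)"
        "\<psi> y y - \<psi> x x = (LINT t:{x..<y}|M. k t * \<phi> t t - r t * G t)"
        by (rule d)+
    qed
  qed
  then show thesis
    using that[of "\<lambda>x. \<phi> x x" "\<lambda>x. \<psi> x x"] sol(2,3)[OF c] by (simp add: solution_on_def)
qed

end

section \<open>A common dominating measure\<close>

lemma Iab_eq_einterval: "Iab a b = einterval a b"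
  by (simp add: Iab_def einterval_def)

lemma open_Iab [simp]: "open (Iab a b)"
  by (simp add: Iab_eq_einterval)

lemma sets_Iab [measurable, simp]: "Iab a b \<in> sets borel"
  by (simp add: Iab_eq_einterval)

lemma mem_Iab: "x \<in> Iab a b \<Longrightarrow> y \<in> Iab a b \<Longrightarrow> x \<le> t \<Longrightarrow> t \<le> y \<Longrightarrow> t \<in> Iab a b"
  using less_le_trans[of a "ereal x" "ereal t"] le_less_trans[of "ereal t" "ereal y" b]
  by (simp add: Iab_def)

lemma is_interval_Iab: "is_interval (Iab a b)"
  unfolding is_interval_1 using mem_Iab by blast

lemma Icc_subset_Iab: "x \<in> Iab a b \<Longrightarrow> y \<in> Iab a b \<Longrightarrow> {x..y} \<subseteq> Iab a b"
  by (auto intro: mem_Iab[of x a b y])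

lemma Iab_neighbours:
  assumes "x \<in> Iab a b"
  obtains y z where "y \<in> Iab a b" "z \<in> Iab a b" "y < x" "x < z"
proof -
  obtain e where e: "e > 0" "\<And>u. dist u x < e \<Longrightarrow> u \<in> Iab a b"
    using open_Iab[of a b] assms unfolding open_dist by blast
  have "x - e / 2 \<in> Iab a b" using e(1) by (intro e(2)) (simp add: dist_real_def)
  moreover have "x + e / 2 \<in> Iab a b" using e(1) by (intro e(2)) (simp add: dist_real_def)
  ultimately show thesis using e(1) by (intro that[of "x - e / 2" "x + e / 2"]) auto
qed

lemma Iab_exhaustion:
  assumes "a < b"
  obtains l u :: "nat \<Rightarrow> real" where "Iab a b = (\<Union>i. {l i..u i})" "incseq u" "decseq l"
    "\<And>i. l i < u i" "\<And>i. l i \<in> Iab a b" "\<And>i. u i \<in> Iab a b"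
proof (rule einterval_Icc_approximation[OF assms])
  fix u l :: "nat \<Rightarrow> real"
  assume *: "einterval a b = (\<Union>i. {l i..u i})" "incseq u" "decseq l" "\<And>i. l i < u i"
  have "l i \<in> Iab a b \<and> u i \<in> Iab a b" for i
    using *(4)[of i] unfolding Iab_eq_einterval *(1) by (auto intro!: exI[of _ i])
  then show thesis
    using that[of l u] * by (simp add: Iab_eq_einterval)
qed

lemma sigma_finite_Iab:
  assumes ab: "a < b" and sets: "sets M = sets borel" and null: "emeasure M (- Iab a b) = 0"
    and fin: "\<And>x y. x \<in> Iab a b \<Longrightarrow> y \<in> Iab a b \<Longrightarrow> emeasure M {x..y} < \<infinity>"
  shows "sigma_finite_measure M"
proof -
  obtain l u where lu: "Iab a b = (\<Union>i::nat. {l i..u i})" and "incseq u" "decseq l" "\<And>i. l i < u i"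
    and lu_mem: "\<And>i. l i \<in> Iab a b" "\<And>i. u i \<in> Iab a b"
    by (rule Iab_exhaustion[OF ab], rule that)
  have sp: "space M = UNIV" using sets_eq_imp_space_eq[OF sets] by simp
  show ?thesis
  proof (rule sigma_finite_measure.intro)
    let ?A = "insert (- Iab a b) (range (\<lambda>i. {l i..u i}))"
    have 1: "countable ?A" by simp
    have "- Iab a b \<in> sets borel" "{l i..u i} \<in> sets borel" for i by (intro borel_comp sets_Iab) simp
    then have 2: "?A \<subseteq> sets M" unfolding sets by blast
    have 3: "\<Union>?A = space M" unfolding sp lu(1) by blast
    have 4: "\<forall>A\<in>?A. emeasure M A \<noteq> \<infinity>"
    proof
      fix A assume "A \<in> ?A"
      then consider "A = - Iab a b" | i where "A = {l i..u i}" by blast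
      then show "emeasure M A \<noteq> \<infinity>"
      proof cases
        case (2 i)
        then show ?thesis using fin[OF lu_mem, of i i] by simp
      qed (use null in simp)
    qed
    show "\<exists>A. countable A \<and> A \<subseteq> sets M \<and> \<Union>A = space M \<and> (\<forall>a\<in>A. emeasure M a \<noteq> \<infinity>)"
      by (intro exI[of _ ?A] conjI 1 2 3 4)
  qed
qed

definition sum_measure :: "'i set \<Rightarrow> ('i \<Rightarrow> real measure) \<Rightarrow> real measure" where
  "sum_measure K \<nu> = measure_of UNIV (sets borel) (\<lambda>A. \<Sum>i\<in>K. emeasure (\<nu> i) A)"

lemma sets_sum_measure [simp]: "sets (sum_measure K \<nu>) = sets borel"
proof -
  have "sigma_sets UNIV (sets borel) = sets (borel :: real measure)"
    using sets.sigma_sets_eq[of "borel :: real measure"] by simp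
  then show ?thesis by (simp add: sum_measure_def sets_measure_of)
qed

lemma emeasure_sum_measure:
  assumes K: "finite K" and sets: "\<And>i. i \<in> K \<Longrightarrow> sets (\<nu> i) = sets borel" and A: "A \<in> sets borel"
  shows "emeasure (sum_measure K \<nu>) A = (\<Sum>i\<in>K. emeasure (\<nu> i) A)"
proof (rule emeasure_measure_of[OF sum_measure_def])
  show "positive (sets (sum_measure K \<nu>)) (\<lambda>A. \<Sum>i\<in>K. emeasure (\<nu> i) A)"
    by (simp add: positive_def)
  show "countably_additive (sets (sum_measure K \<nu>)) (\<lambda>A. \<Sum>i\<in>K. emeasure (\<nu> i) A)"
  proof (rule countably_additiveI)
    fix B :: "nat \<Rightarrow> real set"
    assume B: "range B \<subseteq> sets (sum_measure K \<nu>)" "disjoint_family B"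
    have "(\<Sum>n. \<Sum>i\<in>K. emeasure (\<nu> i) (B n)) = (\<Sum>i\<in>K. \<Sum>n. emeasure (\<nu> i) (B n))"
      by (rule suminf_sum) auto
    also have "\<dots> = (\<Sum>i\<in>K. emeasure (\<nu> i) (\<Union>n. B n))"
      using B sets by (intro sum.cong refl suminf_emeasure) auto
    finally show "(\<Sum>n. \<Sum>i\<in>K. emeasure (\<nu> i) (B n)) = (\<Sum>i\<in>K. emeasure (\<nu> i) (\<Union>n. B n))" .
  qed
qed (use A in auto)

text \<open>The behaviour of \<nu> outside (a,b) is unspecified and is removed here. A density with
  the indicator, as opposed to a restricted space, keeps \<open>UNIV\<close> as the space and the
  Borel sets as the sigma-algebra, so that such measures can be added and compared directly.\<close>

abbreviation restricted :: "ereal \<Rightarrow> ereal \<Rightarrow> real measure \<Rightarrow> real measure" where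
  "restricted a b \<nu> \<equiv> density \<nu> (\<lambda>t. ennreal (indicator (Iab a b) t))"

text \<open>The density is real-valued, nonnegative everywhere and Borel on the whole line, so that
  the difference of the densities of two Jordan parts makes sense pointwise.\<close>

definition density_on :: "ereal \<Rightarrow> ereal \<Rightarrow> real measure \<Rightarrow> real measure \<Rightarrow> (real \<Rightarrow> real) \<Rightarrow> bool" where
  "density_on a b M \<nu> d \<longleftrightarrow> d \<in> borel_measurable borel \<and> (\<forall>t. 0 \<le> d t) \<and>
     restricted a b \<nu> = density M (\<lambda>t. ennreal (d t))"

lemma emeasure_density_indicator:
  assumes "sets \<nu> = sets borel" "A \<in> sets borel"
  shows "emeasure (restricted a b \<nu>) A = emeasure \<nu> (A \<inter> Iab a b)"
proof -
  have [measurable]: "Iab a b \<in> sets \<nu>" "A \<in> sets \<nu>" using assms by auto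
  have "emeasure (restricted a b \<nu>) A
      = (\<integral>\<^sup>+ t. ennreal (indicator (Iab a b) t) * indicator A t \<partial>\<nu>)"
    by (subst emeasure_density) auto
  also have "\<dots> = (\<integral>\<^sup>+ t. indicator (A \<inter> Iab a b) t \<partial>\<nu>)"
    by (intro nn_integral_cong) (simp split: split_indicator)
  finally have "emeasure (restricted a b \<nu>) A
      = (\<integral>\<^sup>+ t. indicator (A \<inter> Iab a b) t \<partial>\<nu>)" .
  then show ?thesis by simp
qed

text \<open>The sum of the restricted measures dominates each of them and stays finite on compact
  subintervals of (a,b), so the Radon-Nikodym theorem applies.\<close>

lemma common_dominating_measure:
  fixes \<nu> :: "'i \<Rightarrow> real measure"
  assumes ab: "a < b" and K: "finite K" and \<nu>: "\<And>i. i \<in> K \<Longrightarrow> locfin a b (\<nu> i)"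
  obtains M d where "loc_finite_interval M (Iab a b)" "\<And>i. i \<in> K \<Longrightarrow> density_on a b M (\<nu> i) (d i)"
proof -
  let ?I = "Iab a b"
  define \<nu>' where "\<nu>' i = restricted a b (\<nu> i)" for i
  define M where "M = sum_measure K \<nu>'"
  have sets: "sets (\<nu> i) = sets borel" if "i \<in> K" for i using \<nu>[OF that] by (simp add: locfin_def)
  have sets': "sets (\<nu>' i) = sets borel" if "i \<in> K" for i using sets[OF that] by (simp add: \<nu>'_def)
  have em: "emeasure (\<nu>' i) A = emeasure (\<nu> i) (A \<inter> ?I)" if "i \<in> K" "A \<in> sets borel" for i A
    unfolding \<nu>'_def by (rule emeasure_density_indicator[OF sets[OF that(1)] that(2)])
  have emM: "emeasure M A = (\<Sum>i\<in>K. emeasure (\<nu>' i) A)" if "A \<in> sets borel" for A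
    unfolding M_def using K sets' that by (rule emeasure_sum_measure)
  have fin: "emeasure (\<nu>' i) {x..y} < \<infinity>" if "i \<in> K" "x \<in> ?I" "y \<in> ?I" for i x y
  proof -
    have sub: "{x..y} \<subseteq> ?I" by (rule Icc_subset_Iab[OF that(2,3)])
    then have "emeasure (\<nu>' i) {x..y} = emeasure (\<nu> i) {x..y}"
      using em[OF that(1), of "{x..y}"] by (simp add: Int_absorb2)
    then show ?thesis using \<nu>[OF that(1)] sub unfolding locfin_def by auto
  qed
  have null: "emeasure (\<nu>' i) (- ?I) = 0" if "i \<in> K" for i
    using em[OF that, of "- ?I"] by simp
  have finM: "emeasure M {x..y} < \<infinity>" if "x \<in> ?I" "y \<in> ?I" for x y
    using emM[of "{x..y}"] fin that K by auto
  have nullM: "emeasure M (- ?I) = 0"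
    using emM[of "- ?I"] null by simp
  have setsM: "sets M = sets borel" by (simp add: M_def)
  have sfM: "sigma_finite_measure M"
    by (rule sigma_finite_Iab[OF ab setsM nullM finM])
  interpret sigma_finite_measure M by (rule sfM)
  have "\<exists>d. density_on a b M (\<nu> i) d" if i: "i \<in> K" for i
  proof -
    have ac: "absolutely_continuous M (\<nu>' i)"
      unfolding absolutely_continuous_def
    proof
      fix A assume A: "A \<in> null_sets M"
      then have "A \<in> sets borel" "emeasure M A = 0" using setsM by (auto simp: null_sets_def)
      then have "emeasure (\<nu>' i) A = 0" using emM[of A] i K by auto
      then show "A \<in> null_sets (\<nu>' i)" using \<open>A \<in> sets borel\<close> sets'[OF i] by (auto simp: null_sets_def)
    qed
    have seq: "sets (\<nu>' i) = sets M" using sets'[OF i] setsM by simp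
    have sf: "sigma_finite_measure (\<nu>' i)"
      by (rule sigma_finite_Iab[OF ab sets'[OF i] null[OF i] fin[OF i]])
    \<comment> \<open>The Radon-Nikodym derivative takes extended values. It is finite almost
      everywhere because \<open>\<nu>' i\<close> is sigma-finite, so passing to real values changes
      it on a null set only.\<close>
    define d where "d x = enn2real (RN_deriv M (\<nu>' i) x)" for x
    have [measurable]: "RN_deriv M (\<nu>' i) \<in> borel_measurable M" by simp
    have d: "d \<in> borel_measurable M" unfolding d_def[abs_def] by measurable
    have "density M (\<lambda>t. ennreal (d t)) = density M (RN_deriv M (\<nu>' i))"
    proof (rule density_cong)
      show "AE x in M. ennreal (d x) = RN_deriv M (\<nu>' i) x"
        using RN_deriv_finite[OF sf ac seq] by eventually_elim (auto simp: d_def less_top)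
    qed (use d in auto)
    also have "\<dots> = \<nu>' i" by (rule density_RN_deriv[OF ac seq])
    finally have "density_on a b M (\<nu> i) d"
      using d unfolding density_on_def \<nu>'_def by (simp add: d_def measurable_cong_sets[OF setsM refl])
    then show ?thesis by blast
  qed
  then obtain d where "\<And>i. i \<in> K \<Longrightarrow> density_on a b M (\<nu> i) (d i)" by metis
  moreover have "loc_finite_interval M ?I"
    by (rule loc_finite_interval.intro[OF setsM sfM is_interval_Iab finM])
  ultimately show thesis using that by blast
qed

context
  fixes a b :: ereal and M \<nu> :: "real measure" and d :: "real \<Rightarrow> real"
  assumes d: "density_on a b M \<nu> d" and sets: "sets \<nu> = sets borel" "sets M = sets borel"
begin

lemma density_on_AE:
  shows "(AE x in \<nu>. x \<in> Iab a b \<longrightarrow> P x) \<longleftrightarrow> (AE x in M. 0 < d x \<longrightarrow> P x)"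
proof -
  have [measurable]: "Iab a b \<in> sets \<nu>" using sets by simp
  have [measurable]: "d \<in> borel_measurable M" using d sets by (simp add: density_on_def cong: measurable_cong_sets)
  have dens: "restricted a b \<nu> = density M (\<lambda>t. ennreal (d t))"
    using d by (simp add: density_on_def)
  have "(AE x in \<nu>. x \<in> Iab a b \<longrightarrow> P x) \<longleftrightarrow> (AE x in \<nu>. 0 < ennreal (indicator (Iab a b) x) \<longrightarrow> P x)"
    by (intro AE_cong) (auto simp: indicator_def)
  also have "\<dots> \<longleftrightarrow> (AE x in restricted a b \<nu>. P x)"
    by (subst AE_density) auto
  also have "\<dots> \<longleftrightarrow> (AE x in density M (\<lambda>t. ennreal (d t)). P x)"
    unfolding dens ..
  also have "\<dots> \<longleftrightarrow> (AE x in M. 0 < ennreal (d x) \<longrightarrow> P x)"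
    by (subst AE_density) auto
  finally show ?thesis by simp
qed

lemma density_on_integral:
  fixes h :: "real \<Rightarrow> 'a::{banach, second_countable_topology}"
  assumes A: "A \<subseteq> Iab a b" and h: "(\<lambda>t. indicator A t *\<^sub>R h t) \<in> borel_measurable borel"
  shows "set_integrable \<nu> A h \<longleftrightarrow> set_integrable M A (\<lambda>t. d t *\<^sub>R h t)"
    and "(LINT t:A|\<nu>. h t) = (LINT t:A|M. d t *\<^sub>R h t)"
proof -
  let ?h = "\<lambda>t. indicator A t *\<^sub>R h t"
  have [measurable]: "Iab a b \<in> sets \<nu>" using sets by simp
  have m: "?h \<in> borel_measurable \<nu>" "?h \<in> borel_measurable M" "d \<in> borel_measurable M"
    using h d sets by (simp_all add: density_on_def cong: measurable_cong_sets)
  have eq: "(\<lambda>t. indicator (Iab a b) t *\<^sub>R ?h t) = ?h"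
  proof
    fix t show "indicator (Iab a b) t *\<^sub>R ?h t = ?h t"
      using A by (cases "t \<in> A") auto
  qed
  have eq': "(\<lambda>t. d t *\<^sub>R ?h t) = (\<lambda>t. indicator A t *\<^sub>R (d t *\<^sub>R h t))"
    by (auto simp: indicator_def)
  have dens: "restricted a b \<nu> = density M (\<lambda>t. ennreal (d t))"
    and nn: "0 \<le> d t" for t using d by (auto simp: density_on_def)
  have "integrable \<nu> ?h \<longleftrightarrow> integrable (restricted a b \<nu>) ?h"
    by (subst integrable_density) (use m in \<open>auto simp only: eq AE_I2 indicator_pos_le borel_measurable_indicator \<open>Iab a b \<in> sets \<nu>\<close>\<close>)
  also have "\<dots> \<longleftrightarrow> integrable M (\<lambda>t. d t *\<^sub>R ?h t)"
    unfolding dens by (subst integrable_density) (use m nn in auto)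
  finally show "set_integrable \<nu> A h \<longleftrightarrow> set_integrable M A (\<lambda>t. d t *\<^sub>R h t)"
    unfolding set_integrable_def eq' .
  have "integral\<^sup>L \<nu> ?h = integral\<^sup>L (restricted a b \<nu>) ?h"
    by (subst integral_density) (use m in \<open>auto simp only: eq AE_I2 indicator_pos_le borel_measurable_indicator \<open>Iab a b \<in> sets \<nu>\<close>\<close>)
  also have "\<dots> = integral\<^sup>L M (\<lambda>t. d t *\<^sub>R ?h t)"
    unfolding dens by (subst integral_density) (use m nn in auto)
  finally show "(LINT t:A|\<nu>. h t) = (LINT t:A|M. d t *\<^sub>R h t)"
    unfolding set_lebesgue_integral_def eq' .
qed

lemma density_on_measure_point:
  assumes x: "x \<in> Iab a b" and fin: "emeasure M {x} < \<infinity>" "emeasure \<nu> {x} < \<infinity>"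
  shows "measure \<nu> {x} = d x * measure M {x}"
proof -
  have "(LINT t:{x}|\<nu>. (1::real)) = (LINT t:{x}|M. d t *\<^sub>R (1::real))"
    by (rule density_on_integral(2)) (use x in auto)
  moreover have "(LINT t:{x}|\<nu>. (1::real)) = measure \<nu> {x}"
    using fin sets unfolding set_lebesgue_integral_def by simp
  moreover have "(LINT t:{x}|M. d t *\<^sub>R (1::real)) = (LINT t|M. indicator {x} t *\<^sub>R d x)"
    unfolding set_lebesgue_integral_def by (rule Bochner_Integration.integral_cong) (auto simp: indicator_def)
  moreover have "(LINT t|M. indicator {x} t *\<^sub>R d x) = measure M {x} *\<^sub>R d x"
    using fin sets by (subst integral_scaleR_left) auto
  ultimately show ?thesis by simp
qed

lemma density_on_emeasure_zero:
  assumes A: "A \<in> sets borel" "A \<subseteq> Iab a b"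
  shows "emeasure \<nu> A = 0 \<longleftrightarrow> (AE x in M. x \<in> A \<longrightarrow> d x = 0)"
proof -
  have "emeasure \<nu> A = 0 \<longleftrightarrow> (AE x in \<nu>. x \<notin> A)"
    using AE_iff_null_sets[of A \<nu>] A sets by (simp add: null_sets_def)
  also have "\<dots> \<longleftrightarrow> (AE x in \<nu>. x \<in> Iab a b \<longrightarrow> x \<notin> A)"
    using A by (intro AE_cong) auto
  also have "\<dots> \<longleftrightarrow> (AE x in M. 0 < d x \<longrightarrow> x \<notin> A)"
    by (rule density_on_AE)
  also have "\<dots> \<longleftrightarrow> (AE x in M. x \<in> A \<longrightarrow> d x = 0)"
    using d by (intro AE_cong) (auto simp: density_on_def less_le)
  finally show ?thesis .
qed

end

text \<open>Carries the singularity of a Jordan decomposition over to densities. For almost every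
  \<open>x\<close> in (a,b), \<open>dP x - dN x = 0\<close> then forces both densities to vanish, so
  no variation is lost by cancellation.\<close>

lemma singular_densities:
  assumes d: "density_on a b M P dP" "density_on a b M N dN"
    and sets: "sets P = sets borel" "sets N = sets borel" "sets M = sets borel"
    and A: "A \<in> sets borel" "emeasure P (Iab a b - A) = 0" "emeasure N (Iab a b \<inter> A) = 0"
  shows "AE x in M. x \<in> Iab a b \<longrightarrow> dP x = 0 \<or> dN x = 0"
proof -
  have "AE x in M. x \<in> Iab a b - A \<longrightarrow> dP x = 0"
    using density_on_emeasure_zero[OF d(1) sets(1,3), of "Iab a b - A"] A by auto
  moreover have "AE x in M. x \<in> Iab a b \<inter> A \<longrightarrow> dN x = 0"
    using density_on_emeasure_zero[OF d(2) sets(2,3), of "Iab a b \<inter> A"] A by auto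
  ultimately show ?thesis by eventually_elim auto
qed

section \<open>One-sided limits and uniqueness of densities\<close>

text \<open>A Lindelof argument: the intervals can be shrunk to rational endpoints, after which only
  countably many exceptional sets occur.\<close>

lemma AE_locally:
  fixes K :: "real set"
  assumes loc: "\<And>t. t \<in> K \<Longrightarrow> \<exists>x y. x < t \<and> t < y \<and> (AE u in N. u \<in> {x<..<y} \<longrightarrow> P u)"
  shows "AE t in N. t \<in> K \<longrightarrow> P t"
proof -
  have "AE t in N. (AE u in N. u \<in> {p<..<q} \<longrightarrow> P u) \<longrightarrow> t \<in> {p<..<q} \<longrightarrow> P t" for p q :: real
    by (cases "AE u in N. u \<in> {p<..<q} \<longrightarrow> P u") auto
  then have "AE t in N. \<forall>p\<in>\<rat>. \<forall>q\<in>\<rat>. (AE u in N. u \<in> {p<..<q} \<longrightarrow> P u) \<longrightarrow> t \<in> {p<..<q} \<longrightarrow> P t"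
    unfolding AE_ball_countable[OF countable_rat] by blast
  then show ?thesis
  proof eventually_elim
    case (elim t)
    show ?case
    proof
      assume "t \<in> K"
      then obtain x y where xy: "x < t" "t < y" "AE u in N. u \<in> {x<..<y} \<longrightarrow> P u" using loc by blast
      obtain p where p: "p \<in> \<rat>" "x < p" "p < t" using Rats_dense_in_real[OF xy(1)] by blast
      obtain q where q: "q \<in> \<rat>" "t < q" "q < y" using Rats_dense_in_real[OF xy(2)] by blast
      have "AE u in N. u \<in> {p<..<q} \<longrightarrow> P u"
        using xy(3) by eventually_elim (use p q in auto)
      then show "P t" using elim p q by (meson greaterThanLessThan_iff)
    qed
  qed
qed

context loc_finite_interval
begin

lemma set_integral_tendsto:
  fixes \<phi> :: "real \<Rightarrow> 'a::{banach, second_countable_topology}"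
  assumes int: "set_integrable M C \<phi>" and A: "\<And>n. A n \<in> sets borel" "\<And>n. A n \<subseteq> C" and B: "B \<in> sets borel" "B \<subseteq> C"
    and ev: "\<And>t. eventually (\<lambda>n. t \<in> A n \<longleftrightarrow> t \<in> B) sequentially"
  shows "(\<lambda>n. LINT t:A n|M. \<phi> t) \<longlonglongrightarrow> (LINT t:B|M. \<phi> t)"
  unfolding set_lebesgue_integral_def
proof (rule integral_dominated_convergence)
  show "integrable M (\<lambda>t. norm (indicator C t *\<^sub>R \<phi> t))"
    using int unfolding set_integrable_def by (rule integrable_norm)
  have "set_integrable M D \<phi>" if "D \<in> sets borel" "D \<subseteq> C" for D
    using int by (rule set_integrable_subset) (use that in auto)
  then show "(\<lambda>t. indicator (A n) t *\<^sub>R \<phi> t) \<in> borel_measurable M"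
    "(\<lambda>t. indicator B t *\<^sub>R \<phi> t) \<in> borel_measurable M" for n
    using A B unfolding set_integrable_def by (blast intro: borel_measurable_integrable)+
  show "AE t in M. norm (indicator (A n) t *\<^sub>R \<phi> t) \<le> norm (indicator C t *\<^sub>R \<phi> t)" for n
    using A(2)[of n] by (intro AE_I2) (auto simp: indicator_def)
  show "AE t in M. (\<lambda>n. indicator (A n) t *\<^sub>R \<phi> t) \<longlonglongrightarrow> indicator B t *\<^sub>R \<phi> t"
  proof (rule AE_I2)
    fix t
    from ev[of t] have "eventually (\<lambda>n. indicator (A n) t *\<^sub>R \<phi> t = indicator B t *\<^sub>R \<phi> t) sequentially"
      by eventually_elim (simp add: indicator_def)
    then show "(\<lambda>n. indicator (A n) t *\<^sub>R \<phi> t) \<longlonglongrightarrow> indicator B t *\<^sub>R \<phi> t"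
      by (rule tendsto_eventually)
  qed
qed

lemma primitive_on_left_limit:
  fixes f :: "real \<Rightarrow> 'a::{banach, second_countable_topology}"
  assumes f: "primitive_on M J f \<phi>" and xy: "x \<in> J" "y \<in> J" "x < y"
  shows "(f \<longlongrightarrow> f y) (at_left y)"
proof (rule tendsto_at_left_sequentially[OF xy(3)])
  fix S :: "nat \<Rightarrow> real"
  assume S: "\<And>n. S n < y" "\<And>n. x < S n" "incseq S" "S \<longlonglongrightarrow> y"
  have S': "S n \<in> J" "S n \<le> y" for n
    using mem_J[OF xy(1,2), of "S n"] S(1,2)[of n] by auto
  have "(\<lambda>n. LINT t:{S n..<y}|M. \<phi> t) \<longlonglongrightarrow> (LINT t:{}|M. \<phi> t)"
  proof (rule set_integral_tendsto[OF primitive_onD(1)[OF f xy(1,2) less_imp_le[OF xy(3)]]])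
    show "{S n..<y} \<subseteq> {x..<y}" for n using S(2)[of n] by auto
    show "eventually (\<lambda>n. t \<in> {S n..<y} \<longleftrightarrow> t \<in> {}) sequentially" for t
    proof (cases "t < y")
      case True
      show ?thesis using order_tendstoD(1)[OF S(4) True] by eventually_elim simp
    qed simp
  qed simp_all
  then have "(\<lambda>n. f y - f (S n)) \<longlonglongrightarrow> 0"
    using primitive_onD(2)[OF f S'(1) xy(2) S'(2)] by (simp add: set_lebesgue_integral_def)
  from tendsto_diff[OF tendsto_const[of "f y"] this]
  show "(\<lambda>n. f (S n)) \<longlonglongrightarrow> f y" by simp
qed

text \<open>Integration over half-open intervals places the contribution of an atom at
  \<open>x\<close> immediately to the right of \<open>x\<close>; from the left, primitives are
  continuous.\<close>

lemma primitive_on_right_limit: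
  fixes f :: "real \<Rightarrow> 'a::{banach, second_countable_topology}"
  assumes f: "primitive_on M J f \<phi>" and xy: "x \<in> J" "y \<in> J" "x < y"
  shows "(f \<longlongrightarrow> f x + measure M {x} *\<^sub>R \<phi> x) (at_right x)"
proof (rule tendsto_at_right_sequentially[OF xy(3)])
  fix S :: "nat \<Rightarrow> real"
  assume S: "\<And>n. x < S n" "\<And>n. S n < y" "decseq S" "S \<longlonglongrightarrow> x"
  have S': "S n \<in> J" "x \<le> S n" for n
    using mem_J[OF xy(1,2), of "S n"] S(1,2)[of n] by auto
  have lim: "(\<lambda>n. LINT t:{x..<S n}|M. \<phi> t) \<longlonglongrightarrow> (LINT t:{x}|M. \<phi> t)"
  proof (rule set_integral_tendsto[OF primitive_onD(1)[OF f xy(1,2) less_imp_le[OF xy(3)]]])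
    show "{x..<S n} \<subseteq> {x..<y}" for n using S(2)[of n] by auto
    show "eventually (\<lambda>n. t \<in> {x..<S n} \<longleftrightarrow> t \<in> {x}) sequentially" for t
    proof (cases "x < t")
      case True
      show ?thesis using order_tendstoD(2)[OF S(4) True] by eventually_elim (use True in simp)
    next
      case False
      then show ?thesis using S(1) by (cases "t = x") auto
    qed
  qed (use xy in simp_all)
  have eq: "indicator {x} t *\<^sub>R \<phi> t = indicator {x} t *\<^sub>R \<phi> x" for t by (auto simp: indicator_def)
  have "(LINT t:{x}|M. \<phi> t) = measure M {x} *\<^sub>R \<phi> x"
    using finite_point[OF xy(1)] unfolding set_lebesgue_integral_def eq by simp
  with lim have "(\<lambda>n. f (S n) - f x) \<longlonglongrightarrow> measure M {x} *\<^sub>R \<phi> x"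
    using primitive_onD(2)[OF f xy(1) S'] by simp
  from tendsto_add[OF tendsto_const[of "f x"] this]
  show "(\<lambda>n. f (S n)) \<longlonglongrightarrow> f x + measure M {x} *\<^sub>R \<phi> x" by simp
qed

text \<open>The sets over which the cut-off density integrates to 0 form a Dynkin system containing
  all left rays, an intersection-stable generator of the Borel sets. A density whose integral over
  every measurable set vanishes is zero almost everywhere.\<close>

lemma integral_zero_imp_AE_zero:
  fixes \<phi> :: "real \<Rightarrow> 'a::{banach, second_countable_topology}"
  assumes int: "set_integrable M {x..<y} \<phi>"
    and zero: "\<And>t. x \<le> t \<Longrightarrow> t \<le> y \<Longrightarrow> (LINT u:{x..<t}|M. \<phi> u) = 0"
  shows "AE t in M. t \<in> {x..<y} \<longrightarrow> \<phi> t = 0"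
proof -
  define \<Phi> where "\<Phi> t = indicator {x..<y} t *\<^sub>R \<phi> t" for t
  have \<Phi>: "integrable M \<Phi>" using int by (simp add: \<Phi>_def[abs_def] set_integrable_def)
  have \<Phi>A: "set_integrable M A \<Phi>" if "A \<in> sets M" for A
    unfolding set_integrable_def using that \<Phi> by (rule integrable_mult_indicator)
  have lt: "(LINT u:{..<t}|M. \<Phi> u) = 0" for t
  proof (cases "x < t \<and> x < y")
    case True
    have "(LINT u:{..<t}|M. \<Phi> u) = (LINT u:{x..<min t y}|M. \<phi> u)"
      unfolding set_lebesgue_integral_def
      by (rule Bochner_Integration.integral_cong) (auto simp: \<Phi>_def indicator_def)
    then show ?thesis using zero[of "min t y"] True by simp
  next
    case False
    then have eq: "indicator {..<t} u *\<^sub>R \<Phi> u = 0" for u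
      by (auto simp: \<Phi>_def indicator_def)
    show ?thesis unfolding set_lebesgue_integral_def eq by simp
  qed
  \<comment> \<open>The total integral enters the Dynkin induction at complements.\<close>
  have UNIV: "(LINT u|M. \<Phi> u) = 0"
    using lt[of y] unfolding set_lebesgue_integral_def
    by (subst Bochner_Integration.integral_cong[OF refl, of _ _ "\<lambda>u. indicator {..<y} u *\<^sub>R \<Phi> u"])
       (auto simp: \<Phi>_def indicator_def)
  have "(LINT u:A|M. \<Phi> u) = 0" if "A \<in> sets M" for A
  proof -
    have "sets M = sigma_sets UNIV (range lessThan)"
      unfolding sets_M by (subst borel_Iio) simp
    then have sets: "B \<in> sets M \<longleftrightarrow> B \<in> sigma_sets UNIV (range lessThan)" for B
      by simp
    have A: "A \<in> sigma_sets UNIV (range lessThan)"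
      using that sets by blast
    have st: "Int_stable (range (lessThan :: real \<Rightarrow> real set))"
    proof (rule Int_stableI_image)
      show "\<exists>z\<in>UNIV. {..<x} \<inter> {..<y} = {..<z}" for x y :: real
        by (intro bexI[of _ "min x y"]) auto
    qed
    have sub: "range (lessThan :: real \<Rightarrow> real set) \<subseteq> Pow UNIV" by simp
    from st sub A show ?thesis
    proof (induction rule: sigma_sets_induct_disjoint)
      case (basic A)
      then show ?case using lt by auto
    next
      case (compl A)
      then have A: "A \<in> sets M" using sets by blast
      have "(LINT u:A \<union> (UNIV - A)|M. \<Phi> u) = (LINT u:A|M. \<Phi> u) + (LINT u:UNIV - A|M. \<Phi> u)"
        by (rule set_integral_Un) (use A \<Phi>A in auto)
      moreover have "(LINT u:A \<union> (UNIV - A)|M. \<Phi> u) = (LINT u|M. \<Phi> u)"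
        by (simp add: set_lebesgue_integral_def)
      ultimately show ?case using compl UNIV by simp
    next
      case (union A)
      then have A: "A i \<in> sets M" for i using sets by blast
      have "(LINT u:(\<Union>i. A i)|M. \<Phi> u) = (\<Sum>i. LINT u:A i|M. \<Phi> u)"
        by (rule lebesgue_integral_countable_add) (use A union \<Phi>A in \<open>auto simp: disjoint_family_on_def\<close>)
      then show ?case using union by simp
    qed (simp add: set_lebesgue_integral_def)
  qed
  from sigma_finite_measure.density_zero[OF sigma_finite_M \<Phi> this] have "AE t in M. \<Phi> t = 0" .
  then show ?thesis by eventually_elim (auto simp: \<Phi>_def)
qed

lemma primitive_on_zero_density:
  fixes \<phi> :: "real \<Rightarrow> 'a::{banach, second_countable_topology}"
  assumes \<phi>: "primitive_on M K f \<phi>" and K: "K \<subseteq> J" "is_interval K" "open K"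
    and f: "\<And>x. x \<in> K \<Longrightarrow> f x = C"
  shows "AE t in M. t \<in> K \<longrightarrow> \<phi> t = 0"
proof (rule AE_locally)
  fix t assume "t \<in> K"
  then obtain e where e: "e > 0" "\<And>u. dist u t < e \<Longrightarrow> u \<in> K" using K(3) unfolding open_dist by blast
  define x y where "x = t - e / 2" "y = t + e / 2"
  have xy: "x \<in> K" "y \<in> K" "x < t" "t < y" using e by (auto simp: x_y_def dist_real_def)
  then have "x \<le> y" by simp
  have "AE u in M. u \<in> {x..<y} \<longrightarrow> \<phi> u = 0"
  proof (rule integral_zero_imp_AE_zero[OF primitive_onD(1)[OF \<phi> xy(1,2) \<open>x \<le> y\<close>]])
    fix u assume u: "x \<le> u" "u \<le> y"
    then have "u \<in> K" using K(2) xy unfolding is_interval_1 by blast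
    then show "(LINT v:{x..<u}|M. \<phi> v) = 0"
      using primitive_onD(2)[OF \<phi> xy(1) _ u(1)] f xy by simp
  qed
  then have "AE u in M. u \<in> {x<..<y} \<longrightarrow> \<phi> u = 0" by eventually_elim simp
  then show "\<exists>x y. x < t \<and> t < y \<and> (AE u in M. u \<in> {x<..<y} \<longrightarrow> \<phi> u = 0)"
    using xy by blast
qed

lemma primitive_on_cong_AE:
  fixes \<phi> :: "real \<Rightarrow> 'a::{banach, second_countable_topology}"
  assumes \<phi>: "primitive_on M J f \<phi>" and eq: "AE t in M. t \<in> J \<longrightarrow> \<phi> t = \<psi> t"
    and int: "\<And>x y. x \<in> J \<Longrightarrow> y \<in> J \<Longrightarrow> x \<le> y \<Longrightarrow> set_integrable M {x..<y} \<psi>"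
  shows "primitive_on M J f \<psi>"
proof (rule primitive_onI[OF int])
  fix x y assume xy: "x \<in> J" "y \<in> J" "x \<le> y"
  have "(LINT t:{x..<y}|M. \<phi> t) = (LINT t:{x..<y}|M. \<psi> t)"
    unfolding set_lebesgue_integral_def
  proof (rule integral_cong_AE)
    show "(\<lambda>t. indicator {x..<y} t *\<^sub>R \<phi> t) \<in> borel_measurable M"
      using primitive_onD(1)[OF \<phi> xy] unfolding set_integrable_def by (rule borel_measurable_integrable)
    show "(\<lambda>t. indicator {x..<y} t *\<^sub>R \<psi> t) \<in> borel_measurable M"
      using int[OF xy] unfolding set_integrable_def by (rule borel_measurable_integrable)
    show "AE t in M. indicator {x..<y} t *\<^sub>R \<phi> t = indicator {x..<y} t *\<^sub>R \<psi> t"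
      using eq
    proof eventually_elim
      case (elim t)
      then show ?case using mem_J[OF xy(1,2), of t] by (cases "t \<in> {x..<y}") auto
    qed
  qed
  then show "f y - f x = (LINT t:{x..<y}|M. \<psi> t)" using primitive_onD(2)[OF \<phi> xy] by simp
qed

text \<open>\<open>L\<close> abstracts from \<open>pint\<close> and \<open>sint\<close>, so that the
  oriented integrals over \<rho>, \<sigma> and \<kappa> are treated alike. Each position of
  \<open>c\<close> relative to \<open>x\<close> and \<open>y\<close> reduces to additivity over
  adjacent half-open intervals.\<close>

lemma primitive_on_oint:
  assumes c: "c \<in> J"
    and L: "\<And>x y. x \<in> J \<Longrightarrow> y \<in> J \<Longrightarrow> x \<le> y \<Longrightarrow> set_integrable M {x..<y} \<phi>"
      "\<And>x y. x \<in> J \<Longrightarrow> y \<in> J \<Longrightarrow> x \<le> y \<Longrightarrow> L {x..<y} h = (LINT t:{x..<y}|M. \<phi> t)"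
  shows "primitive_on M J (\<lambda>x. oint L c x h) \<phi>"
proof (rule primitive_onI[OF L(1)])
  have un: "(LINT t:{x..<z}|M. \<phi> t) = (LINT t:{x..<y}|M. \<phi> t) + (LINT t:{y..<z}|M. \<phi> t)"
    if "x \<in> J" "y \<in> J" "z \<in> J" "x \<le> y" "y \<le> z" for x y z
  proof -
    have "{x..<z} = {x..<y} \<union> {y..<z}" using that by auto
    then show ?thesis using set_integral_Un[OF _ L(1)[OF that(1,2,4)] L(1)[OF that(2,3,5)]] by auto
  qed
  fix x y assume xy: "x \<in> J" "y \<in> J" "x \<le> y"
  have zero: "(LINT t:{x..<x}|M. \<phi> t) = 0" for x by (simp add: set_lebesgue_integral_def)
  have o1: "oint L c x h = (LINT t:{c..<x}|M. \<phi> t)" if "x \<in> J" "c \<le> x" for x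
    using L(2)[OF c that] that zero[of c] by (cases "x = c") (auto simp: oint_def)
  have o2: "oint L c x h = - (LINT t:{x..<c}|M. \<phi> t)" if "x \<in> J" "x \<le> c" for x
    using L(2)[OF that(1) c that(2)] that zero[of c] by (cases "x = c") (auto simp: oint_def)
  consider "c \<le> x" | "x \<le> c" "c \<le> y" | "y \<le> c" using xy by linarith
  then show "oint L c y h - oint L c x h = (LINT t:{x..<y}|M. \<phi> t)"
  proof cases
    case 1
    then have "c \<le> y" using xy by simp
    then show ?thesis using o1[OF xy(1) 1] o1[OF xy(2)] un[OF c xy(1,2) 1 xy(3)] by simp
  next
    case 2
    then show ?thesis using o2[OF xy(1)] o1[OF xy(2)] un[OF xy(1) c xy(2)] by simp
  next
    case 3
    then have "x \<le> c" using xy by simp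
    then show ?thesis using o2[OF xy(1)] o2[OF xy(2) 3] un[OF xy(1,2) c xy(3) 3] by simp
  qed
qed

lemma primitive_on_eq_oint:
  assumes c: "c \<in> J" and f: "primitive_on M J f \<phi>"
    and L: "\<And>x y. x \<in> J \<Longrightarrow> y \<in> J \<Longrightarrow> x \<le> y \<Longrightarrow> L {x..<y} h = (LINT t:{x..<y}|M. \<phi> t)"
    and x: "x \<in> J"
  shows "f x = f c + oint L c x h"
proof -
  have o: "primitive_on M J (\<lambda>x. oint L c x h) \<phi>"
    by (rule primitive_on_oint[where L = L and h = h, OF c primitive_onD(1)[OF f] L])
  have eq: "f y - f x = oint L c y h - oint L c x h" if "x \<in> J" "y \<in> J" "x \<le> y" for x y
    using primitive_onD(2)[OF f that] primitive_onD(2)[OF o that] by simp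
  have "oint L c c h = 0" by (simp add: oint_def)
  then show ?thesis using eq[OF c x] eq[OF x c] by (cases "c \<le> x") (auto simp: algebra_simps)
qed

end

section \<open>The Sturm--Liouville equation as a first order system\<close>

lemma compact_subset_Iab:
  assumes K: "compact K" "K \<subseteq> Iab a b" and c: "c \<in> Iab a b"
  obtains x y where "x \<in> Iab a b" "y \<in> Iab a b" "x \<le> y" "K \<subseteq> {x..<y}"
proof (cases "K = {}")
  case True
  then show ?thesis using that[of c c] c by simp
next
  case False
  obtain x where x: "x \<in> K" "\<And>t. t \<in> K \<Longrightarrow> x \<le> t" using compact_attains_inf[OF K(1) False] by blast
  obtain y where y: "y \<in> K" "\<And>t. t \<in> K \<Longrightarrow> t \<le> y" using compact_attains_sup[OF K(1) False] by blast
  have "y \<in> Iab a b" using y K by blast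
  \<comment> \<open>The right end must lie beyond the maximum of \<open>K\<close>, since the
    enclosing interval excludes it.\<close>
  then obtain z where "z \<in> Iab a b" "y < z" by (rule Iab_neighbours)
  then show ?thesis
    using that[of x z] x y(2) y(2)[OF x(1)] K by (force simp: subset_iff)
qed

text \<open>A dominating measure and the five densities are fixed together with the hypotheses, so
  that all later statements refer to the same \<open>M\<close>. The mutual singularity of the two
  parts of \<sigma> is recorded in \<open>singular_\<sigma>\<close>.\<close>

locale Sturm_Liouville =
  fixes a b :: ereal and \<rho> :: "real measure" and \<sigma> \<kappa> :: smeasure and c :: real
    and M :: "real measure" and d\<rho> d\<sigma>p d\<sigma>n d\<kappa>p d\<kappa>n :: "real \<Rightarrow> real"
  assumes a_less_b: "a < b" and c: "c \<in> Iab a b"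
    and locfin: "locfin a b \<rho>" "locfin a b (fst \<sigma>)" "locfin a b (snd \<sigma>)" "locfin a b (fst \<kappa>)" "locfin a b (snd \<kappa>)"
    and supp_\<sigma>: "ssupp a b \<sigma> = Iab a b"
    and jumps: "\<forall>x\<in>Iab a b. smass \<sigma> x * smass \<kappa> x = 0 \<and> smass \<sigma> x * measure \<rho> {x} = 0"
    and H5: "\<forall>\<alpha> \<beta>. \<alpha> < \<beta> \<and> \<alpha> \<in> psupp a b \<rho> \<and> \<beta> \<in> psupp a b \<rho> \<and>
               {\<alpha><..<\<beta>} \<inter> psupp a b \<rho> = {} \<longrightarrow>
               (\<forall>f. in_Dtau a b \<rho> \<sigma> \<kappa> c f \<and> (f \<longlongrightarrow> 0) (at_left \<alpha>) \<and> (f \<longlongrightarrow> 0) (at_right \<beta>)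
                    \<longrightarrow> (\<forall>x\<in>{\<alpha><..<\<beta>}. f x = 0))"
    and H6: "\<exists>x\<in>psupp a b \<rho>. \<exists>y\<in>psupp a b \<rho>. x \<noteq> y"
    and M: "loc_finite_interval M (Iab a b)"
    and dens: "density_on a b M \<rho> d\<rho>" "density_on a b M (fst \<sigma>) d\<sigma>p" "density_on a b M (snd \<sigma>) d\<sigma>n"
      "density_on a b M (fst \<kappa>) d\<kappa>p" "density_on a b M (snd \<kappa>) d\<kappa>n"
    and singular_\<sigma>: "AE x in M. x \<in> Iab a b \<longrightarrow> d\<sigma>p x = 0 \<or> d\<sigma>n x = 0"
begin

abbreviation "I \<equiv> Iab a b"
definition "s t = complex_of_real (d\<sigma>p t - d\<sigma>n t)"
definition "k t = complex_of_real (d\<kappa>p t - d\<kappa>n t)"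
abbreviation "r \<equiv> \<lambda>t. complex_of_real (d\<rho> t)"

sublocale loc_finite_interval M I by (rule M)

definition weighted :: "real measure \<Rightarrow> (real \<Rightarrow> real) \<Rightarrow> bool" where
  "weighted \<nu> d \<longleftrightarrow> locfin a b \<nu> \<and> density_on a b M \<nu> d"

lemma weighted_data: "weighted \<rho> d\<rho>" "weighted (fst \<sigma>) d\<sigma>p" "weighted (snd \<sigma>) d\<sigma>n"
  "weighted (fst \<kappa>) d\<kappa>p" "weighted (snd \<kappa>) d\<kappa>n"
  using locfin dens by (auto simp: weighted_def)

lemma weightedD:
  assumes "weighted \<nu> d"
  shows "sets \<nu> = sets borel" "density_on a b M \<nu> d" "d \<in> borel_measurable borel" "0 \<le> d t"
    "compact K \<Longrightarrow> K \<subseteq> I \<Longrightarrow> emeasure \<nu> K < \<infinity>"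
  using assms by (auto simp: weighted_def locfin_def density_on_def)

lemma weighted_integrable_iff:
  fixes h :: "real \<Rightarrow> complex"
  assumes \<nu>: "weighted \<nu> d" and S: "S \<subseteq> I" and m: "(\<lambda>t. indicator S t *\<^sub>R h t) \<in> borel_measurable borel"
  shows "set_integrable \<nu> S h \<longleftrightarrow> set_integrable M S (\<lambda>t. complex_of_real (d t) * h t)"
  using density_on_integral(1)[OF weightedD(2)[OF \<nu>] weightedD(1)[OF \<nu>] sets_M S m]
  by (simp add: scaleR_conv_of_real)

lemma
  fixes h :: "real \<Rightarrow> complex"
  assumes \<nu>: "weighted \<nu> d" and S: "S \<subseteq> I" and h: "set_integrable \<nu> S h"
  shows weighted_integrable: "set_integrable M S (\<lambda>t. complex_of_real (d t) * h t)"
    and weighted_integral: "(LINT t:S|\<nu>. h t) = (LINT t:S|M. complex_of_real (d t) * h t)"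
proof -
  have "(\<lambda>t. indicator S t *\<^sub>R h t) \<in> borel_measurable \<nu>"
    using h unfolding set_integrable_def by (rule borel_measurable_integrable)
  then have m: "(\<lambda>t. indicator S t *\<^sub>R h t) \<in> borel_measurable borel"
    by (simp add: measurable_cong_sets[OF weightedD(1)[OF \<nu>] refl])
  show "set_integrable M S (\<lambda>t. complex_of_real (d t) * h t)"
    using weighted_integrable_iff[OF \<nu> S m] h by simp
  show "(LINT t:S|\<nu>. h t) = (LINT t:S|M. complex_of_real (d t) * h t)"
    using density_on_integral(2)[OF weightedD(2)[OF \<nu>] weightedD(1)[OF \<nu>] sets_M S m]
    by (simp add: scaleR_conv_of_real)
qed

lemma Ico_subset_I: "x \<in> I \<Longrightarrow> y \<in> I \<Longrightarrow> {x..<y} \<subseteq> I"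
  using Icc_subset_Iab[of x a b y] by (meson atLeastLessThan_subseteq_atLeastAtMost_iff order_refl subset_trans)

lemma ploc_int_integrable:
  fixes h :: "real \<Rightarrow> complex"
  assumes \<nu>: "weighted \<nu> d" and h: "ploc_int a b \<nu> h" and xy: "x \<in> I" "y \<in> I"
  shows "set_integrable \<nu> {x..<y} h"
proof (rule set_integrable_subset)
  show "set_integrable \<nu> {x..y} h"
    using h Icc_subset_Iab[OF xy] unfolding ploc_int_def by blast
qed (use weightedD(1)[OF \<nu>] in auto)

lemma ploc_intI:
  fixes h :: "real \<Rightarrow> complex"
  assumes \<nu>: "weighted \<nu> d" and h: "\<And>x y. x \<in> I \<Longrightarrow> y \<in> I \<Longrightarrow> x \<le> y \<Longrightarrow> set_integrable \<nu> {x..<y} h"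
  shows "ploc_int a b \<nu> h"
  unfolding ploc_int_def
proof (intro allI impI, elim conjE)
  fix K :: "real set" assume K: "compact K" "K \<subseteq> I"
  obtain x y where xy: "x \<in> I" "y \<in> I" "x \<le> y" "K \<subseteq> {x..<y}"
    by (rule compact_subset_Iab[OF K c], rule that)
  have "K \<in> sets \<nu>" using K(1) weightedD(1)[OF \<nu>] by (simp add: borel_compact)
  then show "set_integrable \<nu> K h"
    using set_integrable_subset[OF h[OF xy(1-3)] _ xy(4)] by blast
qed

lemma ploc_int_const:
  assumes \<nu>: "weighted \<nu> d"
  shows "ploc_int a b \<nu> (\<lambda>_. C :: complex)"
  unfolding ploc_int_def set_integrable_def
proof (intro allI impI, elim conjE)
  fix K :: "real set" assume K: "compact K" "K \<subseteq> I"
  show "integrable \<nu> (\<lambda>t. indicator K t *\<^sub>R C)"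
    using weightedD(5)[OF \<nu> K] weightedD(1)[OF \<nu>] K(1)
    by (intro integrable_scaleR_left integrable_real_indicator) (auto simp: borel_compact)
qed

lemma int_density:
  assumes \<nu>: "weighted \<nu> d" and xy: "x \<in> I" "y \<in> I"
  shows "set_integrable M {x..<y} (\<lambda>t. complex_of_real (d t))"
  using weighted_integrable[OF \<nu> Ico_subset_I[OF xy] ploc_int_integrable[OF \<nu> ploc_int_const[OF \<nu>, of 1] xy]]
  by simp

lemma measure_point:
  assumes \<nu>: "weighted \<nu> d" and x: "x \<in> I"
  shows "measure \<nu> {x} = d x * measure M {x}"
  using density_on_measure_point[OF weightedD(2)[OF \<nu>] weightedD(1)[OF \<nu>] sets_M x finite_point[OF x]]
    weightedD(5)[OF \<nu>, of "{x}"] x by auto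

sublocale measure_system M I s k r
proof
  fix x y assume xy: "x \<in> I" "y \<in> I"
  note i = weighted_data(2-5)[THEN int_density[OF _ xy]]
  show "set_integrable M {x..<y} s"
    unfolding s_def[abs_def] of_real_diff by (rule set_integral_diff(1)[OF i(1,2)])
  show "set_integrable M {x..<y} k"
    unfolding k_def[abs_def] of_real_diff by (rule set_integral_diff(1)[OF i(3,4)])
next
  fix x assume x: "x \<in> I"
  have *: "smass \<sigma> x = (d\<sigma>p x - d\<sigma>n x) * measure M {x}" "smass \<kappa> x = (d\<kappa>p x - d\<kappa>n x) * measure M {x}"
    "measure \<rho> {x} = d\<rho> x * measure M {x}"
    unfolding smass_def using measure_point[OF _ x] weighted_data by (simp_all add: left_diff_distrib)
  \<comment> \<open>The products of point masses contain \<open>measure M {x}\<close> squared;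
    vanishing with the square and vanishing with a single factor are the same condition.\<close>
  show "s x * k x * of_real (measure M {x}) = 0" "s x * r x * of_real (measure M {x}) = 0"
    using bspec[OF jumps x] unfolding * by (auto simp: s_def k_def)
qed (simp_all add: s_def k_def)

lemma ploc_int_primitive:
  fixes f \<phi> :: "real \<Rightarrow> complex"
  assumes \<nu>: "weighted \<nu> d" and f: "primitive_on M I f \<phi>"
  shows "ploc_int a b \<nu> f"
proof (rule ploc_intI[OF \<nu>])
  fix x y assume xy: "x \<in> I" "y \<in> I" "x \<le> y"
  have "(\<lambda>t. indicator {x..<y} t *\<^sub>R f t) \<in> borel_measurable borel"
    using primitive_on_borel[OF f xy] by (simp add: measurable_cong_sets[OF sets_M refl])
  then show "set_integrable \<nu> {x..<y} f"
    using weighted_integrable_iff[OF \<nu> Ico_subset_I[OF xy(1,2)]]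
      set_integrable_mult_primitive[OF f xy int_density[OF \<nu> xy(1,2)]] by simp
qed

lemma ploc_int_weighted:
  fixes h :: "real \<Rightarrow> complex"
  assumes \<nu>: "weighted \<nu> d" and h: "ploc_int a b \<nu> h" and xy: "x \<in> I" "y \<in> I"
  shows "set_integrable M {x..<y} (\<lambda>t. complex_of_real (d t) * h t)"
    and "(LINT t:{x..<y}|\<nu>. h t) = (LINT t:{x..<y}|M. complex_of_real (d t) * h t)"
  using weighted_integrable[OF \<nu> Ico_subset_I[OF xy] ploc_int_integrable[OF \<nu> h xy]]
    weighted_integral[OF \<nu> Ico_subset_I[OF xy] ploc_int_integrable[OF \<nu> h xy]] by auto

lemma sloc_int_weighted:
  fixes h :: "real \<Rightarrow> complex"
  assumes \<mu>: "weighted (fst \<mu>) dp" "weighted (snd \<mu>) dn" and h: "sloc_int a b \<mu> h" and xy: "x \<in> I" "y \<in> I"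
  shows "set_integrable M {x..<y} (\<lambda>t. complex_of_real (dp t - dn t) * h t)"
    and "sint \<mu> {x..<y} h = (LINT t:{x..<y}|M. complex_of_real (dp t - dn t) * h t)"
proof -
  have h': "ploc_int a b (fst \<mu>) h" "ploc_int a b (snd \<mu>) h" using h by (auto simp: sloc_int_def)
  have eq: "complex_of_real (dp t - dn t) * h t = complex_of_real (dp t) * h t - complex_of_real (dn t) * h t" for t
    by (simp add: left_diff_distrib)
  note p = ploc_int_weighted[OF \<mu>(1) h'(1) xy] and n = ploc_int_weighted[OF \<mu>(2) h'(2) xy]
  show "set_integrable M {x..<y} (\<lambda>t. complex_of_real (dp t - dn t) * h t)"
    unfolding eq using p(1) n(1) by (rule set_integral_diff(1))
  show "sint \<mu> {x..<y} h = (LINT t:{x..<y}|M. complex_of_real (dp t - dn t) * h t)"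
    unfolding eq sint_def p(2) n(2) set_integral_diff(2)[OF p(1) n(1)] ..
qed

lemmas \<sigma>_integral = sloc_int_weighted[OF weighted_data(2,3), folded s_def]
lemmas \<kappa>_integral = sloc_int_weighted[OF weighted_data(4,5), folded k_def]

section \<open>Elements of the domain as solutions of the first order system\<close>

lemma pAC_primitive:
  assumes "pAC a b \<rho> c F G"
  shows "primitive_on M I F (\<lambda>t. r t * G t)"
proof -
  have G: "ploc_int a b \<rho> G" and F: "\<And>x. x \<in> I \<Longrightarrow> F x = F c + oint (pint \<rho>) c x G"
    using assms by (auto simp: pAC_def)
  have "primitive_on M I (\<lambda>x. oint (pint \<rho>) c x G) (\<lambda>t. r t * G t)"
    by (rule primitive_on_oint[OF c]) (use ploc_int_weighted[OF weighted_data(1) G] in \<open>simp_all add: pint_def\<close>)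
  from primitive_on_add[OF primitive_on_const[of M I "F c"] this]
  show ?thesis
    by (rule primitive_on_cong[OF _ interval_J]) (use F in auto)
qed

lemma sAC_primitive:
  assumes "sAC a b \<sigma> c f h"
  shows "primitive_on M I f (\<lambda>t. s t * h t)"
proof -
  have h: "sloc_int a b \<sigma> h" and f: "\<And>x. x \<in> I \<Longrightarrow> f x = f c + oint (sint \<sigma>) c x h"
    using assms by (auto simp: sAC_def)
  have "primitive_on M I (\<lambda>x. oint (sint \<sigma>) c x h) (\<lambda>t. s t * h t)"
    by (rule primitive_on_oint[OF c]) (use \<sigma>_integral[OF h] in simp_all)
  from primitive_on_add[OF primitive_on_const[of M I "f c"] this]
  show ?thesis
    by (rule primitive_on_cong[OF _ interval_J]) (use f in auto)
qed

lemma oint_\<kappa>_primitive: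
  assumes "primitive_on M I f \<phi>"
  shows "primitive_on M I (\<lambda>x. oint (sint \<kappa>) c x f) (\<lambda>t. k t * f t)"
proof -
  have "sloc_int a b \<kappa> f"
    using ploc_int_primitive[OF _ assms] weighted_data by (auto simp: sloc_int_def)
  then show ?thesis
    by (intro primitive_on_oint[OF c]) (use \<kappa>_integral in simp_all)
qed

text \<open>Solved for \<open>h\<close>, the almost-everywhere identity says that \<open>h\<close>
  equals the quasi-derivative almost everywhere for the variation of \<sigma>. In the density of
  \<open>f\<close> with respect to \<open>M\<close> the one may therefore replace the other.\<close>

lemma Dtau_data_solution:
  assumes data: "Dtau_data a b \<rho> \<sigma> \<kappa> c f h F G"
  shows "solution_on I f (\<lambda>x. oint (sint \<kappa>) c x f - F x) G" "ploc_int a b \<rho> G"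
proof -
  let ?q = "\<lambda>x. oint (sint \<kappa>) c x f - F x"
  have d: "sAC a b \<sigma> c f h" "pAC a b \<rho> c F G" "sAE a b \<sigma> (\<lambda>x. F x = - h x + oint (sint \<kappa>) c x f)"
    using data by (auto simp: Dtau_data_def)
  show "ploc_int a b \<rho> G" using d(2) by (simp add: pAC_def)
  note f = sAC_primitive[OF d(1)]
  have q: "primitive_on M I ?q (\<lambda>t. k t * f t - r t * G t)"
    by (intro primitive_on_diff oint_\<kappa>_primitive[OF f] pAC_primitive[OF d(2)])
  have "AE x in M. 0 < d\<sigma>p x \<longrightarrow> F x = - h x + oint (sint \<kappa>) c x f"
    using density_on_AE[OF dens(2) weightedD(1)[OF weighted_data(2)] sets_M] d(3) by (simp add: sAE_def)
  moreover have "AE x in M. 0 < d\<sigma>n x \<longrightarrow> F x = - h x + oint (sint \<kappa>) c x f"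
    using density_on_AE[OF dens(3) weightedD(1)[OF weighted_data(3)] sets_M] d(3) by (simp add: sAE_def)
  ultimately have "AE x in M. x \<in> I \<longrightarrow> s x * h x = s x * ?q x"
  proof eventually_elim
    case (elim x)
    have "0 \<le> d\<sigma>p x" "0 \<le> d\<sigma>n x" using weightedD(4) weighted_data by auto
    \<comment> \<open>Either one part of \<sigma> has positive density at \<open>x\<close>, and the
      identity holds there, or \<open>s x = 0\<close> and both sides vanish.\<close>
    then consider "0 < d\<sigma>p x \<or> 0 < d\<sigma>n x" | "d\<sigma>p x - d\<sigma>n x = 0" by force
    then show ?case
    proof cases
      case 1
      then have "F x = - h x + oint (sint \<kappa>) c x f" using elim by blast
      then show ?thesis by simp
    next
      case 2
      then show ?thesis by (simp add: s_def)
    qed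
  qed
  then have "primitive_on M I f (\<lambda>t. s t * ?q t)"
    by (rule primitive_on_cong_AE[OF f]) (rule set_integrable_mult_primitive[OF q _ _ _ int_s])
  then show "solution_on I f ?q G" using q by (simp add: solution_on_def)
qed

text \<open>The choice \<open>h = q\<close> turns the almost-everywhere condition into an identity,
  with \<open>F\<close> dictated by the definition of the quasi-derivative.\<close>

lemma solution_Dtau_data:
  assumes sol: "solution_on I f q G" and G: "ploc_int a b \<rho> G"
  shows "Dtau_data a b \<rho> \<sigma> \<kappa> c f q (\<lambda>x. oint (sint \<kappa>) c x f - q x) G"
proof -
  let ?F = "\<lambda>x. oint (sint \<kappa>) c x f - q x"
  have f: "primitive_on M I f (\<lambda>t. s t * q t)" and q: "primitive_on M I q (\<lambda>t. k t * f t - r t * G t)"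
    using sol by (auto simp: solution_on_def)
  have q_int: "sloc_int a b \<sigma> q"
    using ploc_int_primitive[OF _ q] weighted_data by (auto simp: sloc_int_def)
  have 1: "sAC a b \<sigma> c f q"
    unfolding sAC_def
  proof (intro conjI ballI q_int)
    fix x assume x: "x \<in> I"
    show "f x = f c + oint (sint \<sigma>) c x q"
      by (rule primitive_on_eq_oint[OF c f _ x]) (use \<sigma>_integral[OF q_int] in simp)
  qed
  have "primitive_on M I ?F (\<lambda>t. k t * f t - (k t * f t - r t * G t))"
    by (intro primitive_on_diff oint_\<kappa>_primitive[OF f] q)
  then have F: "primitive_on M I ?F (\<lambda>t. r t * G t)" by simp
  have 2: "pAC a b \<rho> c ?F G"
    unfolding pAC_def
  proof (intro conjI ballI G)
    fix x assume x: "x \<in> I"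
    show "?F x = ?F c + oint (pint \<rho>) c x G"
      by (rule primitive_on_eq_oint[OF c F _ x])
        (use ploc_int_weighted[OF weighted_data(1) G] in \<open>simp add: pint_def\<close>)
  qed
  show ?thesis
    unfolding Dtau_data_def sAE_def using 1 2 by simp
qed

lemma left_limit:
  fixes f :: "real \<Rightarrow> complex"
  assumes f: "primitive_on M I f \<phi>" and x: "x \<in> I"
  shows "(f \<longlongrightarrow> f x) (at_left x)"
  using x by (rule Iab_neighbours) (rule primitive_on_left_limit[OF f _ x])

lemma right_limit:
  fixes f :: "real \<Rightarrow> complex"
  assumes f: "primitive_on M I f \<phi>" and x: "x \<in> I"
  shows "(f \<longlongrightarrow> f x + of_real (measure M {x}) * \<phi> x) (at_right x)"
  by (rule Iab_neighbours[OF x])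
    (use primitive_on_right_limit[OF f x] in \<open>simp add: scaleR_conv_of_real\<close>)

text \<open>A vanishing difference of densities could come from cancellation;
  \<open>singular_\<sigma>\<close> excludes this, so both parts of \<sigma> would be null on the
  interval, although its midpoint lies in the support.\<close>

lemma \<sigma>_charges_intervals:
  assumes "x < y" "x \<in> I" "y \<in> I"
  shows "\<not> (AE t in M. t \<in> {x<..<y} \<longrightarrow> d\<sigma>p t - d\<sigma>n t = 0)"
proof
  assume ae: "AE t in M. t \<in> {x<..<y} \<longrightarrow> d\<sigma>p t - d\<sigma>n t = 0"
  define m e where "m = (x + y) / 2" "e = (y - x) / 2"
  have sub: "{x<..<y} \<subseteq> I" using Icc_subset_Iab[OF assms(2,3)] by force
  have "m \<in> I" using assms sub by (auto simp: m_e_def)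
  have ball: "ball m e = {x<..<y}" unfolding m_e_def by (rule greaterThanLessThan_eq_ball[symmetric])
  have both: "AE t in M. t \<in> {x<..<y} \<longrightarrow> d\<sigma>p t = 0 \<and> d\<sigma>n t = 0"
    using ae singular_\<sigma> by eventually_elim (use sub in auto)
  have "emeasure (fst \<sigma>) {x<..<y} = 0"
    using density_on_emeasure_zero[OF dens(2) weightedD(1)[OF weighted_data(2)] sets_M _ sub] both
    by (simp add: AE_conjI) (auto elim: eventually_mono)
  moreover have "emeasure (snd \<sigma>) {x<..<y} = 0"
    using density_on_emeasure_zero[OF dens(3) weightedD(1)[OF weighted_data(3)] sets_M _ sub] both
    by (simp add: AE_conjI) (auto elim: eventually_mono)
  moreover have "m \<in> ssupp a b \<sigma>" using supp_\<sigma> \<open>m \<in> I\<close> by simp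
  moreover have "e > 0" using assms by (simp add: m_e_def)
  ultimately show False
    unfolding ssupp_def using ball sub by (auto simp: Int_absorb2)
qed

text \<open>Where \<open>f\<close> vanishes on an open interval, \<open>s t * q t = 0\<close> almost
  everywhere. As \<open>q\<close> is continuous from the left, a nonzero value at \<open>t\<close>
  would keep \<open>q\<close> away from zero just before \<open>t\<close> and leave \<sigma> no mass
  there.\<close>

lemma derivative_zero:
  assumes sol: "solution_on I f q G" and xy: "x \<in> I" "y \<in> I"
    and f: "\<And>t. t \<in> {x<..<y} \<Longrightarrow> f t = 0" and t: "t \<in> {x<..<y}"
  shows "q t = 0"
proof (rule ccontr)
  assume ne: "q t \<noteq> 0"
  have sub: "{x<..<y} \<subseteq> I" using Icc_subset_Iab[OF xy] by force
  have f': "primitive_on M {x<..<y} f (\<lambda>t. s t * q t)" and q: "primitive_on M I q (\<lambda>t. k t * f t - r t * G t)"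
    using sol primitive_on_subset[OF _ sub] by (auto simp: solution_on_def)
  have ae: "AE t in M. t \<in> {x<..<y} \<longrightarrow> s t * q t = 0"
    by (rule primitive_on_zero_density[OF f' sub _ _ f]) auto
  have "eventually (\<lambda>u. q u \<noteq> 0) (at_left t)"
    using left_limit[OF q] sub t ne by (intro tendsto_imp_eventually_ne[of q "q t"]) auto
  then obtain z where z: "z < t" "\<And>u. z < u \<Longrightarrow> u < t \<Longrightarrow> q u \<noteq> 0"
    unfolding eventually_at_left_field by blast
  define w where "w = max x z"
  have "AE u in M. u \<in> {w<..<t} \<longrightarrow> d\<sigma>p u - d\<sigma>n u = 0"
    using ae
  proof eventually_elim
    case (elim u)
    show ?case
    proof
      assume u: "u \<in> {w<..<t}"
      then have "s u * q u = 0" "q u \<noteq> 0" using elim z t by (auto simp: w_def)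
      then have "s u = 0" by simp
      then show "d\<sigma>p u - d\<sigma>n u = 0" by (simp only: s_def of_real_eq_0_iff)
    qed
  qed
  moreover have "w < t" "t \<in> I" using z t sub by (auto simp: w_def)
  moreover have "w \<in> I" using mem_Iab[OF xy(1) \<open>t \<in> I\<close>, of w] \<open>w < t\<close> by (simp add: w_def)
  ultimately show False using \<sigma>_charges_intervals by blast
qed

text \<open>Applied to the difference of two solutions with the same \<open>f\<close>, this is the
  uniqueness of the quasi-derivative on (a,b) and of \<open>\<tau> f\<close> up to \<rho>-null
  sets.\<close>

lemma zero_solution:
  assumes sol: "solution_on I f q G" and f: "\<And>t. t \<in> I \<Longrightarrow> f t = 0"
  shows "t \<in> I \<Longrightarrow> q t = 0" and "AE t in \<rho>. t \<in> I \<longrightarrow> G t = 0"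
proof -
  show q: "q t = 0" if t: "t \<in> I" for t
  proof -
    obtain x y where xy: "x \<in> I" "y \<in> I" "x < t" "t < y" using t by (rule Iab_neighbours)
    then show ?thesis
      using derivative_zero[OF sol xy(1,2)] f Icc_subset_Iab[OF xy(1,2)] by (auto simp: subset_iff)
  qed
  have "primitive_on M I q (\<lambda>t. k t * f t - r t * G t)" using sol by (simp add: solution_on_def)
  from primitive_on_zero_density[OF this order_refl interval_J open_Iab q]
  have "AE t in M. t \<in> I \<longrightarrow> k t * f t - r t * G t = 0" .
  moreover have "AE t in M. 0 < d\<rho> t \<longrightarrow> t \<in> I"
    using density_on_AE[OF dens(1) weightedD(1)[OF weighted_data(1)] sets_M, of "\<lambda>t. t \<in> I"] by simp
  ultimately have "AE t in M. 0 < d\<rho> t \<longrightarrow> G t = 0"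
    by eventually_elim (use f in auto)
  then show "AE t in \<rho>. t \<in> I \<longrightarrow> G t = 0"
    using density_on_AE[OF dens(1) weightedD(1)[OF weighted_data(1)] sets_M] by simp
qed

abbreviation "qd \<equiv> quasi a b \<rho> \<sigma> \<kappa> c"
abbreviation "\<tau> \<equiv> tau a b \<rho> \<sigma> \<kappa> c"

lemma in_Dtau_solution:
  assumes "in_Dtau a b \<rho> \<sigma> \<kappa> c f"
  shows "solution_on I f (qd f) (\<tau> f)" "ploc_int a b \<rho> (\<tau> f)"
proof -
  obtain h F G where "Dtau_data a b \<rho> \<sigma> \<kappa> c f h F G" using assms by (auto simp: in_Dtau_def)
  then have "\<exists>FG. \<exists>h. Dtau_data a b \<rho> \<sigma> \<kappa> c f h (fst FG) (snd FG)" by (intro exI[of _ "(F, G)"]) auto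
  then have "\<exists>h. Dtau_data a b \<rho> \<sigma> \<kappa> c f h (fst (FG_of a b \<rho> \<sigma> \<kappa> c f)) (snd (FG_of a b \<rho> \<sigma> \<kappa> c f))"
    unfolding FG_of_def by (rule someI_ex)
  then obtain h where data: "Dtau_data a b \<rho> \<sigma> \<kappa> c f h (fst (FG_of a b \<rho> \<sigma> \<kappa> c f)) (\<tau> f)"
    unfolding tau_def by blast
  have eq: "qd f = (\<lambda>x. oint (sint \<kappa>) c x f - fst (FG_of a b \<rho> \<sigma> \<kappa> c f) x)"
    by (rule ext) (rule quasi_def)
  show "solution_on I f (qd f) (\<tau> f)" "ploc_int a b \<rho> (\<tau> f)"
    using Dtau_data_solution[OF data] by (simp_all add: eq)
qed

text \<open>Whatever pair the choice operator in \<open>FG_of\<close> picks, it agrees with the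
  given solution: the quasi-derivative pointwise on (a,b), \<open>\<tau> f\<close> almost
  everywhere.\<close>

lemma solution_unique_data:
  assumes sol: "solution_on I f q G" and G: "ploc_int a b \<rho> G"
  shows "in_Dtau a b \<rho> \<sigma> \<kappa> c f" "x \<in> I \<Longrightarrow> qd f x = q x" "AE t in \<rho>. t \<in> I \<longrightarrow> \<tau> f t = G t"
proof -
  show D: "in_Dtau a b \<rho> \<sigma> \<kappa> c f"
    using solution_Dtau_data[OF sol G] by (auto simp: in_Dtau_def)
  note d = solution_on_diff[OF in_Dtau_solution(1)[OF D] sol]
  show "x \<in> I \<Longrightarrow> qd f x = q x" using zero_solution(1)[OF d] by simp
  show "AE t in \<rho>. t \<in> I \<longrightarrow> \<tau> f t = G t" using zero_solution(2)[OF d] by simp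
qed

end

section \<open>Square-integrable functions\<close>

context Sturm_Liouville
begin

lemma sets_\<rho> [measurable_cong, simp]: "sets \<rho> = sets borel"
  by (rule weightedD(1)[OF weighted_data(1)])

abbreviation "L2\<rho> \<equiv> L2 a b \<rho>"

text \<open>The bilinear pairing without conjugation: it is symmetric and fits the bilinear Lagrange
  identity. Conjugates are written explicitly where positivity or orthogonality matters.\<close>

definition ip :: "(real \<Rightarrow> complex) \<Rightarrow> (real \<Rightarrow> complex) \<Rightarrow> complex" where
  "ip f g = (LINT t:I|\<rho>. f t * g t)"

lemma inner2_ip: "inner2 a b \<rho> f g = ip (\<lambda>t. cnj (g t)) f"
  by (simp add: inner2_def ip_def)

lemma L2D:
  assumes "L2\<rho> f"
  shows "(\<lambda>t. indicator I t *\<^sub>R f t) \<in> borel_measurable \<rho>" "integrable \<rho> (\<lambda>t. indicator I t *\<^sub>R (norm (f t))\<^sup>2)"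
  using assms by (auto simp: L2_def set_borel_measurable_def set_integrable_def)

lemma L2I:
  assumes m: "(\<lambda>t. indicator I t *\<^sub>R f t) \<in> borel_measurable \<rho>" and h: "set_integrable \<rho> I h"
    and le: "AE t in \<rho>. t \<in> I \<longrightarrow> (norm (f t))\<^sup>2 \<le> h t"
  shows "L2\<rho> f"
  unfolding L2_def
proof
  show "set_borel_measurable \<rho> I f" using m by (simp add: set_borel_measurable_def)
  have [measurable]: "(\<lambda>t. indicator I t *\<^sub>R f t) \<in> borel_measurable \<rho>" by (rule m)
  have eq: "(\<lambda>t. indicator I t *\<^sub>R (norm (f t))\<^sup>2) = (\<lambda>t. (norm (indicator I t *\<^sub>R f t))\<^sup>2)"
    by (auto simp: indicator_def)
  show "set_integrable \<rho> I (\<lambda>t. (norm (f t))\<^sup>2)"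
    unfolding set_integrable_def
  proof (rule Bochner_Integration.integrable_bound)
    show "integrable \<rho> (\<lambda>t. indicator I t *\<^sub>R h t)" using h by (simp add: set_integrable_def)
    show "(\<lambda>t. indicator I t *\<^sub>R (norm (f t))\<^sup>2) \<in> borel_measurable \<rho>" unfolding eq by measurable
    show "AE t in \<rho>. norm (indicator I t *\<^sub>R (norm (f t))\<^sup>2) \<le> norm (indicator I t *\<^sub>R h t)"
      using le by eventually_elim (auto simp: indicator_def)
  qed
qed

lemma L2_mult_integrable:
  assumes f: "L2\<rho> f" and g: "L2\<rho> g"
  shows "set_integrable \<rho> I (\<lambda>t. f t * g t)"
  unfolding set_integrable_def
proof (rule Bochner_Integration.integrable_bound)
  show "integrable \<rho> (\<lambda>t. indicator I t *\<^sub>R (norm (f t))\<^sup>2 + indicator I t *\<^sub>R (norm (g t))\<^sup>2)"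
    by (intro Bochner_Integration.integrable_add L2D f g)
  note [measurable] = L2D(1)[OF f] L2D(1)[OF g]
  have eq: "(\<lambda>t. indicator I t *\<^sub>R (f t * g t)) = (\<lambda>t. (indicator I t *\<^sub>R f t) * (indicator I t *\<^sub>R g t))"
    by (auto simp: indicator_def)
  show "(\<lambda>t. indicator I t *\<^sub>R (f t * g t)) \<in> borel_measurable \<rho>" unfolding eq by measurable
  have *: "x * y \<le> x\<^sup>2 + y\<^sup>2" for x y :: real
  proof -
    have "0 \<le> (x - y)\<^sup>2" "0 \<le> x\<^sup>2" "0 \<le> y\<^sup>2" by simp_all
    then show ?thesis by (simp only: power2_diff mult.assoc)
  qed
  show "AE t in \<rho>. norm (indicator I t *\<^sub>R (f t * g t))
      \<le> norm (indicator I t *\<^sub>R (norm (f t))\<^sup>2 + indicator I t *\<^sub>R (norm (g t))\<^sup>2)"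
    by (rule AE_I2) (use * in \<open>auto simp: indicator_def norm_mult\<close>)
qed

lemma L2_cnj: "L2\<rho> f \<Longrightarrow> L2\<rho> (\<lambda>t. cnj (f t))"
proof -
  assume f: "L2\<rho> f"
  note [measurable] = L2D(1)[OF f]
  have eq: "(\<lambda>t. indicator I t *\<^sub>R cnj (f t)) = (\<lambda>t. cnj (indicator I t *\<^sub>R f t))" by simp
  have "(\<lambda>t. indicator I t *\<^sub>R cnj (f t)) \<in> borel_measurable \<rho>"
    unfolding eq using borel_measurable_continuous_onI[OF continuous_on_cnj[OF continuous_on_id]]
    by (rule measurable_compose[OF L2D(1)[OF f]])
  then show ?thesis
    by (rule L2I[where h = "\<lambda>t. (norm (f t))\<^sup>2"]) (use f in \<open>auto simp: L2_def\<close>)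
qed

lemma L2_cmult: "L2\<rho> f \<Longrightarrow> L2\<rho> (\<lambda>t. C * f t)"
proof -
  assume f: "L2\<rho> f"
  note [measurable] = L2D(1)[OF f]
  have eq: "(\<lambda>t. indicator I t *\<^sub>R (C * f t)) = (\<lambda>t. C * (indicator I t *\<^sub>R f t))" by simp
  have m: "(\<lambda>t. indicator I t *\<^sub>R (C * f t)) \<in> borel_measurable \<rho>"
    unfolding eq by measurable
  have "set_integrable \<rho> I (\<lambda>t. (norm C)\<^sup>2 * (norm (f t))\<^sup>2)"
    using f by (intro set_integrable_mult_right) (simp add: L2_def)
  from L2I[OF m this] show ?thesis by (simp add: norm_mult power_mult_distrib)
qed

lemma L2_add: "L2\<rho> f \<Longrightarrow> L2\<rho> g \<Longrightarrow> L2\<rho> (\<lambda>t. f t + g t)"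
proof -
  assume f: "L2\<rho> f" and g: "L2\<rho> g"
  note [measurable] = L2D(1)[OF f] L2D(1)[OF g]
  have eq: "(\<lambda>t. indicator I t *\<^sub>R (f t + g t)) = (\<lambda>t. indicator I t *\<^sub>R f t + indicator I t *\<^sub>R g t)"
    by (simp add: scaleR_add_right)
  have m: "(\<lambda>t. indicator I t *\<^sub>R (f t + g t)) \<in> borel_measurable \<rho>"
    unfolding eq by measurable
  have h: "set_integrable \<rho> I (\<lambda>t. 2 * (norm (f t))\<^sup>2 + 2 * (norm (g t))\<^sup>2)"
    using f g by (intro set_integral_add(1) set_integrable_mult_right) (simp_all add: L2_def)
  have le: "(norm (f t + g t))\<^sup>2 \<le> 2 * (norm (f t))\<^sup>2 + 2 * (norm (g t))\<^sup>2" for t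
  proof -
    have "(norm (f t + g t))\<^sup>2 \<le> (norm (f t) + norm (g t))\<^sup>2"
      by (intro power_mono norm_triangle_ineq norm_ge_zero)
    moreover have "0 \<le> (norm (f t) - norm (g t))\<^sup>2" by simp
    ultimately show ?thesis unfolding power2_sum power2_diff by linarith
  qed
  show ?thesis by (rule L2I[OF m h]) (simp add: le)
qed

lemma L2_diff: "L2\<rho> f \<Longrightarrow> L2\<rho> g \<Longrightarrow> L2\<rho> (\<lambda>t. f t - g t)"
  using L2_add[OF _ L2_cmult[of g "-1"], of f] by simp

lemma L2_cong_AE:
  assumes f: "L2\<rho> f" and m: "(\<lambda>t. indicator I t *\<^sub>R g t) \<in> borel_measurable \<rho>"
    and eq: "AE t in \<rho>. t \<in> I \<longrightarrow> f t = g t"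
  shows "L2\<rho> g"
proof (rule L2I[OF m])
  show "set_integrable \<rho> I (\<lambda>t. (norm (f t))\<^sup>2)" using f by (simp add: L2_def)
  show "AE t in \<rho>. t \<in> I \<longrightarrow> (norm (g t))\<^sup>2 \<le> (norm (f t))\<^sup>2"
    using eq by eventually_elim simp
qed

lemma L2_ploc_int:
  assumes f: "L2\<rho> f"
  shows "ploc_int a b \<rho> f"
  unfolding ploc_int_def
proof (intro allI impI, elim conjE)
  fix K :: "real set" assume K: "compact K" "K \<subseteq> I"
  have [measurable]: "K \<in> sets \<rho>" using K(1) by (simp add: borel_compact)
  note [measurable] = L2D(1)[OF f]
  have eq: "(\<lambda>t. indicator K t *\<^sub>R f t) = (\<lambda>t. indicator K t *\<^sub>R (indicator I t *\<^sub>R f t))"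
  proof
    fix t show "indicator K t *\<^sub>R f t = indicator K t *\<^sub>R (indicator I t *\<^sub>R f t)"
      using K(2) by (cases "t \<in> K") auto
  qed
  have *: "norm (z::complex) \<le> 1 + (norm z)\<^sup>2" for z
  proof -
    have "0 \<le> (norm z - 1)\<^sup>2" "0 \<le> norm z" by simp_all
    then show ?thesis unfolding power2_diff mult_1_right power_one by linarith
  qed
  show "set_integrable \<rho> K f"
    unfolding set_integrable_def
  proof (rule Bochner_Integration.integrable_bound)
    have "integrable \<rho> (\<lambda>t. indicator K t *\<^sub>R (1::complex))"
      using ploc_int_const[OF weighted_data(1), of 1] K unfolding ploc_int_def set_integrable_def by blast
    then show "integrable \<rho> (\<lambda>t. norm (indicator K t *\<^sub>R (1::complex)) + indicator I t *\<^sub>R (norm (f t))\<^sup>2)"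
      by (intro Bochner_Integration.integrable_add integrable_norm L2D f)
    show "(\<lambda>t. indicator K t *\<^sub>R f t) \<in> borel_measurable \<rho>" unfolding eq by measurable
    show "AE t in \<rho>. norm (indicator K t *\<^sub>R f t)
        \<le> norm (norm (indicator K t *\<^sub>R (1::complex)) + indicator I t *\<^sub>R (norm (f t))\<^sup>2)"
      by (rule AE_I2) (use K(2) * in \<open>auto simp: indicator_def\<close>)
  qed
qed

text \<open>Solutions may fail to be square-integrable near the ends; cutting them off between two
  points of (a,b) brings them into \<open>L2\<rho>\<close>.\<close>

definition trunc :: "real \<Rightarrow> real \<Rightarrow> (real \<Rightarrow> complex) \<Rightarrow> real \<Rightarrow> complex" where
  "trunc x y f t = (if t \<in> {x<..<y} then f t else 0)"

lemma ploc_int_borel: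
  assumes f: "ploc_int a b \<rho> f"
  shows "(\<lambda>t. indicator I t *\<^sub>R f t) \<in> borel_measurable \<rho>"
proof -
  obtain l u where lu: "I = (\<Union>i::nat. {l i..u i})" "incseq u" "decseq l" "\<And>i. l i < u i"
    "\<And>i. l i \<in> I" "\<And>i. u i \<in> I"
    by (rule Iab_exhaustion[OF a_less_b], rule that)
  have m: "(\<lambda>t. indicator {l i..u i} t *\<^sub>R f t) \<in> borel_measurable \<rho>" for i
    using f Icc_subset_Iab[OF lu(5,6)[of i]]
    unfolding ploc_int_def set_integrable_def by (blast intro: borel_measurable_integrable)
  show ?thesis
  proof (rule borel_measurable_LIMSEQ_metric[OF m])
    fix t
    show "(\<lambda>i. indicator {l i..u i} t *\<^sub>R f t) \<longlonglongrightarrow> indicator I t *\<^sub>R f t"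
    proof (cases "t \<in> I")
      case True
      then obtain i where i: "t \<in> {l i..u i}" using lu(1) by blast
      have "indicator {l n..u n} t *\<^sub>R f t = indicator I t *\<^sub>R f t" if "n \<ge> i" for n
      proof -
        have "u i \<le> u n" "l n \<le> l i" using lu(2,3) that by (auto simp: incseq_def decseq_def)
        then show ?thesis using i True by auto
      qed
      then show ?thesis by (intro tendsto_eventually eventually_sequentiallyI[of i])
    next
      case False
      then have "t \<notin> {l i..u i}" for i using lu(1) by auto
      then show ?thesis using False by simp
    qed
  qed
qed

lemma primitive_borel_I:
  fixes f \<phi> :: "real \<Rightarrow> complex"
  assumes "primitive_on M I f \<phi>"
  shows "(\<lambda>t. indicator I t *\<^sub>R f t) \<in> borel_measurable \<rho>"
  by (rule ploc_int_borel[OF ploc_int_primitive[OF weighted_data(1) assms]])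

lemma L2_trunc:
  assumes f: "L2\<rho> f"
  shows "L2\<rho> (trunc x y f)"
proof (rule L2I)
  note [measurable] = L2D(1)[OF f]
  have eq: "(\<lambda>t. indicator I t *\<^sub>R trunc x y f t) = (\<lambda>t. indicator {x<..<y} t *\<^sub>R (indicator I t *\<^sub>R f t))"
    by (auto simp: indicator_def trunc_def)
  show "(\<lambda>t. indicator I t *\<^sub>R trunc x y f t) \<in> borel_measurable \<rho>"
    unfolding eq by measurable
  show "set_integrable \<rho> I (\<lambda>t. (norm (f t))\<^sup>2)" using f by (simp add: L2_def)
  show "AE t in \<rho>. t \<in> I \<longrightarrow> (norm (trunc x y f t))\<^sup>2 \<le> (norm (f t))\<^sup>2"
    by (rule AE_I2) (simp add: trunc_def)
qed

lemma L2_trunc_primitive: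
  fixes f \<phi> :: "real \<Rightarrow> complex"
  assumes f: "primitive_on M I f \<phi>" and xy: "x \<in> I" "y \<in> I" "x \<le> y"
  shows "L2\<rho> (trunc x y f)"
proof (rule L2I)
  note [measurable] = primitive_borel_I[OF f]
  have eq: "(\<lambda>t. indicator I t *\<^sub>R trunc x y f t) = (\<lambda>t. indicator {x<..<y} t *\<^sub>R (indicator I t *\<^sub>R f t))"
    by (auto simp: indicator_def trunc_def)
  show "(\<lambda>t. indicator I t *\<^sub>R trunc x y f t) \<in> borel_measurable \<rho>"
    unfolding eq by measurable
  define B where "B = norm (f x) + (LINT t:{x..<y}|M. norm (\<phi> t))"
  have int: "integrable \<rho> (\<lambda>t. norm (indicator {x..<y} t *\<^sub>R (complex_of_real (B\<^sup>2))))"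
    using ploc_int_integrable[OF weighted_data(1) ploc_int_const[OF weighted_data(1)] xy(1,2)]
    unfolding set_integrable_def by (rule integrable_norm)
  have eq': "(\<lambda>t. norm (indicator {x..<y} t *\<^sub>R (complex_of_real (B\<^sup>2)))) = (\<lambda>t. indicator I t *\<^sub>R (indicator {x..<y} t *\<^sub>R B\<^sup>2))"
  proof
    fix t show "norm (indicator {x..<y} t *\<^sub>R (complex_of_real (B\<^sup>2))) = indicator I t *\<^sub>R (indicator {x..<y} t *\<^sub>R B\<^sup>2)"
      using Ico_subset_I[OF xy(1,2)] by (cases "t \<in> {x..<y}") (auto simp: norm_power)
  qed
  show "set_integrable \<rho> I (\<lambda>t. indicator {x..<y} t *\<^sub>R B\<^sup>2)"
    unfolding set_integrable_def eq'[symmetric] by (rule int)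
  have "(norm (trunc x y f t))\<^sup>2 \<le> indicator {x..<y} t *\<^sub>R B\<^sup>2" for t
  proof (cases "t \<in> {x<..<y}")
    case True
    then have "(norm (f t))\<^sup>2 \<le> B\<^sup>2"
      unfolding B_def by (intro power_mono primitive_on_bounded[OF f xy(1,2)]) auto
    then show ?thesis using True by (simp add: trunc_def)
  qed (auto simp: trunc_def)
  then show "AE t in \<rho>. t \<in> I \<longrightarrow> (norm (trunc x y f t))\<^sup>2 \<le> indicator {x..<y} t *\<^sub>R B\<^sup>2" by simp
qed

lemma ip_add_right: "L2\<rho> h \<Longrightarrow> L2\<rho> f \<Longrightarrow> L2\<rho> g \<Longrightarrow> ip h (\<lambda>t. f t + g t) = ip h f + ip h g"
  unfolding ip_def distrib_left by (intro set_integral_add(2) L2_mult_integrable)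

lemma ip_diff_right: "L2\<rho> h \<Longrightarrow> L2\<rho> f \<Longrightarrow> L2\<rho> g \<Longrightarrow> ip h (\<lambda>t. f t - g t) = ip h f - ip h g"
  unfolding ip_def right_diff_distrib by (intro set_integral_diff(2) L2_mult_integrable)

lemma ip_commute: "ip f g = ip g f"
  by (simp add: ip_def mult.commute)

lemma ip_cmult_right: "ip h (\<lambda>t. C * f t) = C * ip h f"
  unfolding ip_def set_integral_mult_right[symmetric] by (simp add: ac_simps)

lemma ip_cong_AE:
  assumes f: "L2\<rho> f" "L2\<rho> f'" and g: "L2\<rho> g" "L2\<rho> g'"
    and eq: "AE t in \<rho>. t \<in> I \<longrightarrow> f t = f' t" "AE t in \<rho>. t \<in> I \<longrightarrow> g t = g' t"
  shows "ip f g = ip f' g'"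
  unfolding ip_def set_lebesgue_integral_def
proof (rule integral_cong_AE)
  show "(\<lambda>t. indicator I t *\<^sub>R (f t * g t)) \<in> borel_measurable \<rho>"
    "(\<lambda>t. indicator I t *\<^sub>R (f' t * g' t)) \<in> borel_measurable \<rho>"
    using L2_mult_integrable f g unfolding set_integrable_def by (blast intro: borel_measurable_integrable)+
  show "AE t in \<rho>. indicator I t *\<^sub>R (f t * g t) = indicator I t *\<^sub>R (f' t * g' t)"
    using eq by eventually_elim (simp split: split_indicator)
qed

lemma ip_cong: "(\<And>t. t \<in> I \<Longrightarrow> f t * g t = f' t * g' t) \<Longrightarrow> ip f g = ip f' g'"
  unfolding ip_def set_lebesgue_integral_def
  by (rule Bochner_Integration.integral_cong) (simp_all split: split_indicator)

section \<open>Orthogonality and projection onto the span of two functions\<close>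

lemma ip_self_zero:
  assumes f: "L2\<rho> f" and zero: "ip (\<lambda>t. cnj (f t)) f = 0"
  shows "AE t in \<rho>. t \<in> I \<longrightarrow> f t = 0"
proof -
  have "ip (\<lambda>t. cnj (f t)) f = (LINT t|\<rho>. complex_of_real (indicator I t *\<^sub>R (norm (f t))\<^sup>2))"
    unfolding ip_def set_lebesgue_integral_def
    by (rule Bochner_Integration.integral_cong)
      (simp_all add: scaleR_conv_of_real complex_norm_square mult.commute del: of_real_power)
  also have "\<dots> = complex_of_real (LINT t|\<rho>. indicator I t *\<^sub>R (norm (f t))\<^sup>2)"
    by (rule integral_complex_of_real)
  finally have "(LINT t|\<rho>. indicator I t *\<^sub>R (norm (f t))\<^sup>2) = 0" using zero by simp
  then have "AE t in \<rho>. indicator I t *\<^sub>R (norm (f t))\<^sup>2 = 0"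
    by (subst (asm) integral_nonneg_eq_0_iff_AE[OF L2D(2)[OF f]]) auto
  then show ?thesis by eventually_elim (auto simp: indicator_def)
qed

text \<open>The coefficient of the orthogonal projection of \<open>w\<close> onto \<open>v\<close>,
  including the degenerate case: if \<open>v\<close> has norm 0, it is \<rho>-null on (a,b) and the
  coefficient 0 works.\<close>

lemma projection_one:
  assumes v: "L2\<rho> v" and w: "L2\<rho> w"
  obtains C where "ip (\<lambda>t. cnj (w t - C * v t)) v = 0"
proof (cases "ip (\<lambda>t. cnj (v t)) v = 0")
  case True
  have "ip (\<lambda>t. cnj (w t)) v = ip (\<lambda>t. cnj (w t)) (\<lambda>t. 0 * v t)"
    by (rule ip_cong_AE) (use ip_self_zero[OF v True] L2_cmult[OF v, of 0] in \<open>auto intro: L2_cnj w v\<close>)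
  also have "\<dots> = 0" unfolding ip_cmult_right by simp
  finally show thesis using that[of 0] by simp
next
  case False
  \<comment> \<open>The pairing conjugates \<open>C\<close>, so the usual quotient is conjugated
    beforehand.\<close>
  define C where "C = cnj (ip (\<lambda>t. cnj (w t)) v / ip (\<lambda>t. cnj (v t)) v)"
  have "ip (\<lambda>t. cnj (w t - C * v t)) v = ip v (\<lambda>t. cnj (w t) - cnj C * cnj (v t))"
    by (subst ip_commute) simp
  also have "\<dots> = ip v (\<lambda>t. cnj (w t)) - cnj C * ip v (\<lambda>t. cnj (v t))"
    unfolding ip_diff_right[OF v L2_cnj[OF w] L2_cmult[OF L2_cnj[OF v]]] ip_cmult_right ..
  also have "\<dots> = 0" using False by (simp add: C_def ip_commute[of v])
  finally show thesis by (rule that)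
qed

text \<open>Gram-Schmidt, with \<open>e\<close> the part of \<open>v2\<close> orthogonal to
  \<open>v1\<close>. The classes of \<open>v1\<close> and \<open>v2\<close> may be linearly
  dependent, because \<open>projection_one\<close> also handles a null function.\<close>

lemma projection_two:
  assumes v: "L2\<rho> v1" "L2\<rho> v2" and w: "L2\<rho> w"
  obtains C1 C2 where "ip (\<lambda>t. cnj (w t - (C1 * v1 t + C2 * v2 t))) v1 = 0"
    "ip (\<lambda>t. cnj (w t - (C1 * v1 t + C2 * v2 t))) v2 = 0"
proof -
  obtain D where D: "ip (\<lambda>t. cnj (v2 t - D * v1 t)) v1 = 0"
    by (rule projection_one[OF v(1,2)])
  define e where "e t = v2 t - D * v1 t" for t
  have e: "L2\<rho> e" unfolding e_def[abs_def] by (intro L2_diff L2_cmult v)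
  obtain B where B: "ip (\<lambda>t. cnj (w t - B * v1 t)) v1 = 0"
    by (rule projection_one[OF v(1) w])
  define w1 where "w1 t = w t - B * v1 t" for t
  have w1: "L2\<rho> w1" unfolding w1_def[abs_def] by (intro L2_diff L2_cmult v w)
  obtain C where C: "ip (\<lambda>t. cnj (w1 t - C * e t)) e = 0"
    by (rule projection_one[OF e w1])
  have L: "L2\<rho> (\<lambda>t. cnj (w1 t - C * e t))" by (intro L2_cnj L2_diff L2_cmult w1 e)
  have "ip (\<lambda>t. cnj (w1 t - C * e t)) v1 = ip v1 (\<lambda>t. cnj (w1 t) - cnj C * cnj (e t))"
    by (subst ip_commute) simp
  also have "\<dots> = ip v1 (\<lambda>t. cnj (w1 t)) - cnj C * ip v1 (\<lambda>t. cnj (e t))"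
    unfolding ip_diff_right[OF v(1) L2_cnj[OF w1] L2_cmult[OF L2_cnj[OF e]]] ip_cmult_right ..
  also have "\<dots> = 0"
    using B D by (simp add: ip_commute[of v1] w1_def e_def)
  finally have 1: "ip (\<lambda>t. cnj (w1 t - C * e t)) v1 = 0" .
  have "ip (\<lambda>t. cnj (w1 t - C * e t)) v2 = ip (\<lambda>t. cnj (w1 t - C * e t)) (\<lambda>t. e t + D * v1 t)"
    by (simp add: e_def)
  also have "\<dots> = 0"
    unfolding ip_add_right[OF L e L2_cmult[OF v(1)]] ip_cmult_right 1 C by simp
  finally have 2: "ip (\<lambda>t. cnj (w1 t - C * e t)) v2 = 0" .
  \<comment> \<open>Writing \<open>e\<close> in terms of \<open>v1\<close> and \<open>v2\<close>
    gives the coefficients \<open>B - C * D\<close> and \<open>C\<close>.\<close>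
  have eq: "w1 t - C * e t = w t - ((B - C * D) * v1 t + C * v2 t)" for t
    by (simp add: w1_def e_def algebra_simps)
  show thesis
    by (rule that[of "B - C * D" C]) (use 1 2 in \<open>simp_all only: eq\<close>)
qed

text \<open>The test function is the conjugate of the projection error \<open>e\<close>. It
  annihilates \<open>v1\<close> and \<open>v2\<close>, hence \<open>w\<close> by \<open>ker\<close>,
  so \<open>e\<close> is orthogonal to itself. Restricting \<open>ker\<close> to functions that
  vanish where \<open>v1\<close>, \<open>v2\<close> and \<open>w\<close> all do will give the test
  functions compact support.\<close>

lemma kernel_argument:
  assumes v: "L2\<rho> v1" "L2\<rho> v2" and w: "L2\<rho> w"
    and ker: "\<And>G. L2\<rho> G \<Longrightarrow> (\<And>t. v1 t = 0 \<Longrightarrow> v2 t = 0 \<Longrightarrow> w t = 0 \<Longrightarrow> G t = 0) \<Longrightarrow>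
        ip G v1 = 0 \<Longrightarrow> ip G v2 = 0 \<Longrightarrow> ip G w = 0"
  obtains C1 C2 where "AE t in \<rho>. t \<in> I \<longrightarrow> w t = C1 * v1 t + C2 * v2 t"
proof -
  obtain C1 C2 where C: "ip (\<lambda>t. cnj (w t - (C1 * v1 t + C2 * v2 t))) v1 = 0"
    "ip (\<lambda>t. cnj (w t - (C1 * v1 t + C2 * v2 t))) v2 = 0"
    by (rule projection_two[OF v w])
  define e where "e t = w t - (C1 * v1 t + C2 * v2 t)" for t
  have e: "L2\<rho> e" unfolding e_def[abs_def] by (intro L2_diff L2_add L2_cmult v w)
  have 0: "ip (\<lambda>t. cnj (e t)) v1 = 0" "ip (\<lambda>t. cnj (e t)) v2 = 0" using C by (simp_all add: e_def)
  have "ip (\<lambda>t. cnj (e t)) w = 0"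
    by (rule ker[OF L2_cnj[OF e] _ 0]) (simp add: e_def)
  moreover have "ip (\<lambda>t. cnj (e t)) (\<lambda>t. w t - (C1 * v1 t + C2 * v2 t))
      = ip (\<lambda>t. cnj (e t)) w - (C1 * ip (\<lambda>t. cnj (e t)) v1 + C2 * ip (\<lambda>t. cnj (e t)) v2)"
    unfolding ip_diff_right[OF L2_cnj[OF e] w L2_add[OF v[THEN L2_cmult]]]
      ip_add_right[OF L2_cnj[OF e] v[THEN L2_cmult]] ip_cmult_right ..
  moreover have "(\<lambda>t. w t - (C1 * v1 t + C2 * v2 t)) = e" by (rule ext) (simp add: e_def)
  ultimately have "ip (\<lambda>t. cnj (e t)) e = 0"
    unfolding 0 by simp
  from ip_self_zero[OF e this] show thesis
    by (intro that[of C1 C2]) (simp add: e_def)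
qed

end

section \<open>Injectivity of the map to square-integrable pairs\<close>

context Sturm_Liouville
begin

lemma null_off_support:
  assumes sub: "{x<..<y} \<subseteq> I" and off: "{x<..<y} \<inter> psupp a b \<rho> = {}"
  shows "AE t in \<rho>. t \<notin> {x<..<y}"
proof -
  have "AE t in \<rho>. t \<in> {x<..<y} \<longrightarrow> t \<notin> {x<..<y}"
  proof (rule AE_locally)
    fix t assume "t \<in> {x<..<y}"
    then have "t \<in> I" "t \<notin> psupp a b \<rho>" using sub off by auto
    then obtain e where e: "e > 0" "emeasure \<rho> (ball t e \<inter> I) = 0"
      unfolding psupp_def by (auto simp: zero_less_iff_neq_zero)
    then have "ball t e \<inter> I \<in> null_sets \<rho>" by (simp add: null_sets_def)
    from AE_not_in[OF this] have "AE u in \<rho>. u \<in> {t - e<..<t + e} \<longrightarrow> u \<notin> {x<..<y}"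
      by eventually_elim (use sub in \<open>auto simp: dist_real_def subset_iff\<close>)
    then show "\<exists>p q. p < t \<and> t < q \<and> (AE u in \<rho>. u \<in> {p<..<q} \<longrightarrow> u \<notin> {x<..<y})"
      using e(1) by (intro exI[of _ "t - e"] exI[of _ "t + e"]) simp
  qed
  then show ?thesis by eventually_elim blast
qed

lemma closed_support:
  assumes xy: "x \<in> I" "y \<in> I"
  shows "closed (psupp a b \<rho> \<inter> {x..y})"
  unfolding closed_def open_dist
proof
  fix t assume t: "t \<in> - (psupp a b \<rho> \<inter> {x..y})"
  show "\<exists>e>0. \<forall>u. dist u t < e \<longrightarrow> u \<in> - (psupp a b \<rho> \<inter> {x..y})"
  proof (cases "t \<in> {x..y}")
    case False
    have "open (- {x..y})" by (intro open_Compl closed_atLeastAtMost)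
    then obtain e where "e > 0" "\<And>u. dist u t < e \<Longrightarrow> u \<in> - {x..y}"
      using False unfolding open_dist by blast
    then show ?thesis by blast
  next
    case True
    then have "t \<in> I" "t \<notin> psupp a b \<rho>" using t Icc_subset_Iab[OF xy] by auto
    then obtain e where e: "e > 0" "emeasure \<rho> (ball t e \<inter> I) = 0"
      unfolding psupp_def by (auto simp: zero_less_iff_neq_zero)
    have "u \<notin> psupp a b \<rho>" if u: "dist u t < e" for u
    proof
      assume "u \<in> psupp a b \<rho>"
      moreover have "e - dist u t > 0" using u by simp
      ultimately have "emeasure \<rho> (ball u (e - dist u t) \<inter> I) > 0" unfolding psupp_def by blast
      moreover have "ball u (e - dist u t) \<inter> I \<subseteq> ball t e \<inter> I"
        by (auto simp: dist_real_def)
      then have "emeasure \<rho> (ball u (e - dist u t) \<inter> I) = 0"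
        using emeasure_mono[of "ball u (e - dist u t) \<inter> I" "ball t e \<inter> I" \<rho>] e(2) by simp
      ultimately show False by simp
    qed
    then show ?thesis using e(1) by blast
  qed
qed

lemma AE_false_interval:
  assumes "\<And>t. P t \<Longrightarrow> t \<notin> A" "AE t in \<rho>. P t" "A \<in> sets borel"
  shows "emeasure \<rho> A = 0"
proof -
  have "AE t in \<rho>. t \<notin> A" using assms(2) by eventually_elim (rule assms(1))
  then show ?thesis using AE_iff_null_sets[of A \<rho>] assms(3) by (simp add: null_sets_def)
qed

section \<open>Solutions that vanish almost everywhere with respect to \<rho>\<close>

context
  fixes f q G :: "real \<Rightarrow> complex" and x0 y0 :: real
  assumes sol: "solution_on I f q G" and xy0: "x0 \<in> I" "y0 \<in> I"
    and f0: "AE t in \<rho>. t \<in> {x0<..<y0} \<longrightarrow> f t = 0"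
begin

lemma f_prim: "primitive_on M I f (\<lambda>t. s t * q t)"
  using sol by (simp add: solution_on_def)

lemma sub_I: "t \<in> {x0..y0} \<Longrightarrow> t \<in> I"
  using Icc_subset_Iab[OF xy0] by blast

text \<open>Mass arbitrarily close to \<open>z\<close> on its left supplies zeros of
  \<open>f\<close> there, and \<open>f\<close> is continuous from the left.\<close>

lemma zero_from_left:
  assumes z: "z \<in> {x0<..<y0}" and mass: "\<And>w. w < z \<Longrightarrow> x0 < w \<Longrightarrow> emeasure \<rho> {w<..<z} > 0"
  shows "f z = 0"
proof (rule ccontr)
  assume ne: "f z \<noteq> 0"
  have "eventually (\<lambda>u. f u \<noteq> 0) (at_left z)"
    using left_limit[OF f_prim sub_I] z ne by (intro tendsto_imp_eventually_ne[of f "f z"]) auto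
  then obtain v where v: "v < z" "\<And>u. v < u \<Longrightarrow> u < z \<Longrightarrow> f u \<noteq> 0"
    unfolding eventually_at_left_field by blast
  define w where "w = (max v x0 + z) / 2"
  have w: "w < z" "x0 < w" "v < w" using v z by (auto simp: w_def max_def)
  have "emeasure \<rho> {w<..<z} = 0"
    by (rule AE_false_interval[OF _ f0]) (use w z v(2) in auto)
  then show False using mass[OF w(1,2)] by simp
qed

text \<open>The mirror image controls the limit instead of the value, as \<open>f\<close> may jump
  at \<open>z\<close>. This limit is what (H5) asks for at the right end of a gap.\<close>

lemma limit_zero_from_right:
  assumes z: "z \<in> {x0<..<y0}" and mass: "\<And>w. z < w \<Longrightarrow> w < y0 \<Longrightarrow> emeasure \<rho> {z<..<w} > 0"
  shows "(f \<longlongrightarrow> 0) (at_right z)"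
proof -
  define L where "L = f z + of_real (measure M {z}) * (s z * q z)"
  have lim: "(f \<longlongrightarrow> L) (at_right z)"
    unfolding L_def by (rule right_limit[OF f_prim sub_I]) (use z in auto)
  have "L = 0"
  proof (rule ccontr)
    assume ne: "L \<noteq> 0"
    have "eventually (\<lambda>u. f u \<noteq> 0) (at_right z)"
      using lim ne by (rule tendsto_imp_eventually_ne)
    then obtain v where v: "v > z" "\<And>u. z < u \<Longrightarrow> u < v \<Longrightarrow> f u \<noteq> 0"
      unfolding eventually_at_right_field by blast
    define w where "w = (min v y0 + z) / 2"
    have w: "z < w" "w < y0" "w < v" using v z by (auto simp: w_def min_def)
    have "emeasure \<rho> {z<..<w} = 0"
      by (rule AE_false_interval[OF _ f0]) (use w z v(2) in auto)
    then show False using mass[OF w(1,2)] by simp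
  qed
  then show ?thesis using lim by simp
qed

text \<open>By the hypothesis on common jumps, \<open>f\<close> is continuous at the atoms of \<open>\<rho>\<close>.\<close>
lemma zero_at_atom:
  assumes z: "z \<in> {x0<..<y0}" and atom: "emeasure \<rho> {z} > 0"
  shows "f z = 0" "(f \<longlongrightarrow> 0) (at_right z)"
proof -
  have zI: "z \<in> I" using sub_I z by auto
  show 1: "f z = 0"
  proof (rule ccontr)
    assume "f z \<noteq> 0"
    then have "emeasure \<rho> {z} = 0"
      by (intro AE_false_interval[OF _ f0]) (use z in auto)
    then show False using atom by simp
  qed
  have "measure \<rho> {z} \<noteq> 0"
    using atom weightedD(5)[OF weighted_data(1), of "{z}"] zI by (auto simp: measure_def enn2real_eq_0_iff)
  then have "smass \<sigma> z = 0" using bspec[OF jumps zI] by simp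
  moreover have "smass \<sigma> z = (d\<sigma>p z - d\<sigma>n z) * measure M {z}"
    unfolding smass_def using measure_point[OF weighted_data(2) zI] measure_point[OF weighted_data(3) zI]
    by (simp add: left_diff_distrib)
  ultimately have ms: "of_real (measure M {z}) * s z = 0" by (auto simp: s_def)
  show "(f \<longlongrightarrow> 0) (at_right z)"
    using right_limit[OF f_prim zI] unfolding 1 mult.assoc[symmetric] ms by simp
qed

text \<open>Meant for the endpoint of a gap: the gap side carries no mass, so the mass that puts
  \<open>z\<close> into the support lies on the other side.\<close>

lemma support_cases:
  assumes z: "z \<in> psupp a b \<rho>" "z \<in> {x0<..<y0}" and atom: "emeasure \<rho> {z} = 0"
    and w: "x0 < w" "w < z" and w': "z < w'" "w' < y0"
  shows "emeasure \<rho> {w<..<z} > 0 \<or> emeasure \<rho> {z<..<w'} > 0"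
proof (rule ccontr)
  assume "\<not> ?thesis"
  then have 0: "emeasure \<rho> {w<..<z} = 0" "emeasure \<rho> {z<..<w'} = 0" by auto
  define e where "e = min (z - w) (w' - z)"
  have "e > 0" using w w' by (simp add: e_def)
  then have "emeasure \<rho> (ball z e \<inter> I) > 0" using z(1) unfolding psupp_def by blast
  moreover have "ball z e \<inter> I \<subseteq> {w<..<z} \<union> {z} \<union> {z<..<w'}"
    by (auto simp: e_def dist_real_def)
  then have "emeasure \<rho> (ball z e \<inter> I) \<le> emeasure \<rho> ({w<..<z} \<union> {z} \<union> {z<..<w'})"
    by (intro emeasure_mono) auto
  moreover have "emeasure \<rho> ({w<..<z} \<union> {z} \<union> {z<..<w'}) = 0"
  proof -
    have "{w<..<z} \<in> null_sets \<rho>" "{z} \<in> null_sets \<rho>" "{z<..<w'} \<in> null_sets \<rho>"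
      using 0 atom by (simp_all add: null_sets_def)
    then have "{w<..<z} \<union> {z} \<union> {z<..<w'} \<in> null_sets \<rho>" by (intro null_sets.Un)
    then show ?thesis by (simp add: null_sets_def)
  qed
  ultimately show False by simp
qed

text \<open>Either the support fills an interval, each point of which is approached by mass from the
  left, or there is a gap and (H5) applies. In both cases \<open>f\<close> vanishes on an open
  interval, where \<open>derivative_zero\<close> makes \<open>q\<close> vanish too.\<close>

lemma vanishing_point:
  assumes D: "in_Dtau a b \<rho> \<sigma> \<kappa> c f"
    and xy1: "x1 \<in> psupp a b \<rho>" "y1 \<in> psupp a b \<rho>" "x0 < x1" "x1 < y1" "y1 < y0"
  obtains z where "z \<in> I" "f z = 0" "q z = 0"
proof -
  have mono: "emeasure \<rho> A \<le> emeasure \<rho> B" if "A \<subseteq> B" "B \<in> sets borel" for A B :: "real set"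
    using that by (intro emeasure_mono) auto
  have "\<exists>x y. x < y \<and> x \<in> {x0..y0} \<and> y \<in> {x0..y0} \<and> (\<forall>t\<in>{x<..<y}. f t = 0)"
  proof (cases "{x1<..<y1} \<subseteq> psupp a b \<rho>")
    case True
    have "f t = 0" if t: "t \<in> {x1<..<y1}" for t
    proof (rule zero_from_left)
      show "t \<in> {x0<..<y0}" using t xy1 by auto
      fix w assume w: "w < t" "x0 < w"
      \<comment> \<open>The midpoint \<open>u\<close> of the interval from \<open>max w x1\<close>
        to \<open>t\<close> lies in the support, and the ball around it is that interval, which
        therefore has positive mass.\<close>
      define u e where "u = (max w x1 + t) / 2" "e = (t - max w x1) / 2"
      have ball: "ball u e = {max w x1<..<t}"
        unfolding u_e_def by (rule greaterThanLessThan_eq_ball[symmetric])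
      have "e > 0" using w t by (auto simp: u_e_def)
      have "u \<in> {x1<..<y1}" using w t by (auto simp: u_e_def max_def)
      then have "u \<in> psupp a b \<rho>" using True by blast
      then have "emeasure \<rho> (ball u e \<inter> I) > 0" using \<open>e > 0\<close> unfolding psupp_def by blast
      moreover have "ball u e \<inter> I \<subseteq> {w<..<t}" unfolding ball by auto
      ultimately show "emeasure \<rho> {w<..<t} > 0" using mono[of "ball u e \<inter> I" "{w<..<t}"] by simp
    qed
    then show ?thesis using xy1 by (intro exI[of _ x1] exI[of _ y1]) auto
  next
    case False
    then obtain z where z: "x1 < z" "z < y1" "z \<notin> psupp a b \<rho>"
      unfolding subset_eq by (meson greaterThanLessThan_iff)
    have I1: "x1 \<in> I" "y1 \<in> I" "z \<in> I" using sub_I z xy1 by auto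
    let ?A = "psupp a b \<rho> \<inter> {x1..z}" and ?B = "psupp a b \<rho> \<inter> {z..y1}"
    \<comment> \<open>The endpoints of the gap around \<open>z\<close>. They belong to the support
      because its part in a compact subinterval is closed.\<close>
    define \<alpha> \<beta> where "\<alpha> = Sup ?A" "\<beta> = Inf ?B"
    have bA: "bdd_above ?A" and bB: "bdd_below ?B" by auto
    have "\<alpha> \<in> ?A" unfolding \<alpha>_\<beta>_def
      by (rule closed_contains_Sup[OF _ bA closed_support[OF I1(1,3)]]) (use xy1 z in auto)
    have "\<beta> \<in> ?B" unfolding \<alpha>_\<beta>_def
      by (rule closed_contains_Inf[OF _ bB closed_support[OF I1(3,2)]]) (use xy1 z in auto)
    have \<alpha>: "\<alpha> \<in> psupp a b \<rho>" "x1 \<le> \<alpha>" "\<alpha> < z" using \<open>\<alpha> \<in> ?A\<close> z(3) by (auto simp: less_le)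
    have \<beta>: "\<beta> \<in> psupp a b \<rho>" "\<beta> \<le> y1" "z < \<beta>" using \<open>\<beta> \<in> ?B\<close> z(3) by (auto simp: less_le)
    have gap: "{\<alpha><..<\<beta>} \<inter> psupp a b \<rho> = {}"
    proof (rule ccontr)
      assume "{\<alpha><..<\<beta>} \<inter> psupp a b \<rho> \<noteq> {}"
      then obtain t where t: "\<alpha> < t" "t < \<beta>" "t \<in> psupp a b \<rho>" by auto
      show False
      proof (cases "t \<le> z")
        case True
        then have "t \<in> ?A" using t \<alpha> by auto
        then have "t \<le> \<alpha>" unfolding \<alpha>_\<beta>_def using bA by (rule cSup_upper)
        then show False using t by simp
      next
        case False
        then have "t \<in> ?B" using t \<beta> by auto
        then have "\<beta> \<le> t" unfolding \<alpha>_\<beta>_def using bB by (rule cInf_lower)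
        then show False using t by simp
      qed
    qed
    have in0: "\<alpha> \<in> {x0<..<y0}" "\<beta> \<in> {x0<..<y0}" using \<alpha> \<beta> xy1 z by auto
    have "{\<alpha><..<\<beta>} \<subseteq> I" using sub_I in0 by auto
    have gap_null: "emeasure \<rho> {\<alpha><..<\<beta>} = 0"
      by (rule AE_false_interval[OF _ null_off_support[OF \<open>{\<alpha><..<\<beta>} \<subseteq> I\<close> gap]]) auto
    have null: "emeasure \<rho> A = 0" if "A \<subseteq> {\<alpha><..<\<beta>}" for A
      using mono[OF that] gap_null by simp
    \<comment> \<open>By continuity from the left the limit is \<open>f \<alpha>\<close>. This is 0
      if \<alpha> is an atom; otherwise mass accumulates to the left of \<alpha>, the gap being
      null.\<close>
    have left: "(f \<longlongrightarrow> 0) (at_left \<alpha>)"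
    proof -
      have "f \<alpha> = 0"
      proof (cases "emeasure \<rho> {\<alpha>} = 0")
        case False
        then show ?thesis using zero_at_atom(1)[OF in0(1)] by (simp add: zero_less_iff_neq_zero)
      next
        case True
        show ?thesis
        proof (rule zero_from_left[OF in0(1)])
          fix w assume w: "w < \<alpha>" "x0 < w"
          have "z < y0" using z xy1 by simp
          have "emeasure \<rho> {\<alpha><..<z} = 0" by (rule null) (use \<beta>(3) in auto)
          then show "emeasure \<rho> {w<..<\<alpha>} > 0"
            using support_cases[OF \<alpha>(1) in0(1) True w(2,1) \<alpha>(3) \<open>z < y0\<close>] by simp
        qed
      qed
      then show ?thesis using left_limit[OF f_prim, of \<alpha>] sub_I[of \<alpha>] in0 by auto
    qed
    have right: "(f \<longlongrightarrow> 0) (at_right \<beta>)"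
    proof (cases "emeasure \<rho> {\<beta>} = 0")
      case False
      then show ?thesis using zero_at_atom(2)[OF in0(2)] by (simp add: zero_less_iff_neq_zero)
    next
      case True
      show ?thesis
      proof (rule limit_zero_from_right[OF in0(2)])
        fix w assume w: "\<beta> < w" "w < y0"
        have "x0 < z" using z xy1 by simp
        have "emeasure \<rho> {z<..<\<beta>} = 0" by (rule null) (use \<alpha>(3) in auto)
        then show "emeasure \<rho> {\<beta><..<w} > 0"
          using support_cases[OF \<beta>(1) in0(2) True \<open>x0 < z\<close> \<beta>(3) w] by simp
      qed
    qed
    have "\<alpha> < \<beta>" using \<alpha> \<beta> by simp
    then have "\<forall>t\<in>{\<alpha><..<\<beta>}. f t = 0" using H5 \<alpha>(1) \<beta>(1) gap D left right by blast
    then show ?thesis using \<open>\<alpha> < \<beta>\<close> in0 by (intro exI[of _ \<alpha>] exI[of _ \<beta>]) auto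
  qed
  then obtain x y where xy: "x < y" "x \<in> {x0..y0}" "y \<in> {x0..y0}" "\<And>t. t \<in> {x<..<y} \<Longrightarrow> f t = 0" by blast
  define m where "m = (x + y) / 2"
  have m: "m \<in> {x<..<y}" using xy(1) by (simp add: m_def)
  have "q m = 0" by (rule derivative_zero[OF sol sub_I[OF xy(2)] sub_I[OF xy(3)] xy(4) m])
  then show thesis using that[of m] sub_I[of m] xy m by auto
qed

end

text \<open>The outer points leave room around the two support points, so that one-sided arguments
  also work at a gap endpoint equal to \<open>x1\<close> or \<open>y1\<close>.\<close>

lemma support_interior_interval:
  obtains x0 x1 y1 y0 where "x0 \<in> I" "y0 \<in> I" "x1 \<in> psupp a b \<rho>" "y1 \<in> psupp a b \<rho>"
    "x0 < x1" "x1 < y1" "y1 < y0"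
proof -
  obtain x1 y1 where 1: "x1 \<in> psupp a b \<rho>" "y1 \<in> psupp a b \<rho>" "x1 < y1"
    using H6 by (metis linorder_neqE)
  then have I1: "x1 \<in> I" "y1 \<in> I" by (auto simp: psupp_def)
  obtain x0 where "x0 \<in> I" "x0 < x1" using I1(1) by (rule Iab_neighbours)
  moreover obtain y0 where "y0 \<in> I" "y1 < y0" using I1(2) by (rule Iab_neighbours)
  ultimately show thesis using that 1 by blast
qed

text \<open>\<open>vanishing_point\<close> provides a point where both components are zero. As
  \<open>G\<close> is \<rho>-null, the equation becomes homogeneous, and uniqueness spreads the zero
  over (a,b).\<close>

lemma solution_ae_zero:
  assumes sol: "solution_on I f q G" and G: "ploc_int a b \<rho> G"
    and 0: "AE t in \<rho>. t \<in> I \<longrightarrow> f t = 0" "AE t in \<rho>. t \<in> I \<longrightarrow> G t = 0" and x: "x \<in> I"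
  shows "f x = 0"
proof -
  obtain x0 x1 y1 y0 where xy: "x0 \<in> I" "y0 \<in> I" "x1 \<in> psupp a b \<rho>" "y1 \<in> psupp a b \<rho>"
    "x0 < x1" "x1 < y1" "y1 < y0"
    by (rule support_interior_interval)
  have "AE t in \<rho>. t \<in> {x0<..<y0} \<longrightarrow> f t = 0"
    using 0(1) by eventually_elim (use Icc_subset_Iab[OF xy(1,2)] in \<open>auto simp: subset_iff\<close>)
  from vanishing_point[OF sol xy(1,2) this solution_unique_data(1)[OF sol G] xy(3-7)]
  obtain z where z: "z \<in> I" "f z = 0" "q z = 0" by blast
  have "AE t in M. 0 < d\<rho> t \<longrightarrow> G t = 0"
    using 0(2) density_on_AE[OF dens(1) sets_\<rho> sets_M] by simp
  then have ae: "AE t in M. t \<in> I \<longrightarrow> k t * f t - r t * G t = k t * f t - r t * 0"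
    by eventually_elim (use weightedD(4)[OF weighted_data(1)] in \<open>auto simp: less_le\<close>)
  have f: "primitive_on M I f (\<lambda>t. s t * q t)" and q: "primitive_on M I q (\<lambda>t. k t * f t - r t * G t)"
    using sol by (auto simp: solution_on_def)
  have "primitive_on M I q (\<lambda>t. k t * f t - r t * 0)"
  proof (rule primitive_on_cong_AE[OF q ae])
    fix x y assume xy: "x \<in> I" "y \<in> I" "x \<le> y"
    show "set_integrable M {x..<y} (\<lambda>t. k t * f t - r t * 0)"
      using set_integrable_mult_primitive[OF f xy int_k[OF xy(1,2)]] by simp
  qed
  then have "solution_on I f q (\<lambda>_. 0)" using f by (simp add: solution_on_def)
  from solution_on_unique_zero[OF this order_refl interval_J z x] show ?thesis by simp
qed

end

section \<open>The adjoint and the boundary form\<close>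

context Sturm_Liouville
begin

section \<open>Compactly supported solutions and representatives of adjoint elements\<close>

lemma \<rho>_integral_Ico:
  fixes h :: "real \<Rightarrow> complex"
  assumes \<alpha>\<beta>: "\<alpha> \<in> I" "\<beta> \<in> I" and h: "set_integrable \<rho> I h" "\<And>t. t \<in> I \<Longrightarrow> t \<notin> {\<alpha>..<\<beta>} \<Longrightarrow> h t = 0"
  shows "(LINT t:{\<alpha>..<\<beta>}|M. r t * h t) = (LINT t:I|\<rho>. h t)"
proof -
  have sub: "{\<alpha>..<\<beta>} \<subseteq> I" by (rule Ico_subset_I[OF \<alpha>\<beta>])
  have "set_integrable \<rho> {\<alpha>..<\<beta>} h" using h(1) by (rule set_integrable_subset) (use sub in auto)
  from weighted_integral[OF weighted_data(1) sub this]
  have "(LINT t:{\<alpha>..<\<beta>}|M. r t * h t) = (LINT t:{\<alpha>..<\<beta>}|\<rho>. h t)" by simp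
  also have "\<dots> = (LINT t:I|\<rho>. h t)"
    unfolding set_lebesgue_integral_def
  proof (rule Bochner_Integration.integral_cong[OF refl])
    fix t show "indicator {\<alpha>..<\<beta>} t *\<^sub>R h t = indicator I t *\<^sub>R h t"
      using h(2)[of t] sub by (cases "t \<in> {\<alpha>..<\<beta>}"; cases "t \<in> I") auto
  qed
  finally show ?thesis .
qed

lemma solution_restrict_zero:
  assumes sol: "solution_on I g q G" and xy: "x \<in> I" "y \<in> I" and G: "\<And>t. t \<in> {x..y} \<Longrightarrow> G t = 0"
    and z: "z \<in> {x..y}" "g z = 0" "q z = 0" and t: "t \<in> {x..y}"
  shows "g t = 0 \<and> q t = 0"
proof -
  have sub: "{x..y} \<subseteq> I" by (rule Icc_subset_Iab[OF xy])
  have "solution_on {x..y} g q (\<lambda>_. 0)"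
    by (rule solution_on_cong[OF solution_on_subset[OF sol sub] is_interval_cc]) (use G in auto)
  from solution_on_unique_zero[OF this sub is_interval_cc z t] show ?thesis .
qed

text \<open>The solution starts with zero data at \<alpha>. By the Lagrange identity, orthogonality
  to \<open>u1\<close> and \<open>u2\<close> makes both Wronskians vanish at \<beta>, so the data
  are zero there as well; outside the interval \<open>G\<close> vanishes and uniqueness continues
  the zero.\<close>

lemma compactly_supported_solution:
  assumes \<alpha>\<beta>: "\<alpha> \<in> I" "\<beta> \<in> I" "\<alpha> < \<beta>" and G: "L2\<rho> G" "\<And>t. t \<notin> {\<alpha><..<\<beta>} \<Longrightarrow> G t = 0"
    and u: "solution_on I u1 p1 (\<lambda>_. 0)" "solution_on I u2 p2 (\<lambda>_. 0)"
    and W: "u1 \<beta> * p2 \<beta> - p1 \<beta> * u2 \<beta> = 1"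
    and orth: "ip G u1 = 0" "ip G u2 = 0"
  obtains g q where "solution_on I g q G" "\<And>t. t \<in> I \<Longrightarrow> t \<notin> {\<alpha><..<\<beta>} \<Longrightarrow> g t = 0 \<and> q t = 0"
proof -
  have Gint: "set_integrable M {x..<y} (\<lambda>t. r t * G t)" if "x \<in> I" "y \<in> I" for x y
    by (rule ploc_int_weighted(1)[OF weighted_data(1) L2_ploc_int[OF G(1)] that])
  obtain g q where g: "solution_on I g q G" "g \<alpha> = 0" "q \<alpha> = 0"
    using global_existence[where A = 0 and B = 0, OF \<alpha>\<beta>(1) Gint] by blast
  have W0: "g \<beta> * p \<beta> - q \<beta> * v \<beta> = 0" if v: "solution_on I v p (\<lambda>_. 0)" "ip G v = 0" for v p
  proof -
    have "g \<beta> * p \<beta> - q \<beta> * v \<beta> = (LINT t:{\<alpha>..<\<beta>}|M. r t * (G t * v t - g t * 0))"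
      using primitive_onD(2)[OF solution_on_Lagrange[OF g(1) v(1) order_refl interval_J] \<alpha>\<beta>(1,2)] \<alpha>\<beta>(3) g(2,3)
      by simp
    also have "\<dots> = (LINT t:{\<alpha>..<\<beta>}|M. r t * (G t * v t))" by simp
    also have "\<dots> = ip G v"
      unfolding ip_def
    proof (rule \<rho>_integral_Ico[OF \<alpha>\<beta>(1,2)])
      have "primitive_on M I v (\<lambda>t. s t * p t)" using v by (simp add: solution_on_def)
      then have "L2\<rho> (trunc \<alpha> \<beta> v)" by (rule L2_trunc_primitive) (use \<alpha>\<beta> in auto)
      from L2_mult_integrable[OF G(1) this]
      have "set_integrable \<rho> I (\<lambda>t. G t * trunc \<alpha> \<beta> v t)" .
      moreover have "G t * trunc \<alpha> \<beta> v t = G t * v t" for t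
        using G(2)[of t] by (auto simp: trunc_def)
      ultimately show "set_integrable \<rho> I (\<lambda>t. G t * v t)" by simp
      fix t assume "t \<notin> {\<alpha>..<\<beta>}"
      then show "G t * v t = 0" using G(2)[of t] by auto
    qed
    finally show ?thesis using v(2) by simp
  qed
  have "g \<beta> = 0 \<and> q \<beta> = 0"
    by (rule Wronskian_elimination[OF W0[OF u(1) orth(1)] W0[OF u(2) orth(2)] W])
  then have \<beta>0: "g \<beta> = 0" "q \<beta> = 0" by auto
  have "g t = 0 \<and> q t = 0" if t: "t \<in> I" "t \<notin> {\<alpha><..<\<beta>}" for t
  proof (cases "t \<le> \<alpha>")
    case True
    show ?thesis
      by (rule solution_restrict_zero[OF g(1) t(1) \<alpha>\<beta>(1) _ _ g(2,3)]) (use True G(2) in auto)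
  next
    case False
    then have "\<beta> \<le> t" using t(2) by simp
    then show ?thesis
      by (intro solution_restrict_zero[OF g(1) \<alpha>\<beta>(2) t(1) _ _ \<beta>0]) (use G(2) in auto)
  qed
  then show thesis using that g(1) by blast
qed

text \<open>On each compact interval the pairing condition identifies \<open>u - F\<close> with a
  homogeneous solution, almost everywhere. It remains to see that the same homogeneous solution
  occurs on all intervals.\<close>

lemma adjoint_solution:
  assumes u: "L2\<rho> u" and v: "L2\<rho> v"
    and adj: "\<And>g q G \<alpha> \<beta>. solution_on I g q G \<Longrightarrow> L2\<rho> G \<Longrightarrow> \<alpha> \<in> I \<Longrightarrow> \<beta> \<in> I \<Longrightarrow> \<alpha> < \<beta> \<Longrightarrow>
      (\<And>t. t \<in> I \<Longrightarrow> t \<notin> {\<alpha><..<\<beta>} \<Longrightarrow> g t = 0 \<and> q t = 0) \<Longrightarrow> ip G u = ip g v"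
  obtains f q where "solution_on I f q v" "AE t in \<rho>. t \<in> I \<longrightarrow> u t = f t"
proof -
  have int: "set_integrable M {x..<y} (\<lambda>t. r t * v t)" if "x \<in> I" "y \<in> I" for x y
    by (rule ploc_int_weighted(1)[OF weighted_data(1) L2_ploc_int[OF v] that])
  obtain F Q where F: "solution_on I F Q v"
    using global_existence[where A = 0 and B = 0, OF c int] by blast
  have int0: "set_integrable M {x..<y} (\<lambda>t. r t * 0)" for x y by (simp add: set_integrable_def)
  obtain u1 p1 where u1: "solution_on I u1 p1 (\<lambda>_. 0)" "u1 c = 1" "p1 c = 0"
    using global_existence[where A = 1 and B = 0, OF c int0] by blast
  obtain u2 p2 where u2: "solution_on I u2 p2 (\<lambda>_. 0)" "u2 c = 0" "p2 c = 1"
    using global_existence[where A = 0 and B = 1, OF c int0] by blast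
  have W: "u1 x * p2 x - p1 x * u2 x = 1" if "x \<in> I" for x
    using Wronskian_const[OF u1(1) u2(1) order_refl interval_J that c] u1 u2 by simp
  have prim: "primitive_on M I F (\<lambda>t. s t * Q t)" "primitive_on M I u1 (\<lambda>t. s t * p1 t)"
    "primitive_on M I u2 (\<lambda>t. s t * p2 t)"
    using F u1 u2 by (auto simp: solution_on_def)
  have local_rep: "\<exists>C1 C2. AE t in \<rho>. t \<in> {\<alpha><..<\<beta>} \<longrightarrow> u t = F t + (C1 * u1 t + C2 * u2 t)"
    if \<alpha>\<beta>: "\<alpha> \<in> I" "\<beta> \<in> I" "\<alpha> < \<beta>" for \<alpha> \<beta>
  proof -
    let ?T = "trunc \<alpha> \<beta>"
    have L: "L2\<rho> (?T u1)" "L2\<rho> (?T u2)" "L2\<rho> (?T F)" "L2\<rho> (?T u)"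
      using prim \<alpha>\<beta> by (auto intro: L2_trunc_primitive L2_trunc[OF u])
    define w where "w t = ?T u t - ?T F t" for t
    have w: "L2\<rho> w" unfolding w_def[abs_def] by (intro L2_diff L)
    have sub: "{\<alpha><..<\<beta>} \<subseteq> I" using Icc_subset_Iab[OF \<alpha>\<beta>(1,2)] by (auto simp: subset_iff)
    have ker: "ip G w = 0"
      if G: "L2\<rho> G" and G0': "\<And>t. ?T u1 t = 0 \<Longrightarrow> ?T u2 t = 0 \<Longrightarrow> w t = 0 \<Longrightarrow> G t = 0"
        and orth: "ip G (?T u1) = 0" "ip G (?T u2) = 0" for G
    proof -
      have G0: "G t = 0" if "t \<notin> {\<alpha><..<\<beta>}" for t
        by (rule G0') (use that in \<open>auto simp: trunc_def w_def\<close>)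
      have GT: "G t * ?T h t = G t * h t" for h t using G0[of t] by (auto simp: trunc_def)
      have ipT: "ip G (?T h) = ip G h" for h by (rule ip_cong) (rule GT)
      have orth': "ip G u1 = 0" "ip G u2 = 0" using orth by (simp_all add: ipT)
      obtain g q where g: "solution_on I g q G" "\<And>t. t \<in> I \<Longrightarrow> t \<notin> {\<alpha><..<\<beta>} \<Longrightarrow> g t = 0 \<and> q t = 0"
        by (rule compactly_supported_solution[OF \<alpha>\<beta> G G0 u1(1) u2(1) W[OF \<alpha>\<beta>(2)] orth'], assumption, rule that)
      have gT: "?T g t * v t = g t * v t" if "t \<in> I" for t using g(2)[OF that] by (auto simp: trunc_def)
      have Lg: "L2\<rho> (?T g)"
        using g(1) \<alpha>\<beta> by (intro L2_trunc_primitive[of g "\<lambda>t. s t * q t"]) (auto simp: solution_on_def)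
      have ends: "g \<alpha> = 0" "q \<alpha> = 0" "g \<beta> = 0" "q \<beta> = 0" using g(2)[of \<alpha>] g(2)[of \<beta>] \<alpha>\<beta> by auto
      have ints: "set_integrable \<rho> I (\<lambda>t. G t * ?T F t)" "set_integrable \<rho> I (\<lambda>t. ?T g t * v t)"
        by (intro L2_mult_integrable G L Lg v)+
      \<comment> \<open>The Lagrange identity for \<open>g\<close> and \<open>F\<close>, without
        boundary terms because \<open>g\<close> and \<open>q\<close> vanish at both ends.\<close>
      have "0 = (LINT t:{\<alpha>..<\<beta>}|M. r t * (G t * F t - g t * v t))"
        using primitive_onD(2)[OF solution_on_Lagrange[OF g(1) F order_refl interval_J] \<alpha>\<beta>(1,2)] \<alpha>\<beta>(3) ends
        by simp
      also have "\<dots> = (LINT t:{\<alpha>..<\<beta>}|M. r t * (G t * ?T F t - ?T g t * v t))"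
      proof (rule set_lebesgue_integral_cong)
        show "\<forall>t. t \<in> {\<alpha>..<\<beta>} \<longrightarrow> r t * (G t * F t - g t * v t) = r t * (G t * ?T F t - ?T g t * v t)"
        proof (intro allI impI)
          fix t assume "t \<in> {\<alpha>..<\<beta>}"
          then have "t \<in> I" using Ico_subset_I[OF \<alpha>\<beta>(1,2)] by blast
          then show "r t * (G t * F t - g t * v t) = r t * (G t * ?T F t - ?T g t * v t)"
            unfolding GT by (simp only: gT)
        qed
      qed simp
      also have "\<dots> = (LINT t:I|\<rho>. G t * ?T F t - ?T g t * v t)"
        by (rule \<rho>_integral_Ico[OF \<alpha>\<beta>(1,2) set_integral_diff(1)[OF ints]]) (use G0 in \<open>auto simp: trunc_def\<close>)
      also have "\<dots> = ip G (?T F) - ip (?T g) v"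
        unfolding ip_def by (rule set_integral_diff(2)[OF ints])
      finally have "ip G (?T F) = ip (?T g) v" by simp
      also have "\<dots> = ip g v" by (rule ip_cong) (rule gT)
      also have "\<dots> = ip G u" by (rule adj[OF g(1) G \<alpha>\<beta> g(2), symmetric])
      also have "\<dots> = ip G (?T u)" by (rule ipT[symmetric])
      finally show "ip G w = 0"
        unfolding w_def[abs_def] ip_diff_right[OF G L(4,3)] by simp
    qed
    obtain C1 C2 where "AE t in \<rho>. t \<in> I \<longrightarrow> w t = C1 * ?T u1 t + C2 * ?T u2 t"
      by (rule kernel_argument[OF L(1,2) w ker])
    then have "AE t in \<rho>. t \<in> {\<alpha><..<\<beta>} \<longrightarrow> u t = F t + (C1 * u1 t + C2 * u2 t)"
      by eventually_elim (use sub in \<open>auto simp: w_def trunc_def algebra_simps\<close>)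
    then show ?thesis by blast
  qed
  \<comment> \<open>A reference interval with two points of the support in its interior: on it the
    coefficients of \<open>u1\<close> and \<open>u2\<close> are unique.\<close>
  obtain x0 x1 y1 y0 where xy: "x0 \<in> I" "y0 \<in> I" "x1 \<in> psupp a b \<rho>" "y1 \<in> psupp a b \<rho>"
    "x0 < x1" "x1 < y1" "y1 < y0"
    by (rule support_interior_interval)
  have "x0 < y0" using xy by simp
  obtain C1 C2 where C: "AE t in \<rho>. t \<in> {x0<..<y0} \<longrightarrow> u t = F t + (C1 * u1 t + C2 * u2 t)"
    using local_rep[OF xy(1,2) \<open>x0 < y0\<close>] by blast
  define f where "f t = F t + (C1 * u1 t + C2 * u2 t)" for t
  define q where "q t = Q t + (C1 * p1 t + C2 * p2 t)" for t
  have "solution_on I f q (\<lambda>t. v t + (C1 * 0 + C2 * 0))"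
    unfolding f_def[abs_def] q_def[abs_def] by (intro solution_on_add solution_on_cmult F u1 u2)
  then have f: "solution_on I f q v" by simp
  have "AE t in \<rho>. t \<in> {x<..<y} \<longrightarrow> u t = f t" if "x \<in> I" "y \<in> I" for x y
  proof -
    \<comment> \<open>Every interval is enlarged to include the reference interval.\<close>
    define \<alpha> \<beta> where "\<alpha> = min x x0" "\<beta> = max y y0"
    have \<alpha>\<beta>: "\<alpha> \<in> I" "\<beta> \<in> I" "\<alpha> < \<beta>" using that xy \<open>x0 < y0\<close> by (auto simp: \<alpha>_\<beta>_def min_def max_def)
    obtain D1 D2 where D: "AE t in \<rho>. t \<in> {\<alpha><..<\<beta>} \<longrightarrow> u t = F t + (D1 * u1 t + D2 * u2 t)"
      using local_rep[OF \<alpha>\<beta>] by blast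
    \<comment> \<open>The two representations differ by a homogeneous solution that is \<rho>-null
      on the reference interval. It vanishes identically, and its data at \<open>c\<close> are the
      differences of the coefficients.\<close>
    let ?e = "\<lambda>t. (C1 - D1) * u1 t + (C2 - D2) * u2 t" and ?m = "\<lambda>t. (C1 - D1) * p1 t + (C2 - D2) * p2 t"
    have "solution_on I ?e ?m (\<lambda>t. (C1 - D1) * 0 + (C2 - D2) * 0)"
      by (intro solution_on_add solution_on_cmult u1 u2)
    then have e: "solution_on I ?e ?m (\<lambda>_. 0)" by simp
    have e0: "AE t in \<rho>. t \<in> {x0<..<y0} \<longrightarrow> ?e t = 0"
      using C D by eventually_elim (auto simp: \<alpha>_\<beta>_def algebra_simps)
    have "in_Dtau a b \<rho> \<sigma> \<kappa> c ?e"
      by (rule solution_unique_data(1)[OF e ploc_int_const[OF weighted_data(1)]])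
    from vanishing_point[OF e xy(1,2) e0 this xy(3-7)]
    obtain z where "z \<in> I" "?e z = 0" "?m z = 0" by blast
    from solution_on_unique_zero[OF e order_refl interval_J this c]
    have CD: "C1 = D1" "C2 = D2" using u1 u2 by auto
    from D show ?thesis
      by eventually_elim (auto simp: f_def \<alpha>_\<beta>_def CD)
  qed
  then have "AE t in \<rho>. t \<in> I \<longrightarrow> u t = f t"
    by (intro AE_locally) (meson Iab_neighbours)
  then show thesis by (rule that[OF f])
qed

section \<open>Limits at the endpoints of (a,b)\<close>

lemma eventually_right_end:
  assumes "u \<in> I"
  shows "eventually (\<lambda>y. u < y \<and> y \<in> I) (right_end b)" "right_end b \<noteq> bot"
proof -
  have au: "a < ereal u" "ereal u < b" using assms by (auto simp: Iab_def)
  have mem: "y \<in> I" if "u < y" "ereal y < b" for y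
    using that au less_trans[of a "ereal u" "ereal y"] by (simp add: Iab_def)
  show "eventually (\<lambda>y. u < y \<and> y \<in> I) (right_end b)"
  proof (cases b)
    case (real b')
    then have "u < b'" using au by simp
    from eventually_at_left_real[OF this] have "eventually (\<lambda>y. u < y \<and> y \<in> I) (at_left b')"
    proof eventually_elim
      case (elim y)
      then show ?case using mem[of y] by (auto simp: real)
    qed
    then show ?thesis by (simp add: right_end_def real)
  next
    case PInf
    have "eventually (\<lambda>y. u < y \<and> y \<in> I) at_top"
      using eventually_gt_at_top[of u]
    proof eventually_elim
      case (elim y)
      then show ?case using mem[of y] by (auto simp: PInf)
    qed
    then show ?thesis by (simp add: right_end_def PInf)
  qed (use au in simp)
  show "right_end b \<noteq> bot" by (simp add: right_end_def)
qed

lemma eventually_left_end: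
  assumes "u \<in> I"
  shows "eventually (\<lambda>y. y < u \<and> y \<in> I) (left_end a)" "left_end a \<noteq> bot"
proof -
  have au: "a < ereal u" "ereal u < b" using assms by (auto simp: Iab_def)
  have mem: "y \<in> I" if "y < u" "a < ereal y" for y
    using that au less_trans[of "ereal y" "ereal u" b] by (simp add: Iab_def)
  show "eventually (\<lambda>y. y < u \<and> y \<in> I) (left_end a)"
  proof (cases a)
    case (real a')
    then have "a' < u" using au by simp
    from eventually_at_right_real[OF this] have "eventually (\<lambda>y. y < u \<and> y \<in> I) (at_right a')"
    proof eventually_elim
      case (elim y)
      then show ?case using mem[of y] by (auto simp: real)
    qed
    then show ?thesis by (simp add: left_end_def real)
  next
    case MInf
    have "eventually (\<lambda>y. y < u \<and> y \<in> I) at_bot"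
      using eventually_gt_at_bot[of u]
    proof eventually_elim
      case (elim y)
      then show ?case using mem[of y] by (auto simp: MInf)
    qed
    then show ?thesis by (simp add: left_end_def MInf)
  qed (use au in simp)
  show "left_end a \<noteq> bot" by (simp add: left_end_def)
qed

context
  fixes h :: "real \<Rightarrow> complex"
  assumes h: "set_integrable \<rho> I h"
begin

lemma h_subset: "A \<in> sets borel \<Longrightarrow> A \<subseteq> I \<Longrightarrow> set_integrable \<rho> A h"
  using h by (rule set_integrable_subset) auto

lemma tail_small:
  assumes A: "\<And>i::nat. A i \<in> sets borel" "\<And>i. A i \<subseteq> I" "decseq A" "(\<Inter>i. A i) = {}" and e: "e > 0"
  obtains i where "\<And>B. B \<in> sets borel \<Longrightarrow> B \<subseteq> A i \<Longrightarrow> norm (LINT t:B|\<rho>. h t) < e"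
proof -
  have "(\<lambda>i. LINT t:A i|\<rho>. norm (h t)) \<longlonglongrightarrow> (LINT t:(\<Inter>i. A i)|\<rho>. norm (h t))"
    by (rule set_integral_cont_down) (use A set_integrable_norm[OF h_subset] in auto)
  then have "(\<lambda>i. LINT t:A i|\<rho>. norm (h t)) \<longlonglongrightarrow> 0"
    unfolding A(4) by (simp add: set_lebesgue_integral_def)
  then obtain i where i: "(LINT t:A i|\<rho>. norm (h t)) < e"
    using order_tendstoD(2)[OF _ e] eventually_happens[of _ sequentially] by (metis sequentially_bot)
  have "norm (LINT t:B|\<rho>. h t) < e" if B: "B \<in> sets borel" "B \<subseteq> A i" for B
  proof -
    have "norm (LINT t:B|\<rho>. h t) \<le> (LINT t:B|\<rho>. norm (h t))"
      by (rule set_integral_norm_bound[OF h_subset]) (use B A in auto)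
    also have "\<dots> \<le> (LINT t:A i|\<rho>. norm (h t))"
      unfolding set_lebesgue_integral_def
    proof (rule integral_mono)
      show "integrable \<rho> (\<lambda>t. indicator B t *\<^sub>R norm (h t))" "integrable \<rho> (\<lambda>t. indicator (A i) t *\<^sub>R norm (h t))"
        using set_integrable_norm[OF h_subset[of B]] set_integrable_norm[OF h_subset[of "A i"]] A(1,2)[of i] B
        unfolding set_integrable_def by auto
      show "indicator B t *\<^sub>R norm (h t) \<le> indicator (A i) t *\<^sub>R norm (h t)" for t
        using B(2) by (auto simp: indicator_def)
    qed
    finally show ?thesis using i by simp
  qed
  then show thesis by (rule that)
qed

text \<open>Up to a constant, \<open>W\<close> is the integral \<Phi> of \<open>h\<close> over the
  part of (a,b) to the left of the argument. \<Phi> tends to 0 at \<open>a\<close> and to the full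
  integral at \<open>b\<close>; both limits exist, so \<open>Lim\<close> has its intended
  meaning.\<close>

lemma boundary_limits:
  assumes prim: "primitive_on M I W (\<lambda>t. r t * h t)" and V: "\<And>t. t \<in> I \<Longrightarrow> V t = W t"
  shows "Lim (right_end b) V - Lim (left_end a) V = (LINT t:I|\<rho>. h t)"
proof -
  obtain l u where lu: "I = (\<Union>i::nat. {l i..u i})" "incseq u" "decseq l" "\<And>i. l i < u i"
    "\<And>i. l i \<in> I" "\<And>i. u i \<in> I"
    by (rule Iab_exhaustion[OF a_less_b], rule that)
  define \<Phi> where "\<Phi> y = (LINT t:I \<inter> {..<y}|\<rho>. h t)" for y
  define C where "C = W c - \<Phi> c"
  have step: "W y - W x = \<Phi> y - \<Phi> x" if xy: "x \<in> I" "y \<in> I" "x \<le> y" for x y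
  proof -
    have sub: "{x..<y} \<subseteq> I" by (rule Ico_subset_I[OF xy(1,2)])
    have eq: "I \<inter> {..<y} = (I \<inter> {..<x}) \<union> {x..<y}" using sub xy by auto
    have "\<Phi> y = \<Phi> x + (LINT t:{x..<y}|\<rho>. h t)"
      unfolding \<Phi>_def eq by (rule set_integral_Un) (use h_subset sub in auto)
    moreover have "W y - W x = (LINT t:{x..<y}|\<rho>. h t)"
      using primitive_onD(2)[OF prim xy] weighted_integral[OF weighted_data(1) sub h_subset[OF _ sub]] by simp
    ultimately show ?thesis by simp
  qed
  have WC: "V y = C + \<Phi> y" if "y \<in> I" for y
    using step[OF c that] step[OF that c] V[OF that] by (cases "c \<le> y") (auto simp: C_def algebra_simps)
  have 1: "(\<Phi> \<longlongrightarrow> (LINT t:I|\<rho>. h t)) (right_end b)"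
  proof (rule tendstoI)
    fix e :: real assume e: "e > 0"
    define A where "A i = I \<inter> {u i<..}" for i
    obtain i where i: "\<And>B. B \<in> sets borel \<Longrightarrow> B \<subseteq> A i \<Longrightarrow> norm (LINT t:B|\<rho>. h t) < e"
    proof (rule tail_small[OF _ _ _ _ e, of A])
      show "decseq A" using lu(2) by (force simp: A_def decseq_def incseq_def)
      show "(\<Inter>i. A i) = {}"
        using lu(1) by (auto simp: A_def) (meson atLeastAtMost_iff not_le)
    qed (auto simp: A_def)
    show "eventually (\<lambda>y. dist (\<Phi> y) (LINT t:I|\<rho>. h t) < e) (right_end b)"
      using eventually_right_end(1)[OF lu(6)[of i]]
    proof eventually_elim
      case (elim y)
      have eq: "I = (I \<inter> {..<y}) \<union> (I \<inter> {y..})" by auto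
      have "(LINT t:I|\<rho>. h t) = \<Phi> y + (LINT t:I \<inter> {y..}|\<rho>. h t)"
        unfolding \<Phi>_def by (subst eq, rule set_integral_Un) (use h_subset in auto)
      moreover have "norm (LINT t:I \<inter> {y..}|\<rho>. h t) < e"
        by (rule i) (use elim in \<open>auto simp: A_def\<close>)
      ultimately show ?case by (simp add: dist_norm norm_minus_commute)
    qed
  qed
  have 2: "(\<Phi> \<longlongrightarrow> 0) (left_end a)"
  proof (rule tendstoI)
    fix e :: real assume e: "e > 0"
    define A where "A i = I \<inter> {..<l i}" for i
    obtain i where i: "\<And>B. B \<in> sets borel \<Longrightarrow> B \<subseteq> A i \<Longrightarrow> norm (LINT t:B|\<rho>. h t) < e"
    proof (rule tail_small[OF _ _ _ _ e, of A])
      show "decseq A" using lu(3) by (force simp: A_def decseq_def)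
      show "(\<Inter>i. A i) = {}"
        using lu(1) by (auto simp: A_def) (meson atLeastAtMost_iff not_le)
    qed (auto simp: A_def)
    show "eventually (\<lambda>y. dist (\<Phi> y) 0 < e) (left_end a)"
      using eventually_left_end(1)[OF lu(5)[of i]]
    proof eventually_elim
      case (elim y)
      have "norm (LINT t:I \<inter> {..<y}|\<rho>. h t) < e"
        by (rule i) (use elim in \<open>auto simp: A_def\<close>)
      then show ?case by (simp add: \<Phi>_def)
    qed
  qed
  have "(V \<longlongrightarrow> C + (LINT t:I|\<rho>. h t)) (right_end b)"
  proof (rule Lim_transform_eventually[OF tendsto_add[OF tendsto_const[of C] 1]])
    show "eventually (\<lambda>y. C + \<Phi> y = V y) (right_end b)"
      using eventually_right_end(1)[OF c] by eventually_elim (simp add: WC)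
  qed
  from tendsto_Lim[OF eventually_right_end(2)[OF c] this]
  have R: "Lim (right_end b) V = C + (LINT t:I|\<rho>. h t)" .
  have "(V \<longlongrightarrow> C + 0) (left_end a)"
  proof (rule Lim_transform_eventually[OF tendsto_add[OF tendsto_const[of C] 2]])
    show "eventually (\<lambda>y. C + \<Phi> y = V y) (left_end a)"
      using eventually_left_end(1)[OF c] by eventually_elim (simp add: WC)
  qed
  from tendsto_Lim[OF eventually_left_end(2)[OF c] this]
  have "Lim (left_end a) V = C" by simp
  then show ?thesis using R by simp
qed

end

section \<open>The maximal relation and its self-adjoint restrictions\<close>

abbreviation "T \<equiv> Tmax a b \<rho> \<sigma> \<kappa> c"

lemma TmaxD:
  assumes "f \<in> T"
  shows "solution_on I f (qd f) (\<tau> f)" "L2\<rho> f" "L2\<rho> (\<tau> f)" "x \<notin> I \<Longrightarrow> f x = 0"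
  using assms in_Dtau_solution(1)[of f] by (auto simp: Tmax_def)

text \<open>Supplies the normalisation outside (a,b). Since \<open>\<tau> f'\<close> is a chosen
  representative, it equals \<open>G\<close> only almost everywhere, and its measurability comes
  from local integrability.\<close>

lemma Tmax_restrict:
  assumes sol: "solution_on I f q G" and f: "L2\<rho> f" and G: "L2\<rho> G"
  defines "f' \<equiv> \<lambda>t. if t \<in> I then f t else 0"
  shows "f' \<in> T" "x \<in> I \<Longrightarrow> qd f' x = q x" "AE t in \<rho>. t \<in> I \<longrightarrow> \<tau> f' t = G t"
proof -
  have sol': "solution_on I f' q G"
    by (rule solution_on_cong[OF sol interval_J]) (auto simp: f'_def)
  note d = solution_unique_data[OF sol' L2_ploc_int[OF G]]
  show "x \<in> I \<Longrightarrow> qd f' x = q x" by (rule d(2))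
  show \<tau>: "AE t in \<rho>. t \<in> I \<longrightarrow> \<tau> f' t = G t" by (rule d(3))
  have "L2\<rho> f'"
  proof (rule L2_cong_AE[OF f])
    have "(\<lambda>t. indicator I t *\<^sub>R f' t) = (\<lambda>t. indicator I t *\<^sub>R f t)" by (auto simp: f'_def indicator_def)
    then show "(\<lambda>t. indicator I t *\<^sub>R f' t) \<in> borel_measurable \<rho>" using L2D(1)[OF f] by simp
  qed (auto simp: f'_def)
  moreover have "L2\<rho> (\<tau> f')"
  proof -
    have m: "(\<lambda>t. indicator I t *\<^sub>R \<tau> f' t) \<in> borel_measurable \<rho>"
      by (rule ploc_int_borel[OF in_Dtau_solution(2)[OF d(1)]])
    show ?thesis
      by (rule L2_cong_AE[OF G m]) (use \<tau> in \<open>auto elim: eventually_mono\<close>)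
  qed
  ultimately show "f' \<in> T" using d(1) by (simp add: Tmax_def f'_def)
qed

text \<open>\<open>quasi\<close> involves a choice, so its compatibility with conjugation rests on
  uniqueness.\<close>

lemma Wr_cnj:
  assumes "f \<in> T" "g \<in> T" "x \<in> I"
  shows "Wr a b \<rho> \<sigma> \<kappa> c f (\<lambda>x. cnj (g x)) x = f x * cnj (qd g x) - qd f x * cnj (g x)"
proof -
  have "qd (\<lambda>x. cnj (g x)) x = cnj (qd g x)"
    by (rule solution_unique_data(2)[OF solution_on_cnj[OF TmaxD(1)[OF assms(2)]]
        L2_ploc_int[OF L2_cnj[OF TmaxD(3)[OF assms(2)]]] assms(3)])
  then show ?thesis by (simp add: Wr_def)
qed

lemma Lagrange_identity:
  assumes f: "f \<in> T" and g: "g \<in> T"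
  shows "Wab a b \<rho> \<sigma> \<kappa> c f (\<lambda>x. cnj (g x)) = inner2 a b \<rho> (\<tau> f) g - inner2 a b \<rho> f (\<tau> g)"
proof -
  note F = TmaxD[OF f] and G = TmaxD[OF g]
  let ?h = "\<lambda>t. \<tau> f t * cnj (g t) - f t * cnj (\<tau> g t)"
  have i: "set_integrable \<rho> I (\<lambda>t. \<tau> f t * cnj (g t))" "set_integrable \<rho> I (\<lambda>t. f t * cnj (\<tau> g t))"
    by (intro L2_mult_integrable L2_cnj F G)+
  have "Wab a b \<rho> \<sigma> \<kappa> c f (\<lambda>x. cnj (g x)) = (LINT t:I|\<rho>. ?h t)"
    unfolding Wab_def
    by (rule boundary_limits[OF set_integral_diff(1)[OF i]
          solution_on_Lagrange[OF F(1) solution_on_cnj[OF G(1)] order_refl interval_J] Wr_cnj[OF f g]])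
  also have "\<dots> = inner2 a b \<rho> (\<tau> f) g - inner2 a b \<rho> f (\<tau> g)"
    unfolding set_integral_diff(2)[OF i] inner2_def by (simp add: mult.commute)
  finally show ?thesis .
qed

lemma inner2_cong_AE:
  assumes "L2\<rho> f" "L2\<rho> f'" "L2\<rho> g" "AE t in \<rho>. t \<in> I \<longrightarrow> f t = f' t"
  shows "inner2 a b \<rho> f g = inner2 a b \<rho> f' g"
  unfolding inner2_ip by (rule ip_cong_AE) (use assms L2_cnj in auto)

text \<open>The injectivity that justifies treating elements of \<open>Tmax\<close> as functions;
  outside (a,b) the normalisation gives equality.\<close>

lemma Tmax_eq_AE:
  assumes f: "f \<in> T" and g: "g \<in> T" and eq: "AE t in \<rho>. t \<in> I \<longrightarrow> f t = g t" "AE t in \<rho>. t \<in> I \<longrightarrow> \<tau> f t = \<tau> g t"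
  shows "f = g"
proof
  fix x
  have "f x - g x = 0" if x: "x \<in> I"
  proof (rule solution_ae_zero[OF solution_on_diff[OF TmaxD(1)[OF f] TmaxD(1)[OF g]] _ _ _ x])
    show "ploc_int a b \<rho> (\<lambda>x. \<tau> f x - \<tau> g x)" by (intro L2_ploc_int L2_diff TmaxD f g)
  qed (use eq in \<open>auto elim: eventually_mono\<close>)
  then show "f x = g x" using TmaxD(4)[OF f] TmaxD(4)[OF g] by (cases "x \<in> I") auto
qed

lemma Wab_compact_support:
  assumes f: "f \<in> T" and \<alpha>\<beta>: "\<alpha> \<in> I" "\<beta> \<in> I" and g: "g \<in> T"
    and zero: "\<And>t. t \<in> I \<Longrightarrow> t \<notin> {\<alpha><..<\<beta>} \<Longrightarrow> f t = 0 \<and> qd f t = 0"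
  shows "Wab a b \<rho> \<sigma> \<kappa> c f (\<lambda>x. cnj (g x)) = 0"
proof -
  let ?W = "Wr a b \<rho> \<sigma> \<kappa> c f (\<lambda>x. cnj (g x))"
  have "eventually (\<lambda>y. ?W y = 0) (right_end b)"
    using eventually_right_end(1)[OF \<alpha>\<beta>(2)] by eventually_elim (use zero in \<open>simp add: Wr_cnj[OF f g]\<close>)
  then have "Lim (right_end b) ?W = 0"
    by (intro tendsto_Lim eventually_right_end(2)[OF c] tendsto_eventually)
  moreover have "eventually (\<lambda>y. ?W y = 0) (left_end a)"
    using eventually_left_end(1)[OF \<alpha>\<beta>(1)] by eventually_elim (use zero in \<open>simp add: Wr_cnj[OF f g]\<close>)
  then have "Lim (left_end a) ?W = 0"
    by (intro tendsto_Lim eventually_left_end(2)[OF c] tendsto_eventually)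
  ultimately show ?thesis by (simp add: Wab_def)
qed

text \<open>\<open>closed\<close> is one inclusion of the boundary condition. It puts all compactly
  supported elements of \<open>Tmax\<close> into \<open>S\<close>, since their boundary form with
  any element of \<open>Tmax\<close> is 0, and these are the test functions for
  \<open>adjoint_solution\<close>.\<close>

lemma adjoint_in_Tmax:
  assumes S: "S \<subseteq> T" and closed: "\<And>f. f \<in> T \<Longrightarrow> (\<And>g. g \<in> S \<Longrightarrow> Wab a b \<rho> \<sigma> \<kappa> c f (\<lambda>x. cnj (g x)) = 0) \<Longrightarrow> f \<in> S"
    and u: "L2\<rho> u" and v: "L2\<rho> v"
    and adj: "\<And>g. g \<in> S \<Longrightarrow> inner2 a b \<rho> u (\<tau> g) = inner2 a b \<rho> v g"
  obtains f where "f \<in> T" "AE t in \<rho>. t \<in> I \<longrightarrow> u t = f t" "AE t in \<rho>. t \<in> I \<longrightarrow> v t = \<tau> f t"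
proof -
  have "\<exists>f q. solution_on I f q v \<and> (AE t in \<rho>. t \<in> I \<longrightarrow> u t = f t)"
  proof (rule adjoint_solution[OF u v])
    fix g q G \<alpha> \<beta>
    assume g: "solution_on I g q G" and G: "L2\<rho> G" and \<alpha>\<beta>: "\<alpha> \<in> I" "\<beta> \<in> I" "\<alpha> < \<beta>"
      and zero: "\<And>t. t \<in> I \<Longrightarrow> t \<notin> {\<alpha><..<\<beta>} \<Longrightarrow> g t = 0 \<and> q t = 0"
    have "primitive_on M I g (\<lambda>t. s t * q t)" using g by (simp add: solution_on_def)
    then have "L2\<rho> (trunc \<alpha> \<beta> g)" by (rule L2_trunc_primitive) (use \<alpha>\<beta> in auto)
    moreover have "(\<lambda>t. indicator I t *\<^sub>R g t) \<in> borel_measurable \<rho>"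
      using g by (intro primitive_borel_I[of g "\<lambda>t. s t * q t"]) (simp add: solution_on_def)
    moreover have "AE t in \<rho>. t \<in> I \<longrightarrow> trunc \<alpha> \<beta> g t = g t"
      using zero by (intro AE_I2) (auto simp: trunc_def)
    ultimately have Lg: "L2\<rho> g" by (rule L2_cong_AE)
    \<comment> \<open>Conjugated because \<open>inner2\<close> conjugates its second argument
      whereas \<open>adjoint_solution\<close> uses the bilinear pairing, and cut off to meet the
      normalisation of \<open>Tmax\<close>.\<close>
    define g' where "g' t = (if t \<in> I then cnj (g t) else 0)" for t
    note g' = Tmax_restrict[OF solution_on_cnj[OF g] L2_cnj[OF Lg] L2_cnj[OF G], folded g'_def]
    have "g' \<in> S"
    proof (rule closed[OF g'(1)])
      fix h assume "h \<in> S"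
      then show "Wab a b \<rho> \<sigma> \<kappa> c g' (\<lambda>x. cnj (h x)) = 0"
        using S zero g'(2) by (intro Wab_compact_support[OF g'(1) \<alpha>\<beta>(1,2)]) (auto simp: g'_def)
    qed
    from adj[OF this] have "ip (\<lambda>t. cnj (\<tau> g' t)) u = ip (\<lambda>t. cnj (g' t)) v" by (simp add: inner2_ip)
    moreover have "ip (\<lambda>t. cnj (\<tau> g' t)) u = ip G u"
      by (rule ip_cong_AE[OF L2_cnj[OF TmaxD(3)[OF g'(1)]] G u u])
        (use g'(3) in \<open>auto elim!: eventually_mono\<close>)
    moreover have "ip (\<lambda>t. cnj (g' t)) v = ip g v"
      by (rule ip_cong) (simp add: g'_def)
    ultimately show "ip G u = ip g v" by simp
  qed blast
  then obtain f q where f: "solution_on I f q v" and uf: "AE t in \<rho>. t \<in> I \<longrightarrow> u t = f t" by blast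
  have m: "(\<lambda>t. indicator I t *\<^sub>R f t) \<in> borel_measurable \<rho>"
    using f by (intro primitive_borel_I[of f "\<lambda>t. s t * q t"]) (simp add: solution_on_def)
  have Lf: "L2\<rho> f" by (rule L2_cong_AE[OF u m uf])
  define f' where "f' t = (if t \<in> I then f t else 0)" for t
  note f' = Tmax_restrict[OF f Lf v, folded f'_def]
  show thesis
  proof (rule that[OF f'(1)])
    show "AE t in \<rho>. t \<in> I \<longrightarrow> u t = f' t" using uf by eventually_elim (simp add: f'_def)
    show "AE t in \<rho>. t \<in> I \<longrightarrow> v t = \<tau> f' t" using f'(3) by eventually_elim simp
  qed
qed

lemma self_adjoint_iff:
  assumes S: "S \<subseteq> T"
  shows "self_adjoint a b \<rho> \<sigma> \<kappa> c S \<longleftrightarrow>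
    S = {f \<in> T. \<forall>g\<in>S. Wab a b \<rho> \<sigma> \<kappa> c f (\<lambda>x. cnj (g x)) = 0}" (is "?sa \<longleftrightarrow> S = ?R")
proof
  assume sa: ?sa
  show "S = ?R"
  proof (intro equalityI subsetI)
    fix f assume f: "f \<in> S"
    then have fT: "f \<in> T" using S by blast
    have "\<exists>f'\<in>S. AE x in \<rho>. x \<in> I \<longrightarrow> f x = f' x \<and> \<tau> f x = \<tau> f' x" using f by auto
    then have "\<forall>g\<in>S. inner2 a b \<rho> f (\<tau> g) = inner2 a b \<rho> (\<tau> f) g"
      using sa TmaxD(2,3)[OF fT] unfolding self_adjoint_def by blast
    then show "f \<in> ?R" using fT S by (auto simp: Lagrange_identity subset_iff)
  next
    fix f assume f: "f \<in> ?R"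
    then have fT: "f \<in> T" by simp
    have "\<forall>g\<in>S. inner2 a b \<rho> f (\<tau> g) = inner2 a b \<rho> (\<tau> f) g"
    proof
      fix g assume "g \<in> S"
      then have "Wab a b \<rho> \<sigma> \<kappa> c f (\<lambda>x. cnj (g x)) = 0" "g \<in> T" using f S by auto
      then show "inner2 a b \<rho> f (\<tau> g) = inner2 a b \<rho> (\<tau> f) g" using Lagrange_identity[OF fT] by simp
    qed
    then obtain f' where f': "f' \<in> S" "AE x in \<rho>. x \<in> I \<longrightarrow> f x = f' x \<and> \<tau> f x = \<tau> f' x"
      using sa TmaxD(2,3)[OF fT] unfolding self_adjoint_def by blast
    \<comment> \<open>Self-adjointness yields only a representative \<open>f'\<close> in
      \<open>S\<close> that agrees almost everywhere; injectivity identifies it with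
      \<open>f\<close>.\<close>
    have "f = f'"
      by (rule Tmax_eq_AE[OF fT]) (use f' S in \<open>auto elim: eventually_mono\<close>)
    then show "f \<in> S" using f' by simp
  qed
next
  assume R: "S = ?R"
  have mem: "f \<in> S" if "f \<in> T" "\<And>g. g \<in> S \<Longrightarrow> Wab a b \<rho> \<sigma> \<kappa> c f (\<lambda>x. cnj (g x)) = 0" for f
    by (subst R) (use that in blast)
  have Wab0: "Wab a b \<rho> \<sigma> \<kappa> c f (\<lambda>x. cnj (g x)) = 0" if "f \<in> S" "g \<in> S" for f g
  proof -
    have "f \<in> ?R" using that(1) R by blast
    then show ?thesis using that(2) by blast
  qed
  show ?sa
    unfolding self_adjoint_def
  proof (intro allI impI iffI ballI)
    fix u v g assume L: "L2\<rho> u \<and> L2\<rho> v" and g: "g \<in> S"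
      and "\<exists>f\<in>S. AE x in \<rho>. x \<in> I \<longrightarrow> u x = f x \<and> v x = \<tau> f x"
    then obtain f where f: "f \<in> S" "AE x in \<rho>. x \<in> I \<longrightarrow> u x = f x \<and> v x = \<tau> f x" by blast
    have T: "f \<in> T" "g \<in> T" using f g S by auto
    have "inner2 a b \<rho> u (\<tau> g) = inner2 a b \<rho> f (\<tau> g)"
      by (rule inner2_cong_AE) (use L f(2) TmaxD T in \<open>auto elim: eventually_mono\<close>)
    moreover have "inner2 a b \<rho> v g = inner2 a b \<rho> (\<tau> f) g"
      by (rule inner2_cong_AE) (use L f(2) TmaxD T in \<open>auto elim: eventually_mono\<close>)
    ultimately show "inner2 a b \<rho> u (\<tau> g) = inner2 a b \<rho> v g"
      using Wab0[OF f(1) g] Lagrange_identity[OF T] by simp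
  next
    fix u v assume L: "L2\<rho> u \<and> L2\<rho> v" and adj: "\<forall>g\<in>S. inner2 a b \<rho> u (\<tau> g) = inner2 a b \<rho> v g"
    obtain f where f: "f \<in> T" "AE t in \<rho>. t \<in> I \<longrightarrow> u t = f t" "AE t in \<rho>. t \<in> I \<longrightarrow> v t = \<tau> f t"
      using adjoint_in_Tmax[OF S mem, of u v] L adj by blast
    have "f \<in> S"
    proof (rule mem[OF f(1)])
      fix g assume g: "g \<in> S"
      then have gT: "g \<in> T" using S by blast
      have "inner2 a b \<rho> u (\<tau> g) = inner2 a b \<rho> f (\<tau> g)"
        by (rule inner2_cong_AE) (use L f(2) TmaxD[OF f(1)] TmaxD[OF gT] in auto)
      moreover have "inner2 a b \<rho> v g = inner2 a b \<rho> (\<tau> f) g"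
        by (rule inner2_cong_AE) (use L f(3) TmaxD[OF f(1)] TmaxD[OF gT] in auto)
      ultimately show "Wab a b \<rho> \<sigma> \<kappa> c f (\<lambda>x. cnj (g x)) = 0"
        using Lagrange_identity[OF f(1) gT] adj g by simp
    qed
    moreover have "AE x in \<rho>. x \<in> I \<longrightarrow> u x = f x \<and> v x = \<tau> f x"
      using f(2,3) by eventually_elim simp
    ultimately show "\<exists>f\<in>S. AE x in \<rho>. x \<in> I \<longrightarrow> u x = f x \<and> v x = \<tau> f x" by blast
  qed
qed

end

theorem theorem6p1:
  fixes a b :: ereal and \<rho> :: "real measure" and \<sigma> \<kappa> :: smeasure and c :: real
    and S :: "(real \<Rightarrow> complex) set"
  assumes ab: "a < b" and c: "c \<in> Iab a b"
    and H1: "locfin a b \<rho>"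
    and H2: "real_lf_measure a b \<kappa>"
    and H3: "real_lf_measure a b \<sigma>" "ssupp a b \<sigma> = Iab a b"
    and H4: "\<forall>x\<in>Iab a b. smass \<sigma> x * smass \<kappa> x = 0 \<and> smass \<sigma> x * measure \<rho> {x} = 0"
    and H5: "\<forall>\<alpha> \<beta>. \<alpha> < \<beta> \<and> \<alpha> \<in> psupp a b \<rho> \<and> \<beta> \<in> psupp a b \<rho> \<and>
               {\<alpha><..<\<beta>} \<inter> psupp a b \<rho> = {} \<longrightarrow>
               (\<forall>f. in_Dtau a b \<rho> \<sigma> \<kappa> c f \<and> (f \<longlongrightarrow> 0) (at_left \<alpha>) \<and> (f \<longlongrightarrow> 0) (at_right \<beta>)
                    \<longrightarrow> (\<forall>x\<in>{\<alpha><..<\<beta>}. f x = 0))"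
    and H6: "\<exists>x\<in>psupp a b \<rho>. \<exists>y\<in>psupp a b \<rho>. x \<noteq> y"
    and S: "lin_rel a b \<rho> \<sigma> \<kappa> c S"
  shows "self_adjoint a b \<rho> \<sigma> \<kappa> c S \<longleftrightarrow>
         S = {f \<in> Tmax a b \<rho> \<sigma> \<kappa> c. \<forall>g\<in>S. Wab a b \<rho> \<sigma> \<kappa> c f (\<lambda>x. cnj (g x)) = 0}"
proof -
  \<comment> \<open>The five measures are indexed by integers, so that one application of
    \<open>common_dominating_measure\<close> yields a single \<open>M\<close> with all
    densities.\<close>
  define \<nu> where "\<nu> i = (if i = 0 then \<rho> else if i = 1 then fst \<sigma> else if i = 2 then snd \<sigma>
    else if i = 3 then fst \<kappa> else snd \<kappa>)" for i :: int
  have \<nu>: "\<nu> 0 = \<rho>" "\<nu> 1 = fst \<sigma>" "\<nu> 2 = snd \<sigma>" "\<nu> 3 = fst \<kappa>" "\<nu> 4 = snd \<kappa>"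
    by (simp_all add: \<nu>_def)
  have lf: "locfin a b \<rho>" "locfin a b (fst \<sigma>)" "locfin a b (snd \<sigma>)" "locfin a b (fst \<kappa>)" "locfin a b (snd \<kappa>)"
    using H1 H2 H3(1) by (auto simp: real_lf_measure_def)
  have "locfin a b (\<nu> i)" if "i \<in> {0, 1, 2, 3, 4}" for i
    using that lf by (auto simp: \<nu>)
  then obtain M d where M: "loc_finite_interval M (Iab a b)"
    and d: "\<And>i. i \<in> {0, 1, 2, 3, 4} \<Longrightarrow> density_on a b M (\<nu> i) (d i)"
    using common_dominating_measure[OF ab, of "{0, 1, 2, 3, 4}" \<nu>] by blast
  have dens: "density_on a b M \<rho> (d 0)" "density_on a b M (fst \<sigma>) (d 1)" "density_on a b M (snd \<sigma>) (d 2)"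
    "density_on a b M (fst \<kappa>) (d 3)" "density_on a b M (snd \<kappa>) (d 4)"
    using d[of 0] d[of 1] d[of 2] d[of 3] d[of 4] by (simp_all add: \<nu>)
  obtain A where A: "A \<in> sets borel" "emeasure (fst \<sigma>) (Iab a b - A) = 0" "emeasure (snd \<sigma>) (Iab a b \<inter> A) = 0"
    using H3(1) by (auto simp: real_lf_measure_def)
  have "AE x in M. x \<in> Iab a b \<longrightarrow> d 1 x = 0 \<or> d 2 x = 0"
    by (rule singular_densities[OF dens(2,3) _ _ _ A])
      (use lf M in \<open>auto simp: locfin_def loc_finite_interval_def\<close>)
  then interpret Sturm_Liouville a b \<rho> \<sigma> \<kappa> c M "d 0" "d 1" "d 2" "d 3" "d 4"
    by (intro Sturm_Liouville.intro ab c lf H3(2) H4 H5 H6 M dens)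
  show ?thesis
    by (rule self_adjoint_iff) (use S in \<open>simp add: lin_rel_def\<close>)
qed

end
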